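(* The stage order and the order of the FFCFE$r$ method are $r$ and $2r$ respectively, that is, as $h\to0$, $$u(\tau)-y(t_0+\tau h)=\mathcal{O}(h^{r+1})\quad\text{for }0<\tau<1,$$ and $$u(1)-y(t_0+h)=\mathcal{O}(h^{2r+1}),$$ where $y$ is the exact solution of $y'(t)=f(y(t))$, $y(t_0)=y_0$.
   Context: Setting. $d=2d_1$, $f:\mathbb{R}^d\to\mathbb{R}^d$ and $H:\mathbb{R}^d\to\mathbb{R}$ are sufficiently smooth (may be read as $C^\infty$), $f=J^{-1}\nabla H$, where $J=\begin{pmatrix}O&I\\-I&O\end{pmatrix}$ with $d_1\times d_1$ blocks. The problem to be solved is $y'(t)=f(y(t))$, $y(t_0)=y_0\in\mathbb{R}^d$; $h>0$ is the stepsize. Function spaces. Let $\varphi_0,\ldots,\varphi_{r-1}$ be sufficiently smooth linearly independent real-valued functions of a real variable. For scalar functions $\psi_i$, $\mathrm{span}\{\psi_0,\ldots,\psi_k\}$ denotes the space of $\mathbb{R}^d$-valued functions $\sum_i W_i\psi_i$ with $W_i\in\mathbb{R}^d$. Put $$Y=\mathrm{span}\{\varphi_0(t),\ldots,\varphi_{r-1}(t)\},\qquad X=\mathrm{span}\Big\{1,\int_{t_0}^t\varphi_0(s)\,ds,\ldots,\int_{t_0}^t\varphi_{r-1}(s)\,ds\Big\}.$$ $Y$ is assumed invariant under translation and reflection: if $v(t)\in Y$ then $v(t+c)\in Y$ for every $c\in\mathbb{R}$ and $v(-t)\in Y$. Let $$Y_h=\{v\text{ on }[0,1]: v(\tau)=w(t_0+\tau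 h),\ w\in Y\},\qquad X_h=\{v\text{ on }[0,1]: v(\tau)=w(t_0+\tau h),\ w\in X\}.$$ Write $\langle w_1,w_2\rangle=\int_0^1 w_1(\tau)\cdot w_2(\tau)\,d\tau$, where $\cdot$ is entrywise multiplication for vector-valued functions. FFCFE$r$ method (functionally-fitted continuous finite element method), one step. Variational form: find $u\in X_h$ with $u(0)=y_0$ such that $\langle v,u'\rangle=h\langle v,f\circ u\rangle$ for all $v\in Y_h$; set $y_1=u(1)$. Equivalently, in continuous-stage Runge–Kutta form, $$u(\tau)=y_0+h\int_0^1A_{\tau,\sigma}f(u(\sigma))\,d\sigma,\qquad y_1=u(1),$$ where, with $\tilde\varphi_i(\tau)=\varphi_i(t_0+\tau h)$ and $M=(\langle\tilde\varphi_i,\tilde\varphi_j\rangle)_{0\le i,j\le r-1}$, $$P_{\tau,\sigma}=(\tilde\varphi_0(\tau),\ldots,\tilde\varphi_{r-1}(\tau))M^{-1}(\tilde\varphi_0(\sigma),\ldots,\tilde\varphi_{r-1}(\sigma))^{\intercal},\qquad A_{\tau,\sigma}=\int_0^\tau P_{\alpha,\sigma}\,d\alpha.$$ Here $u$ denotes the solution of the method for small $h$: for a fixed $R>0$ and all sufficiently small $h>0$, the method has a unique solution $u$ with values in the ball $\{y:\|y-y_0\|_\infty\le R\}$, and it depends smoothly on $h$ up to $h=0$. *)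

theory Defs
  imports "HOL-Analysis.Analysis" "HOL-Library.Landau_Symbols"
begin

section \<open>Smooth functions\<close>

primrec Ck_on :: "nat \<Rightarrow> 'a::real_normed_vector set \<Rightarrow> ('a \<Rightarrow> 'b::real_normed_vector) \<Rightarrow> bool" where
  "Ck_on 0 S f \<longleftrightarrow> continuous_on S f"
| "Ck_on (Suc k) S f \<longleftrightarrow>
     (\<forall>x\<in>S. f differentiable (at x)) \<and> (\<forall>v. Ck_on k S (\<lambda>x. frechet_derivative f (at x) v))"

text \<open>Meant for open \<open>S\<close> and finite-dimensional domains only.\<close>

definition smooth_on :: "'a::real_normed_vector set \<Rightarrow> ('a \<Rightarrow> 'b::real_normed_vector) \<Rightarrow> bool" where
  "smooth_on S f \<longleftrightarrow> (\<forall>k. Ck_on k S f)"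

section \<open>Hamiltonian vector fields\<close>

text \<open>The phase space of dimension \<open>d = 2 d\<^sub>1\<close> is \<open>real ^ ('n + 'n)\<close> with \<open>d\<^sub>1 = CARD('n)\<close>:
  the indices \<open>Inl a\<close> form the first block of coordinates, the indices \<open>Inr a\<close> the second.\<close>

definition J_mat :: "real ^ ('n::finite + 'n) ^ ('n + 'n)" where
  "J_mat = (\<chi> i j. case (i, j) of
      (Inl a, Inr b) \<Rightarrow> (if a = b then 1 else 0)
    | (Inr a, Inl b) \<Rightarrow> (if a = b then - 1 else 0)
    | _ \<Rightarrow> 0)"

definition gradient :: "(real ^ 'm::finite \<Rightarrow> real) \<Rightarrow> real ^ 'm \<Rightarrow> real ^ 'm" where
  "gradient H y = (\<chi> i. frechet_derivative H (at y) (axis i 1))"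

section \<open>Function spaces\<close>

definition lin_indep :: "nat \<Rightarrow> (nat \<Rightarrow> real \<Rightarrow> real) \<Rightarrow> bool" where
  "lin_indep r \<phi> \<longleftrightarrow>
     (\<forall>c :: nat \<Rightarrow> real. (\<forall>t. (\<Sum>i<r. c i * \<phi> i t) = 0) \<longrightarrow> (\<forall>i<r. c i = 0))"

definition vec_span :: "nat \<Rightarrow> (nat \<Rightarrow> real \<Rightarrow> real) \<Rightarrow> (real \<Rightarrow> real ^ 'm::finite) set" where
  "vec_span k \<psi> = {\<lambda>t. \<Sum>i<k. \<psi> i t *\<^sub>R W i | W :: nat \<Rightarrow> real ^ 'm. True}"

definition Y_space :: "nat \<Rightarrow> (nat \<Rightarrow> real \<Rightarrow> real) \<Rightarrow> (real \<Rightarrow> real ^ 'm::finite) set" where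
  "Y_space r \<phi> = vec_span r \<phi>"

text \<open>The interval integral is oriented, so the primitives are also the right ones for \<open>t < t0\<close>.\<close>

definition X_space :: "nat \<Rightarrow> (nat \<Rightarrow> real \<Rightarrow> real) \<Rightarrow> real \<Rightarrow> (real \<Rightarrow> real ^ 'm::finite) set" where
  "X_space r \<phi> t0 = vec_span (Suc r)
     (\<lambda>i t. case i of 0 \<Rightarrow> 1 | Suc j \<Rightarrow> (LBINT s=ereal t0..ereal t. \<phi> j s))"

definition shift_reflect_invariant :: "(real \<Rightarrow> 'a) set \<Rightarrow> bool" where
  "shift_reflect_invariant V \<longleftrightarrow>
     (\<forall>v\<in>V. (\<forall>c. (\<lambda>t. v (t + c)) \<in> V) \<and> (\<lambda>t. v (- t)) \<in> V)"

text \<open>Functions on \<open>[0,1]\<close> are represented by total functions whose values outside \<open>[0,1]\<close>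
  are irrelevant.\<close>

definition rescaled :: "real \<Rightarrow> real \<Rightarrow> (real \<Rightarrow> 'a) set \<Rightarrow> (real \<Rightarrow> 'a) set" where
  "rescaled t0 h V = {v. \<exists>w\<in>V. \<forall>\<tau>\<in>{0..1}. v \<tau> = w (t0 + \<tau> * h)}"

definition ip :: "(real \<Rightarrow> real ^ 'm::finite) \<Rightarrow> (real \<Rightarrow> real ^ 'm) \<Rightarrow> real ^ 'm" where
  "ip w1 w2 = integral {0..1} (\<lambda>\<tau>. \<chi> i. w1 \<tau> $ i * w2 \<tau> $ i)"

section \<open>The method\<close>

text \<open>One step with stepsize \<open>h\<close>, in variational form; the numerical solution after the step
  is \<open>u 1\<close>.\<close>

definition ffcfe_solution ::
    "nat \<Rightarrow> (nat \<Rightarrow> real \<Rightarrow> real) \<Rightarrow> (real ^ 'm \<Rightarrow> real ^ 'm) \<Rightarrow> real \<Rightarrow> real ^ 'm::finite \<Rightarrow>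
     real \<Rightarrow> (real \<Rightarrow> real ^ 'm) \<Rightarrow> bool" where
  "ffcfe_solution r \<phi> f t0 y0 h u \<longleftrightarrow>
     u \<in> rescaled t0 h (X_space r \<phi> t0) \<and>
     u 0 = y0 \<and>
     (\<forall>v \<in> rescaled t0 h (Y_space r \<phi>).
        ip v (\<lambda>\<tau>. vector_derivative u (at \<tau> within {0..1})) = h *\<^sub>R ip v (f \<circ> u))"

definition in_sup_ball :: "real ^ 'm::finite \<Rightarrow> real \<Rightarrow> (real \<Rightarrow> real ^ 'm) \<Rightarrow> bool" where
  "in_sup_ball y0 R u \<longleftrightarrow> (\<forall>\<tau>\<in>{0..1}. infnorm (u \<tau> - y0) \<le> R)"

definition unique_ffcfe_solution ::
    "nat \<Rightarrow> (nat \<Rightarrow> real \<Rightarrow> real) \<Rightarrow> (real ^ 'm \<Rightarrow> real ^ 'm) \<Rightarrow> real \<Rightarrow> real ^ 'm::finite \<Rightarrow>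
     real \<Rightarrow> real \<Rightarrow> (real \<Rightarrow> real ^ 'm) \<Rightarrow> bool" where
  "unique_ffcfe_solution r \<phi> f t0 y0 R h u \<longleftrightarrow>
     ffcfe_solution r \<phi> f t0 y0 h u \<and> in_sup_ball y0 R u \<and>
     (\<forall>w. ffcfe_solution r \<phi> f t0 y0 h w \<and> in_sup_ball y0 R w \<longrightarrow> (\<forall>\<tau>\<in>{0..1}. w \<tau> = u \<tau>))"

text \<open>Smooth dependence of \<open>u h \<tau>\<close> on \<open>h\<close> (jointly with \<open>\<tau>\<close>) up to \<open>h = 0\<close>: smoothness on the
  non-open set \<open>[0,\<epsilon>] \<times> [0,1]\<close> is expressed by a smooth extension to an open set. The value
  of \<open>u\<close> at \<open>h = 0\<close> itself is irrelevant.\<close>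

definition smooth_up_to_zero :: "(real \<Rightarrow> real \<Rightarrow> real ^ 'm::finite) \<Rightarrow> bool" where
  "smooth_up_to_zero u \<longleftrightarrow>
     (\<exists>\<epsilon>>0. \<exists>S U. open S \<and> {0..\<epsilon>} \<times> {0..1} \<subseteq> S \<and> smooth_on S U \<and>
        (\<forall>h\<in>{0<..\<epsilon>}. \<forall>\<tau>\<in>{0..1}. u h \<tau> = U (h, \<tau>)))"

end

(* The space spanned by the phi i is invariant under translation, hence under differentiation, and
   therefore has a basis psi j whose jets at t0 of length r are the unit vectors; on a short step the
   rescaled space is a small perturbation of the polynomials of degree less than r, and the orthogonal
   projection onto it is bounded in the sup norm uniformly in h. In terms of w(t) = u((t - t0) / h)
   the method says that w' is the projection of f o w. Bootstrapping this equation shows that all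
   derivatives of w are bounded uniformly in h; hence the defect w' - f o w is O(h^r), and the error
   w - y is O(h^(r+1)). At the end of the step the error is tested against a solution of the adjoint
   of the equation linearised about w: since the defect is orthogonal to the space, only the part of
   the adjoint solution outside it, of size O(h^r), contributes, which gains the further factor h^r. *)

theory Submission
  imports Defs
begin

text \<open>The obstacle is uniformity in \<open>h\<close>. The stability estimate sees the
  coefficients \<open>a h j\<close> of the derivative of \<open>w\<close> only with the weight
  \<open>h ^ j\<close>, so a bound from it alone permits growth like h^(-j). Conversely, on the step
  the k-th derivative of the j-th basis function is of size h^(j-k) for k below j. Decay of order k
  of the weighted coefficients is therefore exactly what bounds k derivatives of w'. This balance
  drives the bootstrapping: it starts from the boundedness of \<open>w\<close>, gains one order per
  turn, and closes at order r, where all coefficients are bounded. The jet-dual basis serves twice.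
  Rescaled and divided by h^j, its members approach x^j / j!, whose coefficients are controlled by
  an L1 norm independent of \<open>h\<close>; and an element of the space with a prescribed jet can
  be written down at once, so that Taylor polynomials can be replaced by elements of the space.
  Closure under differentiation rests on point values: combinations of them read off the
  coefficients of a translate, which are thereby differentiable in the shift.\<close>

section \<open>Translation-invariant function spaces\<close>

text \<open>Gaussian elimination on the number of equations: an equation with vanishing coefficients
  is dropped, any other is solved for a pivot unknown \<open>p\<close>, which is substituted into
  the rest. This is the dimension count behind the bases below.\<close>

lemma homogeneous_system_nontrivial:
  fixes a :: "nat \<Rightarrow> 'i \<Rightarrow> real"
  assumes "finite I" "m < card I"
  shows "\<exists>c. (\<exists>i\<in>I. c i \<noteq> 0) \<and> (\<forall>k<m. (\<Sum>i\<in>I. c i * a k i) = 0)"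
  using assms
proof (induction m arbitrary: a I)
  case 0
  then have "I \<noteq> {}" by auto
  then show ?case by (intro exI[of _ "\<lambda>_. 1"]) auto
next
  case (Suc m)
  show ?case
  proof (cases "\<forall>i\<in>I. a m i = 0")
    case True
    obtain c where c: "\<exists>i\<in>I. c i \<noteq> 0" "\<forall>k<m. (\<Sum>i\<in>I. c i * a k i) = 0"
      using Suc.IH[of I a] Suc.prems by auto
    have "(\<Sum>i\<in>I. c i * a m i) = 0" using True by simp
    then show ?thesis using c by (metis less_Suc_eq)
  next
    case False
    then obtain p where p: "p \<in> I" "a m p \<noteq> 0" by auto
    define I' where "I' = I - {p}"
    have I': "finite I'" "m < card I'" "p \<notin> I'" "I = insert p I'"
      using Suc.prems p by (auto simp: I'_def)
    obtain c where c: "\<exists>i\<in>I'. c i \<noteq> 0"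
        "\<forall>k<m. (\<Sum>i\<in>I'. c i * (a k i - a k p * a m i / a m p)) = 0"
      using Suc.IH[of I' "\<lambda>k i. a k i - a k p * a m i / a m p"] I' by auto
    \<comment> \<open>The value at \<open>p\<close> is forced by equation \<open>m\<close>; the
      coefficients handed to the induction hypothesis are those left after substituting it.\<close>
    define c' where "c' = c(p := - (\<Sum>i\<in>I'. c i * a m i) / a m p)"
    have sum': "(\<Sum>i\<in>I. c' i * a k i) =
        (\<Sum>i\<in>I'. c i * a k i) - (\<Sum>i\<in>I'. c i * a m i) / a m p * a k p" for k
    proof -
      have "(\<Sum>i\<in>I'. c' i * a k i) = (\<Sum>i\<in>I'. c i * a k i)"
        using I' by (intro sum.cong) (auto simp: c'_def)
      then show ?thesis using I' by (simp add: c'_def)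
    qed
    have "(\<Sum>i\<in>I. c' i * a k i) = 0" if "k < Suc m" for k
    proof (cases "k = m")
      case True
      then show ?thesis unfolding sum' using p by simp
    next
      case False
      then have "(\<Sum>i\<in>I'. c i * (a k i - a k p * a m i / a m p)) = 0" using that c by simp
      then have "(\<Sum>i\<in>I'. c i * a k i) = (\<Sum>i\<in>I'. c i * (a k p * a m i / a m p))"
        by (simp add: right_diff_distrib sum_subtractf)
      also have "\<dots> = (\<Sum>i\<in>I'. c i * a m i) / a m p * a k p"
        unfolding sum_divide_distrib sum_distrib_right by (intro sum.cong) auto
      finally show ?thesis unfolding sum' by simp
    qed
    moreover have "\<exists>i\<in>I. c' i \<noteq> 0" using c I' by (auto simp: c'_def)
    ultimately show ?thesis by blast
  qed
qed

section \<open>Dual functionals and closure under differentiation\<close>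

text \<open>A finite combination of point evaluations is the intended instance.\<close>

definition evaluation_like :: "((real \<Rightarrow> real) \<Rightarrow> real) \<Rightarrow> bool" where
  "evaluation_like L \<longleftrightarrow>
     (\<forall>v v'. (\<forall>t. (v has_real_derivative v' t) (at t)) \<longrightarrow>
        ((\<lambda>c. L (\<lambda>t. v (t + c))) has_real_derivative L v') (at 0)) \<and>
     (\<forall>x v n. L (\<lambda>t. \<Sum>i<n. x i * v i t) = (\<Sum>i<(n::nat). x i * L (v i)))"

lemma evaluation_like_point: "evaluation_like (\<lambda>v. v s)"
  unfolding evaluation_like_def
proof (intro conjI allI impI refl)
  fix v v' :: "real \<Rightarrow> real"
  assume "\<forall>t. (v has_real_derivative v' t) (at t)"
  then have "(v has_real_derivative v' s) (at (0 + s))" by simp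
  then show "((\<lambda>c. v (s + c)) has_real_derivative v' s) (at 0)"
    by (subst (asm) DERIV_shift) (simp add: add.commute)
qed

lemma evaluation_like_cmult:
  "evaluation_like L \<Longrightarrow> evaluation_like (\<lambda>v. a * L v)"
  unfolding evaluation_like_def
  by (auto intro!: derivative_eq_intros simp: sum_distrib_left mult_ac)

lemma evaluation_like_diff:
  "evaluation_like L \<Longrightarrow> evaluation_like L' \<Longrightarrow> evaluation_like (\<lambda>v. L v - L' v)"
  unfolding evaluation_like_def
  by (auto intro!: derivative_eq_intros simp: right_diff_distrib sum_subtractf)

lemma evaluation_like_sum:
  assumes "\<And>j. j \<in> J \<Longrightarrow> evaluation_like (L j)"
  shows "evaluation_like (\<lambda>v. \<Sum>j\<in>J. L j v)"
  using assms unfolding evaluation_like_def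
  by (auto intro!: DERIV_sum simp: sum_distrib_left sum.swap[of _ J])

lemma evaluation_like_lincomb:
  assumes "evaluation_like L"
  shows "L (\<lambda>t. \<Sum>i<n. x i * v i t) = (\<Sum>i<(n::nat). x i * L (v i))"
  using assms unfolding evaluation_like_def by blast

text \<open>Subtracting from \<open>\<phi> r\<close> its interpolant leaves a function that
  independence keeps from vanishing identically; evaluating residues at a point \<open>s\<close>
  where it is nonzero yields the new functional. An abstract dual basis would not do, because the
  functionals must be differentiable along translations.\<close>

lemma lin_indep_dual_functionals:
  assumes "lin_indep r \<phi>"
  shows "\<exists>L. (\<forall>j<r. evaluation_like (L j)) \<and>
    (\<forall>i<r. \<forall>j<r. L j (\<phi> i) = (if i = j then 1 else 0))"
  using assms
proof (induction r)
  case 0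
  then show ?case by simp
next
  case (Suc r)
  have "lin_indep r \<phi>"
    unfolding lin_indep_def
  proof (intro allI impI)
    fix c :: "nat \<Rightarrow> real" and i
    assume "\<forall>t. (\<Sum>i<r. c i * \<phi> i t) = 0" and "i < r"
    then have "\<forall>t. (\<Sum>i<Suc r. (c(r := 0)) i * \<phi> i t) = 0" by simp
    then have "\<forall>i<Suc r. (c(r := 0)) i = 0" using Suc.prems unfolding lin_indep_def by blast
    then show "c i = 0" using \<open>i < r\<close> by (metis fun_upd_other less_SucI less_irrefl)
  qed
  from Suc.IH[OF this] obtain L where L: "\<And>j. j < r \<Longrightarrow> evaluation_like (L j)"
    and dual: "\<And>i j. i < r \<Longrightarrow> j < r \<Longrightarrow> L j (\<phi> i) = (if i = j then 1 else 0)" by blast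
  define c where "c = (\<lambda>i. if i < r then - L i (\<phi> r) else 1)"
  have "\<not> (\<forall>t. (\<Sum>i<Suc r. c i * \<phi> i t) = 0)"
    using Suc.prems unfolding lin_indep_def by (metis c_def lessI less_irrefl zero_neq_one)
  then obtain s where s: "(\<Sum>i<Suc r. c i * \<phi> i s) \<noteq> 0" by blast
  define \<rho> where "\<rho> = (\<Sum>i<Suc r. c i * \<phi> i s)"
  have \<rho>: "\<rho> = \<phi> r s - (\<Sum>j<r. \<phi> j s * L j (\<phi> r))"
    by (simp add: \<rho>_def c_def sum_negf mult.commute)
  have \<rho>0: "\<rho> \<noteq> 0" using s by (simp add: \<rho>_def)
  \<comment> \<open>Up to the factor \<open>1 / \<rho>\<close>, the value at \<open>s\<close> of
    \<open>v\<close> minus its interpolant. It kills every \<open>\<phi> i\<close> with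
    \<open>i < r\<close>, and the factor makes it 1 on \<open>\<phi> r\<close>.\<close>
  define M where "M = (\<lambda>v. (1 / \<rho>) * (v s - (\<Sum>j<r. \<phi> j s * L j v)))"
  define L' where "L' = (\<lambda>j. if j < r then (\<lambda>v. L j v - L j (\<phi> r) * M v) else M)"
  have M: "evaluation_like M"
    unfolding M_def
    by (intro evaluation_like_cmult evaluation_like_diff evaluation_like_sum evaluation_like_point L)
      auto
  have M_low: "M (\<phi> i) = 0" if "i < r" for i
  proof -
    have "(\<Sum>j<r. \<phi> j s * L j (\<phi> i)) = (\<Sum>j<r. if j = i then \<phi> i s else 0)"
      using that by (intro sum.cong) (auto simp: dual)
    then show ?thesis using that by (simp add: M_def)
  qed
  have M_top: "M (\<phi> r) = 1" using \<rho>0 \<rho> by (simp add: M_def)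
  show ?case
  proof (intro exI[of _ L'] conjI allI impI)
    fix j assume "j < Suc r"
    then show "evaluation_like (L' j)"
      using M L by (auto simp: L'_def intro!: evaluation_like_cmult evaluation_like_diff)
  next
    fix i j assume "i < Suc r" "j < Suc r"
    then show "L' j (\<phi> i) = (if i = j then 1 else 0)"
      using M_low M_top dual by (auto simp: L'_def less_Suc_eq)
  qed
qed

text \<open>The variables in \<open>\<phi> i (t + c)\<close> are interchangeable, so the derivative
  in \<open>t\<close> is the derivative in \<open>c\<close> at 0. In the latter only the
  coefficients of the translate vary, and the dual functionals express them differentiably.\<close>

lemma translation_invariant_derivative:
  assumes indep: "lin_indep r \<phi>"
    and deriv: "\<And>i t. i < r \<Longrightarrow> (\<phi> i has_real_derivative \<phi>' i t) (at t)"
    and trans: "\<And>i c. i < r \<Longrightarrow> \<exists>W. \<forall>t. \<phi> i (t + c) = (\<Sum>j<r. W j * \<phi> j t)"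
  shows "\<exists>A. \<forall>i<r. \<forall>t. (\<phi> i has_real_derivative (\<Sum>j<r. A i j * \<phi> j t)) (at t)"
proof -
  obtain L where L: "\<And>j. j < r \<Longrightarrow> evaluation_like (L j)"
    and dual: "\<And>i j. i < r \<Longrightarrow> j < r \<Longrightarrow> L j (\<phi> i) = (if i = j then 1 else 0)"
    using lin_indep_dual_functionals[OF indep] by blast
  have repr: "\<phi> i (t + c) = (\<Sum>j<r. L j (\<lambda>t. \<phi> i (t + c)) * \<phi> j t)" if i: "i < r" for i t c
  proof -
    obtain W where W: "\<And>t. \<phi> i (t + c) = (\<Sum>j<r. W j * \<phi> j t)" using trans[OF i] by blast
    have "L j (\<lambda>t. \<phi> i (t + c)) = W j" if j: "j < r" for j
    proof -
      have "L j (\<lambda>t. \<phi> i (t + c)) = (\<Sum>k<r. W k * L j (\<phi> k))"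
        unfolding W by (rule evaluation_like_lincomb[OF L[OF j]])
      also have "\<dots> = (\<Sum>k<r. if k = j then W j else 0)"
        using j by (intro sum.cong) (auto simp: dual)
      finally show ?thesis using j by simp
    qed
    then show ?thesis unfolding W by simp
  qed
  have "(\<phi> i has_real_derivative (\<Sum>j<r. L j (\<phi>' i) * \<phi> j t)) (at t)" if i: "i < r" for i t
  proof -
    have "((\<lambda>c. \<Sum>j<r. L j (\<lambda>t. \<phi> i (t + c)) * \<phi> j t) has_real_derivative
        (\<Sum>j<r. L j (\<phi>' i) * \<phi> j t)) (at 0)"
      using L deriv[OF i] unfolding evaluation_like_def
      by (intro DERIV_sum DERIV_cmult_right) blast
    then have "((\<lambda>c. \<phi> i (t + c)) has_real_derivative (\<Sum>j<r. L j (\<phi>' i) * \<phi> j t)) (at 0)"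
      unfolding repr[OF i, symmetric] .
    then show ?thesis using DERIV_shift[of "\<phi> i" _ 0 t] by (simp add: add.commute)
  qed
  then show ?thesis by (intro exI[of _ "\<lambda>i j. L j (\<phi>' i)"]) blast
qed

text \<open>Forward substitution: unknown \<open>n\<close> enters no equation before the
  \<open>n\<close>-th, so it can be adjusted last.\<close>

lemma triangular_solve:
  fixes B :: "nat \<Rightarrow> nat \<Rightarrow> real"
  assumes "\<And>j m. j < n \<Longrightarrow> m < j \<Longrightarrow> B j m = 0" "\<And>j. j < n \<Longrightarrow> B j j = 1"
  shows "\<exists>g. \<forall>m<n. (\<Sum>j<n. g j * B j m) = x m"
  using assms
proof (induction n)
  case 0
  then show ?case by simp
next
  case (Suc n)
  obtain g where g: "\<And>m. m < n \<Longrightarrow> (\<Sum>j<n. g j * B j m) = x m"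
    using Suc.IH Suc.prems by (metis less_SucI)
  define g' where "g' = g(n := x n - (\<Sum>j<n. g j * B j n))"
  have "(\<Sum>j<n. g' j * B j m) = (\<Sum>j<n. g j * B j m)" for m
    by (intro sum.cong) (auto simp: g'_def)
  then have "(\<Sum>j<Suc n. g' j * B j m) = x m" if "m < Suc n" for m
    using that g Suc.prems by (auto simp: less_Suc_eq g'_def)
  then show ?case by blast
qed

section \<open>Jets at a point and a basis dual to them\<close>

context
  fixes r :: nat and \<phi> :: "nat \<Rightarrow> real \<Rightarrow> real" and A :: "nat \<Rightarrow> nat \<Rightarrow> real"
  assumes A: "\<forall>i<r. \<forall>t. (\<phi> i has_real_derivative (\<Sum>j<r. A i j * \<phi> j t)) (at t)"
begin

text \<open>The \<open>k\<close>-th derivative of \<open>\<phi> i\<close>, obtained by applying the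
  matrix \<open>A\<close> instead of differentiating, so that membership in the span and growth in
  \<open>k\<close> become plain algebra.\<close>

primrec iter_deriv :: "nat \<Rightarrow> nat \<Rightarrow> real \<Rightarrow> real" where
  "iter_deriv 0 i t = \<phi> i t"
| "iter_deriv (Suc k) i t = (\<Sum>j<r. A i j * iter_deriv k j t)"

lemma iter_deriv_has_derivative:
  "i < r \<Longrightarrow> (iter_deriv k i has_real_derivative iter_deriv (Suc k) i t) (at t)"
proof (induction k arbitrary: i)
  case 0
  have "iter_deriv 0 i = \<phi> i" by auto
  with A[rule_format, OF 0] show ?case by simp
next
  case (Suc k)
  have "((\<lambda>t. \<Sum>j<r. A i j * iter_deriv k j t) has_real_derivative
      (\<Sum>j<r. A i j * iter_deriv (Suc k) j t)) (at t)"
    by (intro DERIV_sum DERIV_cmult Suc.IH) simp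
  moreover have "iter_deriv (Suc k) i = (\<lambda>t. \<Sum>j<r. A i j * iter_deriv k j t)" by auto
  ultimately show ?case by simp
qed

lemma iter_deriv_span: "\<exists>B. \<forall>i<r. \<forall>t. iter_deriv k i t = (\<Sum>j<r. B i j * \<phi> j t)"
proof (induction k)
  case 0
  have "\<phi> i t = (\<Sum>j<r. (if j = i then 1 else 0) * \<phi> j t)" if "i < r" for i t
  proof -
    have "(\<Sum>j<r. (if j = i then 1 else 0) * \<phi> j t) = (\<Sum>j<r. if j = i then \<phi> i t else 0)"
      by (intro sum.cong) auto
    then show ?thesis using that by simp
  qed
  then show ?case by (intro exI[of _ "\<lambda>i j. if j = i then 1 else 0"]) simp
next
  case (Suc k)
  then obtain B where B: "\<And>i t. i < r \<Longrightarrow> iter_deriv k i t = (\<Sum>j<r. B i j * \<phi> j t)" by blast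
  have "iter_deriv (Suc k) i t = (\<Sum>j<r. (\<Sum>l<r. A i l * B l j) * \<phi> j t)" for i t
  proof -
    have "iter_deriv (Suc k) i t = (\<Sum>l<r. \<Sum>j<r. A i l * B l j * \<phi> j t)"
      by (simp add: B sum_distrib_left mult_ac)
    then show ?thesis by (subst (asm) sum.swap) (simp add: sum_distrib_right)
  qed
  then show ?case by (intro exI[of _ "\<lambda>i j. \<Sum>l<r. A i l * B l j"]) blast
qed

lemma iter_deriv_bound:
  assumes "\<And>i t. i < r \<Longrightarrow> t \<in> S \<Longrightarrow> \<bar>\<phi> i t\<bar> \<le> M" and "t \<in> S" "i < r"
  shows "\<bar>iter_deriv k i t\<bar> \<le> (\<Sum>i<r. \<Sum>j<r. \<bar>A i j\<bar>) ^ k * M"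
  using assms(3)
proof (induction k arbitrary: i)
  case 0
  then show ?case using assms by simp
next
  case (Suc k)
  let ?L = "\<Sum>i<r. \<Sum>j<r. \<bar>A i j\<bar>"
  have L: "0 \<le> ?L" by (intro sum_nonneg) auto
  have M: "0 \<le> M" using assms(1)[OF Suc.prems assms(2)] by linarith
  have "\<bar>iter_deriv (Suc k) i t\<bar> \<le> (\<Sum>j<r. \<bar>A i j\<bar> * (?L ^ k * M))"
    unfolding iter_deriv.simps
    by (rule order_trans[OF sum_abs]) (auto intro!: sum_mono mult_left_mono Suc.IH simp: abs_mult)
  also have "\<dots> = (\<Sum>j<r. \<bar>A i j\<bar>) * (?L ^ k * M)" by (simp add: sum_distrib_right)
  also have "\<dots> \<le> ?L * (?L ^ k * M)"
    using Suc.prems L M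
    by (intro mult_right_mono member_le_sum[of i "{..<r}" "\<lambda>i. \<Sum>j<r. \<bar>A i j\<bar>"])
      (auto intro!: sum_nonneg)
  finally show ?case by (simp add: mult_ac)
qed

text \<open>The Taylor remainder tends to \<open>0\<close> because the derivatives grow at most geometrically.\<close>

lemma vanishing_jet_imp_zero:
  assumes jet: "\<And>k. (\<Sum>i<r. c i * iter_deriv k i t0) = 0"
  shows "(\<Sum>i<r. c i * \<phi> i t) = 0"
proof (cases "t = t0")
  case True
  then show ?thesis using jet[of 0] by simp
next
  case False
  define S where "S = {min t t0..max t t0}"
  have cont: "continuous_on S (\<phi> i)" if "i < r" for i
    using A[rule_format, OF that] by (meson DERIV_continuous_on has_field_derivative_at_within)
  have "\<exists>M. \<forall>t\<in>S. \<bar>\<phi> i t\<bar> \<le> M" if "i < r" for i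
  proof -
    have "compact (\<phi> i ` S)"
      using cont[OF that] by (intro compact_continuous_image) (auto simp: S_def)
    then show ?thesis by (meson bounded_real compact_imp_bounded imageI)
  qed
  then obtain m where m: "\<And>i t. i < r \<Longrightarrow> t \<in> S \<Longrightarrow> \<bar>\<phi> i t\<bar> \<le> m i" by metis
  define M where "M = (\<Sum>i<r. \<bar>m i\<bar>)"
  have M: "\<bar>\<phi> i t\<bar> \<le> M" if "i < r" "t \<in> S" for i t
  proof -
    have "\<bar>m i\<bar> \<le> M" unfolding M_def using that by (intro member_le_sum) auto
    then show ?thesis using m[OF that] by linarith
  qed
  define L where "L = (\<Sum>i<r. \<Sum>j<r. \<bar>A i j\<bar>)"
  define diff where "diff = (\<lambda>k t. \<Sum>i<r. c i * iter_deriv k i t)"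
  define K where "K = (\<Sum>i<r. \<bar>c i\<bar> * M)"
  have L0: "0 \<le> L" unfolding L_def by (intro sum_nonneg) auto
  have diff_bound: "\<bar>diff n x\<bar> \<le> L ^ n * K" if "x \<in> S" for n x
  proof -
    have "\<bar>diff n x\<bar> \<le> (\<Sum>i<r. \<bar>c i\<bar> * (L ^ n * M))"
      unfolding diff_def L_def
      by (rule order_trans[OF sum_abs])
        (auto intro!: sum_mono mult_left_mono iter_deriv_bound[OF M] that simp: abs_mult)
    then show ?thesis by (simp add: K_def sum_distrib_left mult_ac)
  qed
  have bound: "\<bar>diff 0 t\<bar> \<le> K * ((L * \<bar>t - t0\<bar>) ^ n / fact n)" if "n > 0" for n
  proof -
    have "\<exists>x. (if t < t0 then t < x \<and> x < t0 else t0 < x \<and> x < t) \<and>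
        diff 0 t = (\<Sum>m<n. diff m t0 / fact m * (t - t0) ^ m) + diff n x / fact n * (t - t0) ^ n"
    proof (rule Taylor[where a = "min t t0" and b = "max t t0"])
      show "\<forall>m x. m < n \<and> min t t0 \<le> x \<and> x \<le> max t t0 \<longrightarrow>
          DERIV (diff m) x :> diff (Suc m) x"
        unfolding diff_def
        by (intro allI impI DERIV_sum DERIV_cmult iter_deriv_has_derivative) simp
    qed (use that False in auto)
    then obtain x where x: "if t < t0 then t < x \<and> x < t0 else t0 < x \<and> x < t"
        "diff 0 t = (\<Sum>m<n. diff m t0 / fact m * (t - t0) ^ m) + diff n x / fact n * (t - t0) ^ n"
      by blast
    have xS: "x \<in> S" using x(1) by (auto simp: S_def split: if_splits)
    have "diff m t0 = 0" for m using jet by (simp add: diff_def)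
    then have eq: "diff 0 t = diff n x / fact n * (t - t0) ^ n" using x(2) by simp
    have "\<bar>diff 0 t\<bar> = \<bar>diff n x\<bar> * (\<bar>t - t0\<bar> ^ n / fact n)"
      unfolding eq by (simp add: abs_mult power_abs)
    also have "\<dots> \<le> L ^ n * K * (\<bar>t - t0\<bar> ^ n / fact n)"
      by (intro mult_right_mono diff_bound xS) simp
    finally show ?thesis by (simp add: power_mult_distrib mult_ac)
  qed
  have "(\<lambda>n. K * ((L * \<bar>t - t0\<bar>) ^ n / fact n)) \<longlonglongrightarrow> K * 0"
    using summable_LIMSEQ_zero[OF summable_exp[of "L * \<bar>t - t0\<bar>"]]
    by (intro tendsto_mult tendsto_const) (simp add: field_simps)
  moreover have "\<forall>\<^sub>F n in sequentially. \<bar>diff 0 t\<bar> \<le> K * ((L * \<bar>t - t0\<bar>) ^ n / fact n)"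
    by (rule eventually_mono[OF eventually_gt_at_top[of 0] bound])
  ultimately have "\<bar>diff 0 t\<bar> \<le> K * 0"
    by (intro tendsto_lowerbound) auto
  then show ?thesis by (simp add: diff_def)
qed

text \<open>Differentiation lowers the order of vanishing at \<open>t0\<close> by one, so it is enough to find an
  element of the space whose order is finite and at least \<open>r - 1\<close>; counting dimensions gives one.\<close>

lemma triangular_basis:
  assumes indep: "lin_indep r \<phi>"
  shows "\<exists>\<psi>. (\<forall>j<r. \<forall>k t. (\<psi> j k has_real_derivative \<psi> j (Suc k) t) (at t)) \<and>
     (\<forall>j<r. \<forall>k<j. \<psi> j k t0 = 0) \<and> (\<forall>j<r. \<psi> j j t0 = 1) \<and>
     (\<forall>j<r. \<exists>c. \<forall>t. \<psi> j 0 t = (\<Sum>i<r. c i * \<phi> i t))"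
proof (cases "r = 0")
  case True
  then show ?thesis by simp
next
  case False
  \<comment> \<open>There are \<open>r\<close> unknowns, so only \<open>r - 1\<close> vanishing
    conditions can be imposed if a nonzero solution is to be guaranteed.\<close>
  obtain c where c: "\<exists>i<r. c i \<noteq> 0"
      and c0: "\<And>k. k < r - 1 \<Longrightarrow> (\<Sum>i<r. c i * iter_deriv k i t0) = 0"
    using homogeneous_system_nontrivial[of "{..<r}" "r - 1" "\<lambda>k i. iter_deriv k i t0"] False by auto
  let ?d = "\<lambda>k t. \<Sum>i<r. c i * iter_deriv k i t"
  have "\<exists>k. ?d k t0 \<noteq> 0"
  proof (rule ccontr)
    assume "\<not> ?thesis"
    then have "(\<Sum>i<r. c i * \<phi> i t) = 0" for t
      using vanishing_jet_imp_zero[of c t0 t] by blast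
    then show False using indep c unfolding lin_indep_def by blast
  qed
  define n where "n = (LEAST k. ?d k t0 \<noteq> 0)"
  have n: "?d n t0 \<noteq> 0" unfolding n_def using \<open>\<exists>k. ?d k t0 \<noteq> 0\<close> by (rule LeastI_ex)
  have below: "?d k t0 = 0" if "k < n" for k using that not_less_Least unfolding n_def by blast
  have nr: "r - 1 \<le> n" using c0 n by (meson not_le)
  \<comment> \<open>With \<open>n\<close> the exact order of the zero at \<open>t0\<close>, the
    derivative of order \<open>n - j\<close> has a zero of order \<open>j\<close> there; the
    subtraction is exact since \<open>j < r\<close> and \<open>r - 1 \<le> n\<close>. The first
    nonvanishing derivative is \<open>?d n t0\<close> for every \<open>j\<close>, so one divisor
    normalises them all.\<close>
  define \<psi> where "\<psi> = (\<lambda>j k t. ?d (k + (n - j)) t / ?d n t0)"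
  show ?thesis
  proof (intro exI[of _ \<psi>] conjI allI impI)
    fix j k t assume "j < r"
    show "(\<psi> j k has_real_derivative \<psi> j (Suc k) t) (at t)"
      unfolding \<psi>_def add_Suc
      by (intro DERIV_cdivide DERIV_sum DERIV_cmult iter_deriv_has_derivative) simp
  next
    fix j k assume "j < r" "k < j"
    then have "k + (n - j) < n" using nr by linarith
    then show "\<psi> j k t0 = 0" using below by (simp add: \<psi>_def)
  next
    fix j assume "j < r"
    then have "j + (n - j) = n" using nr by linarith
    then show "\<psi> j j t0 = 1" using n by (simp add: \<psi>_def)
  next
    fix j assume "j < r"
    obtain B where B: "\<And>i t. i < r \<Longrightarrow> iter_deriv (n - j) i t = (\<Sum>l<r. B i l * \<phi> l t)"
      using iter_deriv_span by blast
    have "\<psi> j 0 t = (\<Sum>l<r. ((\<Sum>i<r. c i * B i l) / ?d n t0) * \<phi> l t)" for t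
    proof -
      have "\<psi> j 0 t = (\<Sum>i<r. \<Sum>l<r. c i * B i l * \<phi> l t) / ?d n t0"
        by (simp add: \<psi>_def B sum_distrib_left mult_ac)
      also have "\<dots> = (\<Sum>l<r. (\<Sum>i<r. c i * B i l) / ?d n t0 * \<phi> l t)"
        by (subst sum.swap) (simp add: sum_distrib_right sum_divide_distrib)
      finally show ?thesis .
    qed
    then show "\<exists>c. \<forall>t. \<psi> j 0 t = (\<Sum>i<r. c i * \<phi> i t)"
      by (intro exI[of _ "\<lambda>l. (\<Sum>i<r. c i * B i l) / ?d n t0"]) blast
  qed
qed

text \<open>The jets of the triangular basis form a unit triangular matrix, and multiplying by its
  inverse turns it into the identity. The new jets show independence, and \<open>r\<close>
  independent elements of the span of \<open>\<phi>\<close> span it.\<close>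

lemma jet_dual_basis:
  assumes indep: "lin_indep r \<phi>"
  shows "\<exists>\<psi>. (\<forall>j<r. \<forall>k t. (\<psi> j k has_real_derivative \<psi> j (Suc k) t) (at t)) \<and>
     (\<forall>j<r. \<forall>k<r. \<psi> j k t0 = (if j = k then 1 else 0)) \<and>
     (\<forall>j<r. \<exists>c. \<forall>t. \<psi> j 0 t = (\<Sum>i<r. c i * \<phi> i t)) \<and>
     (\<forall>i<r. \<exists>c. \<forall>t. \<phi> i t = (\<Sum>j<r. c j * \<psi> j 0 t))"
proof -
  obtain \<theta> where \<theta>: "\<forall>j<r. \<forall>k t. (\<theta> j k has_real_derivative \<theta> j (Suc k) t) (at t)"
      and low: "\<forall>j<r. \<forall>k<j. \<theta> j k t0 = 0"
      and diag: "\<forall>j<r. \<theta> j j t0 = 1"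
      and span: "\<forall>j<r. \<exists>c. \<forall>t. \<theta> j 0 t = (\<Sum>i<r. c i * \<phi> i t)"
    using triangular_basis[OF indep, of t0] by (elim exE conjE) (rule that; assumption)
  have "\<forall>j. \<exists>c. j < r \<longrightarrow> (\<forall>t. \<theta> j 0 t = (\<Sum>i<r. c i * \<phi> i t))" using span by blast
  from choice[OF this] obtain b where b: "\<And>j t. j < r \<Longrightarrow> \<theta> j 0 t = (\<Sum>i<r. b j i * \<phi> i t)"
    by blast
  have "\<forall>l. \<exists>g. \<forall>m<r. (\<Sum>j<r. g j * \<theta> j m t0) = (if l = m then 1 else 0)"
    by (intro allI triangular_solve[of r "\<lambda>j m. \<theta> j m t0"]) (use low diag in auto)
  from choice[OF this]
  obtain g where g: "\<And>l m. m < r \<Longrightarrow> (\<Sum>j<r. g l j * \<theta> j m t0) = (if l = m then 1 else 0)"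
    by blast
  define \<psi> where "\<psi> = (\<lambda>l k t. \<Sum>j<r. g l j * \<theta> j k t)"
  have \<psi>: "(\<psi> l k has_real_derivative \<psi> l (Suc k) t) (at t)" for l k t
    unfolding \<psi>_def by (intro DERIV_sum DERIV_cmult \<theta>[rule_format]) simp
  have \<psi>_jet: "\<psi> l k t0 = (if l = k then 1 else 0)" if "k < r" for l k
    using g that by (simp add: \<psi>_def)
  have \<psi>_span: "\<psi> l 0 t = (\<Sum>i<r. (\<Sum>j<r. g l j * b j i) * \<phi> i t)" for l t
  proof -
    have "\<psi> l 0 t = (\<Sum>j<r. \<Sum>i<r. g l j * b j i * \<phi> i t)"
      by (simp add: \<psi>_def b sum_distrib_left mult_ac)
    then show ?thesis by (subst (asm) sum.swap) (simp add: sum_distrib_right)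
  qed
  \<comment> \<open>Differentiating the relation \<open>k\<close> times and evaluating at
    \<open>t0\<close> isolates \<open>d k\<close>.\<close>
  have \<psi>_indep: "d k = 0" if zero: "\<And>t. (\<Sum>j<r. d j * \<psi> j 0 t) = 0" and "k < r" for d k
  proof -
    have "(\<Sum>j<r. d j * \<psi> j m t) = 0" for m t
    proof (induction m arbitrary: t)
      case 0
      then show ?case by (rule zero)
    next
      case (Suc m)
      have "((\<lambda>t. \<Sum>j<r. d j * \<psi> j m t) has_real_derivative (\<Sum>j<r. d j * \<psi> j (Suc m) t)) (at t)"
        by (intro DERIV_sum DERIV_cmult \<psi>)
      then have "((\<lambda>t. 0) has_real_derivative (\<Sum>j<r. d j * \<psi> j (Suc m) t)) (at t)"
        unfolding Suc.IH .
      then show ?case by (metis DERIV_const DERIV_unique)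
    qed
    then have "0 = (\<Sum>j<r. d j * \<psi> j k t0)" by simp
    also have "\<dots> = (\<Sum>j<r. if j = k then d k else 0)"
      using \<open>k < r\<close> by (intro sum.cong) (auto simp: \<psi>_jet)
    finally show ?thesis using \<open>k < r\<close> by simp
  qed
  have "\<exists>c. \<forall>t. \<phi> i t = (\<Sum>j<r. c j * \<psi> j 0 t)" if i: "i < r" for i
  proof -
    \<comment> \<open>The columns are the coordinates with respect to \<open>\<phi>\<close> of the
      \<open>r\<close> functions \<open>\<psi> j 0\<close> and, in column \<open>r\<close>, of
      \<open>\<phi> i\<close>: one vector more than the dimension, which forces a linear
      relation.\<close>
    define C where "C = (\<lambda>l k. if k < r then (\<Sum>j<r. g k j * b j l) else if l = i then 1 else (0::real))"
    obtain d where d: "\<exists>k<Suc r. d k \<noteq> 0" "\<And>l. l < r \<Longrightarrow> (\<Sum>k<Suc r. d k * C l k) = 0"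
      using homogeneous_system_nontrivial[of "{..<Suc r}" r C] by auto
    have rel: "(\<Sum>j<r. d j * \<psi> j 0 t) + d r * \<phi> i t = 0" for t
    proof -
      have "(\<Sum>j<r. d j * \<psi> j 0 t) + d r * \<phi> i t
          = (\<Sum>k<Suc r. d k * (\<Sum>l<r. C l k * \<phi> l t))"
      proof -
        have "(\<Sum>l<r. C l r * \<phi> l t) = (\<Sum>l<r. if l = i then \<phi> i t else 0)"
          by (intro sum.cong) (auto simp: C_def)
        then show ?thesis using i by (simp add: \<psi>_span C_def)
      qed
      also have "\<dots> = (\<Sum>k<Suc r. \<Sum>l<r. d k * C l k * \<phi> l t)"
        by (simp only: sum_distrib_left mult.assoc)
      also have "\<dots> = (\<Sum>l<r. (\<Sum>k<Suc r. d k * C l k) * \<phi> l t)"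
        by (subst sum.swap) (simp only: sum_distrib_right)
      also have "\<dots> = 0" using d(2) by (intro sum.neutral) simp
      finally show ?thesis .
    qed
    have "d r \<noteq> 0"
    proof
      assume "d r = 0"
      then have "(\<Sum>j<r. d j * \<psi> j 0 t) = 0" for t using rel[of t] by simp
      then show False using \<psi>_indep d(1) \<open>d r = 0\<close> by (metis less_Suc_eq)
    qed
    have "\<phi> i t = (\<Sum>j<r. (- d j / d r) * \<psi> j 0 t)" for t
    proof -
      have "(\<Sum>j<r. (- d j / d r) * \<psi> j 0 t) = - (\<Sum>j<r. d j * \<psi> j 0 t) / d r"
        by (simp add: sum_negf sum_divide_distrib)
      also have "\<dots> = \<phi> i t" using rel[of t] \<open>d r \<noteq> 0\<close> by (simp add: field_simps)
      finally show ?thesis by simp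
    qed
    then show ?thesis by (intro exI[of _ "\<lambda>j. - d j / d r"]) blast
  qed
  moreover have "\<exists>c. \<forall>t. \<psi> l 0 t = (\<Sum>i<r. c i * \<phi> i t)" for l
    using \<psi>_span by (intro exI[of _ "\<lambda>i. \<Sum>j<r. g l j * b j i"]) blast
  ultimately show ?thesis using \<psi> \<psi>_jet by (intro exI[of _ \<psi>] conjI) (auto simp del: One_nat_def)
qed

end

section \<open>Projection onto the space on short intervals\<close>

lemma vector_derivative_bound_interval:
  fixes f :: "real \<Rightarrow> 'b::real_normed_vector"
  assumes "\<And>t. t \<in> {a..b} \<Longrightarrow> (f has_vector_derivative f' t) (at t within {a..b})"
    and "\<And>t. t \<in> {a..b} \<Longrightarrow> norm (f' t) \<le> B"
    and "x \<in> {a..b}" "y \<in> {a..b}"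
  shows "norm (f x - f y) \<le> B * \<bar>x - y\<bar>"
proof -
  have "norm (f x - f y) \<le> B * norm (x - y)"
  proof (rule differentiable_bound[of "{a..b}" f "\<lambda>t s. s *\<^sub>R f' t"])
    fix t assume t: "t \<in> {a..b}"
    show "(f has_derivative (\<lambda>s. s *\<^sub>R f' t)) (at t within {a..b})"
      using assms(1)[OF t] by (simp add: has_vector_derivative_def)
    show "onorm (\<lambda>s. s *\<^sub>R f' t) \<le> B"
      using assms(2)[OF t] by (intro onorm_le) (simp add: mult.commute[of B] mult_left_mono)
  qed (use assms in auto)
  then show ?thesis by simp
qed

text \<open>The mean value inequality descends from order \<open>n\<close> to order 0, each step
  gaining a factor \<open>b - a\<close>. Values are vectors, so the Lagrange form of the remainder
  does not apply; the factorial is given away, since only the power of the length matters.\<close>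

lemma vanishing_jet_bound:
  fixes d :: "nat \<Rightarrow> real \<Rightarrow> 'b::real_normed_vector"
  assumes d: "\<And>k t. k < n \<Longrightarrow> t \<in> {a..b} \<Longrightarrow> (d k has_vector_derivative d (Suc k) t) (at t within {a..b})"
    and zero: "\<And>k. k < n \<Longrightarrow> d k a = 0"
    and bound: "\<And>t. t \<in> {a..b} \<Longrightarrow> norm (d n t) \<le> B"
    and t: "t \<in> {a..b}"
  shows "norm (d 0 t) \<le> B * (b - a) ^ n"
proof -
  have ab: "a \<le> b" using t by auto
  have "0 \<le> B" using bound[OF t] norm_ge_zero order_trans by blast
  have "\<forall>t\<in>{a..b}. norm (d (n - k) t) \<le> B * (b - a) ^ k" if "k \<le> n" for k
    using that
  proof (induction k)
    case 0
    then show ?case using bound by simp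
  next
    case (Suc k)
    define m where "m = n - Suc k"
    have m: "m < n" "Suc m = n - k" using Suc.prems by (auto simp: m_def)
    have IH: "norm (d (Suc m) t) \<le> B * (b - a) ^ k" if "t \<in> {a..b}" for t
      using Suc.IH Suc.prems that m by auto
    have "norm (d m t) \<le> B * (b - a) ^ Suc k" if t: "t \<in> {a..b}" for t
    proof -
      have "norm (d m t - d m a) \<le> B * (b - a) ^ k * \<bar>t - a\<bar>"
        by (rule vector_derivative_bound_interval[of a b "d m" "d (Suc m)"]) (use IH t ab d[OF m(1)] in auto)
      also have "\<dots> \<le> B * (b - a) ^ k * (b - a)"
        using t ab \<open>0 \<le> B\<close> by (intro mult_left_mono) auto
      finally show ?thesis using zero[OF m(1)] by (simp add: mult_ac)
    qed
    then show ?case by (simp add: m_def)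
  qed
  from this[of n] show ?thesis using t by simp
qed

section \<open>Polynomial coefficients and the L1 norm\<close>

text \<open>Substitution gives twice the integral over \<open>{0..1/2}\<close>, a part of the
  interval. This compares \<open>p (x / 2)\<close> with \<open>p x\<close> when the top term of a
  polynomial is eliminated.\<close>

lemma integral_abs_half_le:
  fixes p :: "real \<Rightarrow> real"
  assumes "continuous_on UNIV p"
  shows "integral {0..1} (\<lambda>x. \<bar>p (x / 2)\<bar>) \<le> 2 * integral {0..1} (\<lambda>x. \<bar>p x\<bar>)"
proof -
  have cont: "continuous_on S (\<lambda>x. \<bar>p x\<bar>)" for S
    using assms by (intro continuous_intros) (auto intro: continuous_on_subset)
  have int: "(\<lambda>x. \<bar>p x\<bar>) integrable_on {a..b}" for a b
    by (intro integrable_continuous_interval cont)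
  have "((\<lambda>x. \<bar>p x\<bar>) has_integral integral {0..1/2} (\<lambda>x. \<bar>p x\<bar>)) (cbox 0 (1/2))"
    using integrable_integral[OF int[of 0 "1/2"]] by simp
  from has_integral_affinity[OF this, of "1/2" 0]
  have "((\<lambda>x. \<bar>p (x / 2)\<bar>) has_integral 2 * integral {0..1/2} (\<lambda>x. \<bar>p x\<bar>)) {0..1}"
    using image_mult_atLeastAtMost[of 2 0 "1/2::real"]
    by (simp add: field_simps cbox_interval)
  then have "integral {0..1} (\<lambda>x. \<bar>p (x / 2)\<bar>) = 2 * integral {0..1/2} (\<lambda>x. \<bar>p x\<bar>)"
    by (rule integral_unique)
  also have "integral {0..1/2} (\<lambda>x. \<bar>p x\<bar>) \<le> integral {0..1} (\<lambda>x. \<bar>p x\<bar>)"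
    by (rule integral_subset_le) (use int in auto)
  finally show ?thesis by simp
qed

text \<open>Induction on the degree: \<open>p(x) - 2 ^ n p(x / 2)\<close> has no term of degree \<open>n\<close>, and its other
  coefficients are those of \<open>p\<close> times a factor of modulus at least \<open>1\<close>.\<close>

lemma polynomial_coefficients_le_L1:
  "\<exists>\<kappa>>0. \<forall>b :: nat \<Rightarrow> real.
     \<kappa> * (\<Sum>j<n. \<bar>b j\<bar>) \<le> integral {0..1} (\<lambda>x. \<bar>\<Sum>j<n. b j * x ^ j\<bar>)"
proof (induction n)
  case 0
  then show ?case by (intro exI[of _ 1]) simp
next
  case (Suc n)
  then obtain \<kappa> where \<kappa>: "\<kappa> > 0"
    "\<And>b :: nat \<Rightarrow> real. \<kappa> * (\<Sum>j<n. \<bar>b j\<bar>) \<le> integral {0..1} (\<lambda>x. \<bar>\<Sum>j<n. b j * x ^ j\<bar>)" by blast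
  \<comment> \<open>If \<open>N\<close> is the L1 norm of \<open>p\<close>, that of
    \<open>p x - 2 ^ n * p (x / 2)\<close> is at most \<open>(1 + 2 * 2 ^ n) * N\<close>; dividing
    by \<open>\<kappa>\<close> bounds the lower coefficients.\<close>
  define c where "c = (1 + 2 * 2 ^ n) / \<kappa>"
  have c: "c > 0" using \<kappa> by (auto simp: c_def intro!: divide_pos_pos add_pos_pos)
  define M where "M = c + real (Suc n) * (1 + c)"
  have M: "M > 0" using c unfolding M_def by (intro add_pos_pos) auto
  have "(\<Sum>j<Suc n. \<bar>b j\<bar>) \<le> M * integral {0..1} (\<lambda>x. \<bar>\<Sum>j<Suc n. b j * x ^ j\<bar>)" for b :: "nat \<Rightarrow> real"
  proof -
    define p where "p = (\<lambda>x. \<Sum>j<Suc n. b j * x ^ j)"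
    define N where "N = integral {0..1} (\<lambda>x. \<bar>p x\<bar>)"
    define S where "S = (\<Sum>j<n. \<bar>b j\<bar>)"
    have cont: "continuous_on A p" for A unfolding p_def by (intro continuous_intros)
    have int: "(\<lambda>x. \<bar>p x\<bar>) integrable_on {0..1}" "(\<lambda>x. \<bar>p (x / 2)\<bar>) integrable_on {0..1}"
      unfolding p_def by (intro integrable_continuous_interval continuous_intros; simp)+
    define b' where "b' = (\<lambda>j. b j * (1 - 2 ^ n / 2 ^ j))"
    have q: "(\<Sum>j<n. b' j * x ^ j) = p x - 2 ^ n * p (x / 2)" for x
    proof -
      have "p x - 2 ^ n * p (x / 2) = (\<Sum>j<Suc n. b' j * x ^ j)"
        unfolding p_def b'_def sum_distrib_left sum_subtractf[symmetric]
        by (intro sum.cong) (auto simp: power_divide field_simps)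
      then show ?thesis by (simp add: b'_def)
    qed
    have "S \<le> (\<Sum>j<n. \<bar>b' j\<bar>)"
      unfolding S_def
    proof (rule sum_mono)
      fix j assume "j \<in> {..<n}"
      then have "(2::real) ^ Suc j \<le> 2 ^ n" by (intro power_increasing) auto
      then have "1 \<le> \<bar>1 - 2 ^ n / 2 ^ j :: real\<bar>" by (simp add: field_simps)
      then have "\<bar>b j\<bar> * 1 \<le> \<bar>b j\<bar> * \<bar>1 - 2 ^ n / 2 ^ j\<bar>" by (intro mult_left_mono) auto
      then show "\<bar>b j\<bar> \<le> \<bar>b' j\<bar>" by (simp add: b'_def abs_mult)
    qed
    then have "\<kappa> * S \<le> \<kappa> * (\<Sum>j<n. \<bar>b' j\<bar>)" using \<kappa> by simp
    also have "\<dots> \<le> integral {0..1} (\<lambda>x. \<bar>p x - 2 ^ n * p (x / 2)\<bar>)"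
      using \<kappa>(2)[of b'] unfolding q .
    also have "\<dots> \<le> integral {0..1} (\<lambda>x. \<bar>p x\<bar> + 2 ^ n * \<bar>p (x / 2)\<bar>)"
    proof (rule integral_le)
      show "(\<lambda>x. \<bar>p x - 2 ^ n * p (x / 2)\<bar>) integrable_on {0..1}"
        unfolding p_def by (intro integrable_continuous_interval continuous_intros) simp
      show "(\<lambda>x. \<bar>p x\<bar> + 2 ^ n * \<bar>p (x / 2)\<bar>) integrable_on {0..1}"
        unfolding p_def by (intro integrable_continuous_interval continuous_intros) simp
      fix x :: real
      show "\<bar>p x - 2 ^ n * p (x / 2)\<bar> \<le> \<bar>p x\<bar> + 2 ^ n * \<bar>p (x / 2)\<bar>"
        using abs_triangle_ineq4[of "p x" "2 ^ n * p (x / 2)"] by (simp add: abs_mult)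
    qed
    also have "\<dots> = N + 2 ^ n * integral {0..1} (\<lambda>x. \<bar>p (x / 2)\<bar>)"
      unfolding N_def using int by (subst integral_add) (auto intro: integrable_on_mult_right)
    also have "\<dots> \<le> N + 2 ^ n * (2 * N)"
      unfolding N_def by (intro add_left_mono mult_left_mono integral_abs_half_le cont) simp
    finally have S: "S \<le> c * N" using \<kappa> by (simp add: c_def field_simps)
    \<comment> \<open>With the lower coefficients under control, the top one is recovered from the
      integral of its own monomial.\<close>
    have "((\<lambda>x. \<bar>b n\<bar> * x ^ n) has_integral
        \<bar>b n\<bar> * 1 ^ Suc n / real (Suc n) - \<bar>b n\<bar> * 0 ^ Suc n / real (Suc n)) {0..1}"
    proof (rule fundamental_theorem_of_calculus)
      fix x :: real
      have "((\<lambda>x. \<bar>b n\<bar> * x ^ Suc n / real (Suc n)) has_real_derivative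
          \<bar>b n\<bar> * ((1 + real n) * (1 * x ^ n)) / real (Suc n)) (at x within {0..1})"
        by (intro DERIV_cdivide DERIV_cmult DERIV_power_Suc DERIV_ident)
      moreover have "\<bar>b n\<bar> * ((1 + real n) * (1 * x ^ n)) / real (Suc n) = \<bar>b n\<bar> * x ^ n"
        by simp
      ultimately show "((\<lambda>x. \<bar>b n\<bar> * x ^ Suc n / real (Suc n)) has_vector_derivative
          \<bar>b n\<bar> * x ^ n) (at x within {0..1})"
        by (simp only: has_real_derivative_iff_has_vector_derivative)
    qed simp
    then have "\<bar>b n\<bar> / real (Suc n) = integral {0..1} (\<lambda>x. \<bar>b n\<bar> * x ^ n)"
      by (intro integral_unique[symmetric]) (simp del: of_nat_Suc)
    also have "\<dots> \<le> integral {0..1} (\<lambda>x. \<bar>p x\<bar> + S)"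
    proof (rule integral_le)
      show "(\<lambda>x. \<bar>b n\<bar> * x ^ n) integrable_on {0..1}"
        by (intro integrable_continuous_interval continuous_intros)
      show "(\<lambda>x. \<bar>p x\<bar> + S) integrable_on {0..1}"
        by (intro integrable_continuous_interval continuous_intros cont)
      fix x :: real assume x: "x \<in> {0..1}"
      have "\<bar>\<Sum>j<n. b j * x ^ j\<bar> \<le> S"
        unfolding S_def using x
        by (intro order_trans[OF sum_abs] sum_mono)
          (auto simp: abs_mult power_le_one intro!: mult_left_le)
      moreover have "\<bar>b n\<bar> * x ^ n = \<bar>b n * x ^ n\<bar>" using x by (simp add: abs_mult)
      ultimately show "\<bar>b n\<bar> * x ^ n \<le> \<bar>p x\<bar> + S" unfolding p_def by simp
    qed
    also have "\<dots> = N + S" unfolding N_def using int by (subst integral_add) auto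
    finally have "\<bar>b n\<bar> \<le> real (Suc n) * (N + S)" by (simp add: field_simps)
    also have "\<dots> \<le> real (Suc n) * (N + c * N)" using S by (intro mult_left_mono) auto
    finally have "\<bar>b n\<bar> + S \<le> M * N" using S by (simp add: M_def algebra_simps)
    then show ?thesis by (simp add: S_def N_def p_def)
  qed
  then show ?case using M by (intro exI[of _ "1 / M"]) (simp add: field_simps)
qed

text \<open>Cauchy-Schwarz against the constant 1, obtained by integrating the nonnegative square of
  \<open>p\<close> minus its mean.\<close>

lemma integral_square_ge:
  fixes p :: "real \<Rightarrow> real"
  assumes "continuous_on {0..1} p"
  shows "(integral {0..1} p)\<^sup>2 \<le> integral {0..1} (\<lambda>x. (p x)\<^sup>2)"
proof -
  define c where "c = integral {0..1} p"
  have int: "p integrable_on {0..1}" "(\<lambda>x. (p x)\<^sup>2) integrable_on {0..1}"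
    using assms by (intro integrable_continuous_interval continuous_intros; simp)+
  have "integral {0..1} (\<lambda>x. 2 * c * p x - c\<^sup>2) \<le> integral {0..1} (\<lambda>x. (p x)\<^sup>2)"
  proof (rule integral_le)
    show "(\<lambda>x. 2 * c * p x - c\<^sup>2) integrable_on {0..1}"
      using assms by (intro integrable_continuous_interval continuous_intros)
    fix x show "2 * c * p x - c\<^sup>2 \<le> (p x)\<^sup>2"
      using zero_le_power2[of "p x - c"] by (simp add: power2_diff mult_ac)
  qed (rule int)
  moreover have "integral {0..1} (\<lambda>x. 2 * c * p x - c\<^sup>2) = 2 * c * c - c\<^sup>2"
    using int by (subst integral_diff) (auto simp: c_def intro: integrable_on_mult_right)
  ultimately show ?thesis by (simp add: c_def power2_eq_square)
qed

section \<open>Uniform stability of the projection\<close>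

locale jet_basis =
  fixes r :: nat and \<psi> :: "nat \<Rightarrow> nat \<Rightarrow> real \<Rightarrow> real" and t0 :: real
  assumes \<psi>_deriv: "\<And>j k t. j < r \<Longrightarrow> (\<psi> j k has_real_derivative \<psi> j (Suc k) t) (at t)"
    and \<psi>_jet: "\<And>j k. j < r \<Longrightarrow> k < r \<Longrightarrow> \<psi> j k t0 = (if j = k then 1 else 0)"
begin

lemma \<psi>_continuous: "j < r \<Longrightarrow> continuous_on S (\<psi> j k)"
  using \<psi>_deriv by (meson DERIV_continuous_on has_field_derivative_at_within)

lemma \<psi>_continuous_comp:
  "j < r \<Longrightarrow> continuous_on S g \<Longrightarrow> continuous_on S (\<lambda>x. \<psi> j k (g x))"
  using continuous_on_compose2[OF \<psi>_continuous[of j UNIV k]] by blast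

lemma \<psi>_bounded: "\<exists>K\<ge>0. \<forall>j<r. \<forall>t\<in>{t0..t0 + 1}. \<bar>\<psi> j k t\<bar> \<le> K"
proof -
  have "\<exists>K. \<forall>t\<in>{t0..t0+1}. \<bar>\<psi> j k t\<bar> \<le> K" if "j < r" for j
  proof -
    have "compact (\<psi> j k ` {t0..t0+1})"
      by (intro compact_continuous_image \<psi>_continuous that) auto
    then show ?thesis by (meson bounded_real compact_imp_bounded imageI)
  qed
  then obtain m where m: "\<And>j t. j < r \<Longrightarrow> t \<in> {t0..t0+1} \<Longrightarrow> \<bar>\<psi> j k t\<bar> \<le> m j" by metis
  have "\<bar>\<psi> j k t\<bar> \<le> (\<Sum>j<r. \<bar>m j\<bar>)" if "j < r" "t \<in> {t0..t0+1}" for j t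
  proof -
    have "\<bar>m j\<bar> \<le> (\<Sum>j<r. \<bar>m j\<bar>)" using that by (intro member_le_sum) auto
    then show ?thesis using m[OF that] by linarith
  qed
  then show ?thesis by (intro exI[of _ "\<Sum>j<r. \<bar>m j\<bar>"]) (auto intro: sum_nonneg)
qed

text \<open>The subtraction in the exponent is truncated: no decay is claimed for \<open>k \<ge> j\<close>.\<close>

lemma \<psi>_small:
  "\<exists>K\<ge>0. \<forall>j<r. \<forall>h\<in>{0<..1}. \<forall>t\<in>{t0..t0 + h}. \<bar>\<psi> j k t\<bar> \<le> K * h ^ (j - k)"
proof -
  have "\<exists>f. \<forall>i. f i \<ge> 0 \<and> (\<forall>j<r. \<forall>t\<in>{t0..t0 + 1}. \<bar>\<psi> j i t\<bar> \<le> f i)"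
    by (intro choice allI) (use \<psi>_bounded in blast)
  then obtain m where m0: "\<And>i. m i \<ge> (0::real)"
    and m: "\<And>i j t. j < r \<Longrightarrow> t \<in> {t0..t0 + 1} \<Longrightarrow> \<bar>\<psi> j i t\<bar> \<le> m i" by blast
  \<comment> \<open>The derivative that gets bounded has order \<open>k + (j - k)\<close>, the
    larger of \<open>j\<close> and \<open>k\<close>, hence at most \<open>max r k\<close>.\<close>
  define K where "K = (\<Sum>i\<le>max r k. m i)"
  have K: "m i \<le> K" if "i \<le> max r k" for i
    unfolding K_def using that m0 by (intro member_le_sum) auto
  have "\<bar>\<psi> j k t\<bar> \<le> K * h ^ (j - k)" if "j < r" "h \<in> {0<..1}" "t \<in> {t0..t0 + h}" for j h t
  proof -
    have "norm (\<psi> j (k + 0) t) \<le> K * (t0 + h - t0) ^ (j - k)"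
    proof (rule vanishing_jet_bound[of "j - k" t0 "t0 + h" "\<lambda>i. \<psi> j (k + i)"])
      fix i s assume "s \<in> {t0..t0 + h}"
      show "(\<psi> j (k + i) has_vector_derivative \<psi> j (k + Suc i) s) (at s within {t0..t0 + h})"
        using \<psi>_deriv[OF that(1), of "k + i" s]
        by (simp add: has_real_derivative_iff_has_vector_derivative has_vector_derivative_at_within)
    next
      fix i assume "i < j - k"
      then show "\<psi> j (k + i) t0 = 0" using \<psi>_jet[of j "k + i"] that by auto
    next
      fix s assume "s \<in> {t0..t0 + h}"
      then have "\<bar>\<psi> j (k + (j - k)) s\<bar> \<le> m (k + (j - k))" using that by (intro m) auto
      also have "\<dots> \<le> K" using that by (intro K) auto
      finally show "norm (\<psi> j (k + (j - k)) s) \<le> K" by simp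
    qed (use that in auto)
    then show ?thesis by simp
  qed
  moreover have "K \<ge> 0" unfolding K_def by (intro sum_nonneg m0)
  ultimately show ?thesis by blast
qed

text \<open>\<open>\<psi> j 0\<close> and the Taylor monomial of degree \<open>j\<close> have the
  same jet of length \<open>r\<close> at \<open>t0\<close>, and the derivative of order
  \<open>r\<close> of the monomial is 0 because \<open>j < r\<close>.\<close>

lemma \<psi>_near_monomial:
  "\<exists>K\<ge>0. \<forall>j<r. \<forall>h\<in>{0<..1}. \<forall>s\<in>{0..h}. \<bar>\<psi> j 0 (t0 + s) - s ^ j / fact j\<bar> \<le> K * h ^ r"
proof -
  obtain K where K: "K \<ge> 0" "\<And>j t. j < r \<Longrightarrow> t \<in> {t0..t0 + 1} \<Longrightarrow> \<bar>\<psi> j r t\<bar> \<le> K"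
    using \<psi>_bounded by blast
  have "\<bar>\<psi> j 0 (t0 + s) - s ^ j / fact j\<bar> \<le> K * h ^ r"
    if j: "j < r" and h: "h \<in> {0<..1}" and s: "s \<in> {0..h}" for j h s
  proof -
    define q where "q = (\<lambda>k t. if k \<le> j then (t - t0) ^ (j - k) / fact (j - k) else (0::real))"
    define d where "d = (\<lambda>k t. \<psi> j k t - q k t)"
    have q: "(q k has_real_derivative q (Suc k) t) (at t)" for k t
    proof (cases "k < j")
      case True
      define m where "m = j - Suc k"
      have m: "j - k = Suc m" "j - Suc k = m" using True by (auto simp: m_def)
      have "((\<lambda>t. (t - t0) ^ Suc m / fact (Suc m)) has_real_derivative
          (1 + real m) * ((1 - 0) * (t - t0) ^ m) / fact (Suc m)) (at t)"
        by (intro DERIV_cdivide DERIV_power_Suc DERIV_diff DERIV_ident DERIV_const)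
      also have "(1 + real m) * ((1 - 0) * (t - t0) ^ m) / fact (Suc m) = (t - t0) ^ m / fact m"
        by (simp add: divide_simps)
      finally have "((\<lambda>t. (t - t0) ^ Suc m / fact (Suc m)) has_real_derivative
          (t - t0) ^ m / fact m) (at t)" .
      then show ?thesis using True m by (simp add: q_def)
    next
      case False
      then have "q k = (\<lambda>t. if k = j then 1 else 0)" "q (Suc k) t = 0" by (auto simp: q_def)
      then show ?thesis by simp
    qed
    have "norm (d 0 (t0 + s)) \<le> K * (t0 + h - t0) ^ r"
    proof (rule vanishing_jet_bound[of r t0 "t0 + h" d])
      fix k t assume "t \<in> {t0..t0 + h}"
      have "(d k has_real_derivative d (Suc k) t) (at t)"
        unfolding d_def by (intro DERIV_diff \<psi>_deriv j q)
      then show "(d k has_vector_derivative d (Suc k) t) (at t within {t0..t0 + h})"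
        by (simp add: has_real_derivative_iff_has_vector_derivative has_vector_derivative_at_within)
    next
      fix k assume "k < r"
      then show "d k t0 = 0" using j \<psi>_jet by (auto simp: d_def q_def power_0_left)
    next
      fix t assume "t \<in> {t0..t0 + h}"
      then show "norm (d r t) \<le> K" using K(2)[of j t] j h by (auto simp: d_def q_def)
    qed (use s in auto)
    then show ?thesis by (simp add: d_def q_def)
  qed
  then show ?thesis using K(1) by blast
qed

text \<open>On the rescaled step \<open>\<psi> j 0\<close> is \<open>h ^ j * x ^ j / fact j\<close>
  up to \<open>K * h ^ r\<close>, which for \<open>j < r\<close> is at most \<open>K * h\<close>
  times the weight \<open>h ^ j\<close>. The inequality for polynomials therefore survives, with a
  smaller constant, once \<open>h\<close> is small.\<close>

lemma coefficients_le_L1: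
  "\<exists>\<kappa>>0. \<exists>h1\<in>{0<..1}. \<forall>h\<in>{0<..h1}. \<forall>b :: nat \<Rightarrow> real.
     \<kappa> * (\<Sum>j<r. \<bar>b j\<bar> * h ^ j) \<le> integral {0..1} (\<lambda>x. \<bar>\<Sum>j<r. b j * \<psi> j 0 (t0 + x * h)\<bar>)"
proof -
  obtain \<kappa> where \<kappa>: "\<kappa> > 0" "\<And>b :: nat \<Rightarrow> real.
      \<kappa> * (\<Sum>j<r. \<bar>b j\<bar>) \<le> integral {0..1} (\<lambda>x. \<bar>\<Sum>j<r. b j * x ^ j\<bar>)"
    using polynomial_coefficients_le_L1[of r] by blast
  obtain K where K: "K \<ge> 0" "\<And>j h s. j < r \<Longrightarrow> h \<in> {0<..1} \<Longrightarrow> s \<in> {0..h} \<Longrightarrow>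
      \<bar>\<psi> j 0 (t0 + s) - s ^ j / fact j\<bar> \<le> K * h ^ r"
    using \<psi>_near_monomial by blast
  \<comment> \<open>\<open>fact r\<close> dominates every \<open>fact j\<close> occurring in the
    rescaled coefficients.\<close>
  define \<mu> where "\<mu> = \<kappa> / fact r"
  have \<mu>: "\<mu> > 0" using \<kappa> by (simp add: \<mu>_def)
  \<comment> \<open>Makes \<open>K * h\<close> at most \<open>\<mu> / 2\<close>, so that half of the
    lower bound absorbs the perturbation; \<open>K + 1\<close> admits \<open>K = 0\<close>.\<close>
  define h1 where "h1 = min 1 (\<mu> / (2 * (K + 1)))"
  have h1: "h1 \<in> {0<..1}" using \<mu> K by (auto simp: h1_def)
  have "\<mu> / 2 * (\<Sum>j<r. \<bar>b j\<bar> * h ^ j) \<le> integral {0..1} (\<lambda>x. \<bar>\<Sum>j<r. b j * \<psi> j 0 (t0 + x * h)\<bar>)"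
    if h: "h \<in> {0<..h1}" for h and b :: "nat \<Rightarrow> real"
  proof -
    have h': "0 < h" "h \<le> 1" using h h1 by auto
    define S where "S = (\<Sum>j<r. \<bar>b j\<bar> * h ^ j)"
    have S0: "0 \<le> S" unfolding S_def using h' by (intro sum_nonneg) auto
    define \<beta> where "\<beta> = (\<lambda>j. b j * h ^ j / fact j)"
    define P where "P = (\<lambda>x. \<Sum>j<r. \<beta> j * x ^ j)"
    define p where "p = (\<lambda>x. \<Sum>j<r. b j * \<psi> j 0 (t0 + x * h))"
    have contp: "continuous_on A p" for A
      unfolding p_def by (intro continuous_intros \<psi>_continuous_comp) auto
    have close: "\<bar>P x - p x\<bar> \<le> K * h * S" if x: "x \<in> {0..1}" for x
    proof -
      have "\<bar>P x - p x\<bar> = \<bar>\<Sum>j<r. b j * ((x * h) ^ j / fact j - \<psi> j 0 (t0 + x * h))\<bar>"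
        unfolding P_def p_def \<beta>_def sum_subtractf[symmetric]
        by (simp add: algebra_simps power_mult_distrib)
      also have "\<dots> \<le> (\<Sum>j<r. \<bar>b j\<bar> * (K * (h * h ^ j)))"
      proof (rule order_trans[OF sum_abs], rule sum_mono)
        fix j assume j: "j \<in> {..<r}"
        have "x * h \<le> h" using x h' by (simp add: mult_le_cancel_right1)
        then have "\<bar>(x * h) ^ j / fact j - \<psi> j 0 (t0 + x * h)\<bar> \<le> K * h ^ r"
          using K(2)[of j h "x * h"] j h' x by (auto simp: abs_minus_commute)
        also have "\<dots> \<le> K * h ^ Suc j"
          using K(1) h' j by (intro mult_left_mono power_decreasing) auto
        finally show "\<bar>b j * ((x * h) ^ j / fact j - \<psi> j 0 (t0 + x * h))\<bar> \<le> \<bar>b j\<bar> * (K * (h * h ^ j))"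
          unfolding abs_mult by (intro mult_left_mono) auto
      qed
      also have "\<dots> = K * h * S" by (simp add: S_def sum_distrib_left mult_ac)
      finally show ?thesis .
    qed
    have "\<mu> * S \<le> \<kappa> * (\<Sum>j<r. \<bar>\<beta> j\<bar>)"
    proof -
      have "S / fact r \<le> (\<Sum>j<r. \<bar>\<beta> j\<bar>)"
        unfolding S_def sum_divide_distrib
      proof (rule sum_mono)
        fix j assume "j \<in> {..<r}"
        then have "(fact j :: real) \<le> fact r" by (intro fact_mono) auto
        then show "\<bar>b j\<bar> * h ^ j / fact r \<le> \<bar>\<beta> j\<bar>"
          using h' by (auto simp: \<beta>_def abs_mult intro!: divide_left_mono)
      qed
      then have "\<kappa> * (S / fact r) \<le> \<kappa> * (\<Sum>j<r. \<bar>\<beta> j\<bar>)" using \<kappa> by (intro mult_left_mono) auto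
      then show ?thesis by (simp add: \<mu>_def)
    qed
    also have "\<dots> \<le> integral {0..1} (\<lambda>x. \<bar>P x\<bar>)" unfolding P_def by (rule \<kappa>(2))
    also have "\<dots> \<le> integral {0..1} (\<lambda>x. \<bar>p x\<bar> + K * h * S)"
    proof (rule integral_le)
      show "(\<lambda>x. \<bar>P x\<bar>) integrable_on {0..1}"
        unfolding P_def by (intro integrable_continuous_interval continuous_intros)
      show "(\<lambda>x. \<bar>p x\<bar> + K * h * S) integrable_on {0..1}"
        by (intro integrable_continuous_interval continuous_intros contp)
      fix x :: real assume "x \<in> {0..1}"
      from close[OF this] show "\<bar>P x\<bar> \<le> \<bar>p x\<bar> + K * h * S" by linarith
    qed
    also have "\<dots> = integral {0..1} (\<lambda>x. \<bar>p x\<bar>) + K * h * S"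
      by (subst integral_add) (auto intro!: integrable_continuous_interval continuous_intros contp)
    finally have 1: "\<mu> * S \<le> integral {0..1} (\<lambda>x. \<bar>p x\<bar>) + K * h * S" .
    have "K * h \<le> \<mu> / 2"
    proof -
      have "K * h \<le> (K + 1) * h" using h' by simp
      also have "\<dots> \<le> (K + 1) * (\<mu> / (2 * (K + 1)))"
        using h K(1) by (intro mult_left_mono) (auto simp: h1_def)
      also have "\<dots> = \<mu> / 2" using K(1) by (simp add: field_simps)
      finally show ?thesis .
    qed
    then have "K * h * S \<le> \<mu> / 2 * S" using S0 by (rule mult_right_mono)
    then show ?thesis using 1 by (simp add: S_def p_def)
  qed
  then show ?thesis using \<mu> h1 by (intro exI[of _ "\<mu> / 2"] conjI bexI[of _ h1]) auto
qed

text \<open>Orthogonality tested against the projection \<open>p\<close> itself equates its squared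
  L2 norm with the integral of \<open>p * \<eta>\<close>, which is at most \<open>\<epsilon>\<close>
  times its L1 norm \<open>N\<close>. As the L2 norm dominates \<open>N\<close>, this gives
  \<open>N \<le> \<epsilon>\<close>, and \<open>N\<close> controls the weighted
  coefficients.\<close>

lemma projection_stability_real:
  "\<exists>K\<ge>0. \<exists>h1\<in>{0<..1}. \<forall>h\<in>{0<..h1}. \<forall>(b :: nat \<Rightarrow> real) \<eta> \<epsilon>.
     continuous_on {0..1} \<eta> \<longrightarrow> (\<forall>x\<in>{0..1}. \<bar>\<eta> x\<bar> \<le> \<epsilon>) \<longrightarrow>
     (\<forall>j<r. integral {0..1} (\<lambda>x. \<psi> j 0 (t0 + x * h) *
        ((\<Sum>l<r. b l * \<psi> l 0 (t0 + x * h)) - \<eta> x)) = 0) \<longrightarrow>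
     (\<Sum>j<r. \<bar>b j\<bar> * h ^ j) \<le> K * \<epsilon>"
proof -
  obtain \<kappa> h1 where \<kappa>: "\<kappa> > 0" and h1: "h1 \<in> {0<..1}" and
    lower: "\<And>h (b :: nat \<Rightarrow> real). h \<in> {0<..h1} \<Longrightarrow>
      \<kappa> * (\<Sum>j<r. \<bar>b j\<bar> * h ^ j) \<le> integral {0..1} (\<lambda>x. \<bar>\<Sum>j<r. b j * \<psi> j 0 (t0 + x * h)\<bar>)"
    using coefficients_le_L1 by blast
  have "(\<Sum>j<r. \<bar>b j\<bar> * h ^ j) \<le> 1 / \<kappa> * \<epsilon>"
    if h: "h \<in> {0<..h1}" and \<eta>: "continuous_on {0..1} \<eta>" "\<forall>x\<in>{0..1}. \<bar>\<eta> x\<bar> \<le> \<epsilon>"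
      and orth: "\<forall>j<r. integral {0..1} (\<lambda>x. \<psi> j 0 (t0 + x * h) *
        ((\<Sum>l<r. b l * \<psi> l 0 (t0 + x * h)) - \<eta> x)) = 0" for h b \<eta> \<epsilon>
  proof -
    define p where "p = (\<lambda>x. \<Sum>l<r. b l * \<psi> l 0 (t0 + x * h))"
    have contp: "continuous_on {0..1} p"
      unfolding p_def by (intro continuous_intros \<psi>_continuous_comp) auto
    define N where "N = integral {0..1} (\<lambda>x. \<bar>p x\<bar>)"
    have "integral {0..1} (\<lambda>x. p x * (p x - \<eta> x))
        = integral {0..1} (\<lambda>x. \<Sum>j<r. b j * (\<psi> j 0 (t0 + x * h) * (p x - \<eta> x)))"
    proof (rule arg_cong[where f = "integral {0..1}"], rule ext)
      fix x
      have "p x * (p x - \<eta> x) = (\<Sum>l<r. b l * \<psi> l 0 (t0 + x * h)) * (p x - \<eta> x)"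
        by (simp add: p_def)
      then show "p x * (p x - \<eta> x) = (\<Sum>j<r. b j * (\<psi> j 0 (t0 + x * h) * (p x - \<eta> x)))"
        by (simp only: sum_distrib_right mult.assoc)
    qed
    also have "\<dots> = (\<Sum>j<r. b j * integral {0..1} (\<lambda>x. \<psi> j 0 (t0 + x * h) * (p x - \<eta> x)))"
      by (subst integral_sum)
        (auto intro!: integrable_continuous_interval continuous_intros contp \<eta> \<psi>_continuous_comp)
    also have "\<dots> = 0" using orth unfolding p_def by (intro sum.neutral) auto
    finally have zero: "integral {0..1} (\<lambda>x. p x * (p x - \<eta> x)) = 0" .
    have "N\<^sup>2 \<le> integral {0..1} (\<lambda>x. \<bar>p x\<bar>\<^sup>2)"
      unfolding N_def by (intro integral_square_ge continuous_intros contp)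
    also have "\<dots> = integral {0..1} (\<lambda>x. p x * (p x - \<eta> x) + p x * \<eta> x)"
      by (simp add: power2_eq_square algebra_simps)
    also have "\<dots> = integral {0..1} (\<lambda>x. p x * \<eta> x)"
      using zero by (subst integral_add)
        (auto intro!: integrable_continuous_interval continuous_intros contp \<eta>)
    also have "\<dots> \<le> integral {0..1} (\<lambda>x. \<epsilon> * \<bar>p x\<bar>)"
    proof (rule integral_le)
      show "(\<lambda>x. p x * \<eta> x) integrable_on {0..1}" "(\<lambda>x. \<epsilon> * \<bar>p x\<bar>) integrable_on {0..1}"
        by (intro integrable_continuous_interval continuous_intros contp \<eta>)+
      fix x :: real assume "x \<in> {0..1}"
      then have "\<bar>p x\<bar> * \<bar>\<eta> x\<bar> \<le> \<bar>p x\<bar> * \<epsilon>" using \<eta> by (intro mult_left_mono) auto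
      then show "p x * \<eta> x \<le> \<epsilon> * \<bar>p x\<bar>"
        using abs_ge_self[of "p x * \<eta> x"] by (simp add: abs_mult mult.commute)
    qed
    also have "\<dots> = \<epsilon> * N" by (simp add: N_def)
    finally have "N * N \<le> \<epsilon> * N" by (simp add: power2_eq_square)
    have "0 \<le> N"
      unfolding N_def
      by (rule integral_nonneg) (auto intro!: integrable_continuous_interval continuous_intros contp)
    have "\<bar>\<eta> 0\<bar> \<le> \<epsilon>" using \<eta>(2) by simp
    then have "0 \<le> \<epsilon>" by linarith
    have "N \<le> \<epsilon>"
    proof (cases "N = 0")
      case False
      then show ?thesis using \<open>N * N \<le> \<epsilon> * N\<close> \<open>0 \<le> N\<close> by simp
    qed (use \<open>0 \<le> \<epsilon>\<close> in simp)
    then have "\<kappa> * (\<Sum>j<r. \<bar>b j\<bar> * h ^ j) \<le> \<epsilon>" using lower[OF h, of b] by (simp add: N_def p_def)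
    then show ?thesis using \<kappa> by (simp add: field_simps)
  qed
  then show ?thesis using \<kappa> h1 by (intro exI[of _ "1 / \<kappa>"] conjI bexI[of _ h1]) auto
qed

text \<open>The entries decouple because the basis functions are scalar; the factor
  \<open>CARD('m)\<close> comes from bounding a norm by the sum of the moduli of the
  entries.\<close>

lemma projection_stability:
  "\<exists>K\<ge>0. \<exists>h1\<in>{0<..1}. \<forall>h\<in>{0<..h1}. \<forall>(b :: nat \<Rightarrow> real ^ 'm::finite) \<eta> \<epsilon>.
     continuous_on {0..1} \<eta> \<longrightarrow> (\<forall>x\<in>{0..1}. norm (\<eta> x) \<le> \<epsilon>) \<longrightarrow>
     (\<forall>j<r. integral {0..1} (\<lambda>x. \<psi> j 0 (t0 + x * h) *\<^sub>R
        ((\<Sum>l<r. \<psi> l 0 (t0 + x * h) *\<^sub>R b l) - \<eta> x)) = 0) \<longrightarrow>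
     (\<Sum>j<r. norm (b j) * h ^ j) \<le> K * \<epsilon>"
proof -
  obtain K h1 where K: "K \<ge> 0" and h1: "h1 \<in> {0<..1}" and
    stab: "\<And>h (b :: nat \<Rightarrow> real) \<eta> \<epsilon>. h \<in> {0<..h1} \<Longrightarrow> continuous_on {0..1} \<eta> \<Longrightarrow>
      (\<forall>x\<in>{0..1}. \<bar>\<eta> x\<bar> \<le> \<epsilon>) \<Longrightarrow>
      (\<forall>j<r. integral {0..1} (\<lambda>x. \<psi> j 0 (t0 + x * h) *
        ((\<Sum>l<r. b l * \<psi> l 0 (t0 + x * h)) - \<eta> x)) = 0) \<Longrightarrow>
      (\<Sum>j<r. \<bar>b j\<bar> * h ^ j) \<le> K * \<epsilon>"
    using projection_stability_real by blast
  have "(\<Sum>j<r. norm (b j) * h ^ j) \<le> (CARD('m) * K) * \<epsilon>"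
    if h: "h \<in> {0<..h1}" and \<eta>: "continuous_on {0..1} \<eta>" "\<forall>x\<in>{0..1}. norm (\<eta> x) \<le> \<epsilon>"
      and orth: "\<forall>j<r. integral {0..1} (\<lambda>x. \<psi> j 0 (t0 + x * h) *\<^sub>R
        ((\<Sum>l<r. \<psi> l 0 (t0 + x * h) *\<^sub>R b l) - \<eta> x)) = 0"
    for h and b :: "nat \<Rightarrow> real ^ 'm" and \<eta> \<epsilon>
  proof -
    have comp: "(\<Sum>j<r. \<bar>b j $ i\<bar> * h ^ j) \<le> K * \<epsilon>" for i
    proof (rule stab[OF h, of "\<lambda>x. \<eta> x $ i"])
      show "continuous_on {0..1} (\<lambda>x. \<eta> x $ i)" using \<eta> by (intro continuous_intros)
      show "\<forall>x\<in>{0..1}. \<bar>\<eta> x $ i\<bar> \<le> \<epsilon>" using \<eta>(2) component_le_norm_cart order_trans by blast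
      show "\<forall>j<r. integral {0..1} (\<lambda>x. \<psi> j 0 (t0 + x * h) *
        ((\<Sum>l<r. b l $ i * \<psi> l 0 (t0 + x * h)) - \<eta> x $ i)) = 0"
      proof (intro allI impI)
        fix j assume j: "j < r"
        let ?F = "\<lambda>x. \<psi> j 0 (t0 + x * h) *\<^sub>R ((\<Sum>l<r. \<psi> l 0 (t0 + x * h) *\<^sub>R b l) - \<eta> x)"
        have "?F integrable_on {0..1}"
          using j by (intro integrable_continuous_interval continuous_intros \<psi>_continuous_comp \<eta>) auto
        then have "integral {0..1} (\<lambda>x. ?F x $ i) = integral {0..1} ?F $ i"
          by (rule integral_component_eq_cart)
        also have "\<dots> = 0" using orth j by simp
        finally show "integral {0..1} (\<lambda>x. \<psi> j 0 (t0 + x * h) *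
            ((\<Sum>l<r. b l $ i * \<psi> l 0 (t0 + x * h)) - \<eta> x $ i)) = 0"
          by (simp add: mult.commute)
      qed
    qed
    have "(\<Sum>j<r. norm (b j) * h ^ j) \<le> (\<Sum>j<r. (\<Sum>i\<in>UNIV. \<bar>b j $ i\<bar>) * h ^ j)"
      using h by (intro sum_mono mult_right_mono norm_le_l1_cart) auto
    also have "\<dots> = (\<Sum>i\<in>UNIV. \<Sum>j<r. \<bar>b j $ i\<bar> * h ^ j)"
      unfolding sum_distrib_right by (rule sum.swap)
    also have "\<dots> \<le> (\<Sum>i\<in>(UNIV :: 'm set). K * \<epsilon>)" by (intro sum_mono comp)
    finally show ?thesis by simp
  qed
  then show ?thesis using K h1 by (intro exI[of _ "CARD('m) * K"] conjI bexI[of _ h1]) auto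
qed

end

section \<open>Families of functions with uniformly bounded derivatives\<close>

lemma smooth_on_differentiable: "smooth_on UNIV f \<Longrightarrow> f differentiable (at x)"
  unfolding smooth_on_def by (drule spec[of _ "Suc 0"]) simp

lemma smooth_on_frechet_derivative:
  "smooth_on UNIV f \<Longrightarrow> smooth_on UNIV (\<lambda>x. frechet_derivative f (at x) v)"
  unfolding smooth_on_def
proof
  fix k assume "\<forall>k. Ck_on k UNIV f"
  then have "Ck_on (Suc k) UNIV f" by blast
  then show "Ck_on k UNIV (\<lambda>x. frechet_derivative f (at x) v)" by simp
qed

lemma smooth_on_has_derivative:
  assumes "smooth_on UNIV f"
  shows "(f has_derivative frechet_derivative f (at x)) (at x within S)"
  by (rule has_derivative_at_withinI,
      rule frechet_derivative_works[THEN iffD1, OF smooth_on_differentiable[OF assms]])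

lemma smooth_on_continuous:
  assumes "smooth_on UNIV f"
  shows "continuous_on S f"
  by (rule continuous_at_imp_continuous_on)
    (intro ballI differentiable_imp_continuous_within smooth_on_differentiable[OF assms])

lemma smooth_on_bounded:
  fixes f :: "real ^ 'm::finite \<Rightarrow> 'b::real_normed_vector"
  assumes "smooth_on UNIV f"
  shows "\<exists>K\<ge>0. \<forall>x\<in>cball c R. norm (f x) \<le> K"
proof -
  have "bounded (f ` cball c R)"
    by (rule compact_imp_bounded,
        rule compact_continuous_image[OF smooth_on_continuous[OF assms] compact_cball])
  then obtain K where "K > 0" "\<forall>x\<in>f ` cball c R. norm x \<le> K" by (auto simp: bounded_pos)
  then show ?thesis by (intro exI[of _ K]) auto
qed

lemma linear_eq_sum_axis:
  fixes L :: "real ^ 'm::finite \<Rightarrow> 'b::real_vector"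
  assumes "linear L"
  shows "L v = (\<Sum>i\<in>UNIV. v $ i *\<^sub>R L (axis i 1))"
proof -
  have "v = (\<Sum>i\<in>UNIV. v $ i *\<^sub>R axis i 1)"
    using basis_expansion[of v] by (simp add: scalar_mult_eq_scaleR)
  then have "L v = L (\<Sum>i\<in>UNIV. v $ i *\<^sub>R axis i 1)" by simp
  then show ?thesis by (simp add: linear_sum[OF assms] linear_cmul[OF assms])
qed

text \<open>\<open>smooth_on\<close> controls the derivative along a fixed vector only; the
  coordinate directions reduce a varying direction to finitely many smooth functions.\<close>

lemma frechet_derivative_eq_sum_axis:
  fixes f :: "real ^ 'm::finite \<Rightarrow> 'b::real_normed_vector"
  assumes "smooth_on UNIV f"
  shows "frechet_derivative f (at x) v = (\<Sum>i\<in>UNIV. v $ i *\<^sub>R frechet_derivative f (at x) (axis i 1))"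
  by (rule linear_eq_sum_axis)
    (use smooth_on_has_derivative[OF assms, of x UNIV] in \<open>auto dest: has_derivative_linear\<close>)

lemma smooth_on_lipschitz:
  fixes f :: "real ^ 'm::finite \<Rightarrow> 'b::real_normed_vector"
  assumes f: "smooth_on UNIV f"
  shows "\<exists>L\<ge>0. \<forall>x\<in>cball c R. \<forall>y\<in>cball c R. norm (f x - f y) \<le> L * norm (x - y)"
proof -
  have "\<forall>i. \<exists>K\<ge>0. \<forall>x\<in>cball c R. norm (frechet_derivative f (at x) (axis i 1)) \<le> K"
    by (intro allI smooth_on_bounded smooth_on_frechet_derivative f)
  from choice[OF this] obtain K where K0: "\<And>i. K i \<ge> 0"
    and K: "\<And>i x. x \<in> cball c R \<Longrightarrow> norm (frechet_derivative f (at x) (axis i 1)) \<le> K i" by blast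
  have "norm (f x - f y) \<le> (\<Sum>i\<in>UNIV. K i) * norm (x - y)" if "x \<in> cball c R" "y \<in> cball c R" for x y
  proof (rule differentiable_bound[OF convex_cball smooth_on_has_derivative[OF f] _ that])
    fix z assume z: "z \<in> cball c R"
    show "onorm (frechet_derivative f (at z)) \<le> (\<Sum>i\<in>UNIV. K i)"
    proof (rule onorm_le)
      fix v
      have "norm (frechet_derivative f (at z) v) \<le> (\<Sum>i\<in>UNIV. norm v * K i)"
        by (subst frechet_derivative_eq_sum_axis[OF f])
          (auto intro!: order_trans[OF norm_sum] sum_mono mult_mono K z component_le_norm_cart)
      then show "norm (frechet_derivative f (at z) v) \<le> (\<Sum>i\<in>UNIV. K i) * norm v"
        by (simp add: sum_distrib_left mult.commute)
    qed
  qed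
  then show ?thesis by (intro exI[of _ "\<Sum>i\<in>UNIV. K i"]) (auto intro: sum_nonneg K0)
qed

text \<open>Once the linear map at \<open>x\<close> is subtracted, the derivative along the segment
  from \<open>x\<close> to \<open>y\<close> is a difference of derivatives of \<open>f\<close>, of
  order \<open>norm (y - x)\<close> by their Lipschitz bound; the mean value inequality supplies the
  second factor.\<close>

lemma smooth_on_quadratic_remainder:
  fixes f :: "real ^ 'm::finite \<Rightarrow> 'b::real_normed_vector"
  assumes f: "smooth_on UNIV f"
  shows "\<exists>K\<ge>0. \<forall>x\<in>cball c R. \<forall>y\<in>cball c R.
    norm (f y - f x - (\<Sum>i\<in>UNIV. (y - x) $ i *\<^sub>R frechet_derivative f (at x) (axis i 1)))
      \<le> K * norm (y - x) ^ 2"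
proof -
  let ?D = "\<lambda>i x. frechet_derivative f (at x) (axis i 1)"
  have "\<forall>i. \<exists>L\<ge>0. \<forall>x\<in>cball c R. \<forall>y\<in>cball c R. norm (?D i x - ?D i y) \<le> L * norm (x - y)"
    by (intro allI smooth_on_lipschitz smooth_on_frechet_derivative f)
  from choice[OF this] obtain L where L0: "\<And>i. L i \<ge> 0"
    and L: "\<And>i x y. x \<in> cball c R \<Longrightarrow> y \<in> cball c R \<Longrightarrow> norm (?D i x - ?D i y) \<le> L i * norm (x - y)"
    by blast
  define K where "K = (\<Sum>i\<in>UNIV. L i)"
  have K0: "K \<ge> 0" unfolding K_def by (intro sum_nonneg L0)
  have "norm (f y - f x - (\<Sum>i\<in>UNIV. (y - x) $ i *\<^sub>R ?D i x)) \<le> K * norm (y - x) ^ 2"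
    if x: "x \<in> cball c R" and y: "y \<in> cball c R" for x y
  proof -
    define F where "F = (\<lambda>z. f z - frechet_derivative f (at x) z)"
    have bl: "bounded_linear (frechet_derivative f (at x))"
      using smooth_on_has_derivative[OF f, of x UNIV] has_derivative_bounded_linear by blast
    have "norm (F y - F x) \<le> K * norm (y - x) * norm (y - x)"
    proof (rule differentiable_bound[of "closed_segment x y" F
          "\<lambda>z v. frechet_derivative f (at z) v - frechet_derivative f (at x) v"])
      fix z assume z: "z \<in> closed_segment x y"
      have zc: "z \<in> cball c R" using z closed_segment_subset[OF x y convex_cball] by blast
      show "(F has_derivative (\<lambda>v. frechet_derivative f (at z) v - frechet_derivative f (at x) v))
          (at z within closed_segment x y)"
        unfolding F_def
        by (intro has_derivative_diff smooth_on_has_derivative f bounded_linear_imp_has_derivative bl)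
      show "onorm (\<lambda>v. frechet_derivative f (at z) v - frechet_derivative f (at x) v)
          \<le> K * norm (y - x)"
      proof (rule onorm_le)
        fix v
        have "frechet_derivative f (at z) v - frechet_derivative f (at x) v
            = (\<Sum>i\<in>UNIV. v $ i *\<^sub>R (?D i z - ?D i x))"
          by (simp add: frechet_derivative_eq_sum_axis[OF f, of _ v] sum_subtractf
              scaleR_right_diff_distrib)
        also have "norm \<dots> \<le> (\<Sum>i\<in>UNIV. norm v * (L i * norm (z - x)))"
          by (auto intro!: order_trans[OF norm_sum] sum_mono mult_mono L zc x component_le_norm_cart)
        also have "\<dots> = K * norm (z - x) * norm v"
          by (simp add: K_def sum_distrib_left sum_distrib_right mult_ac)
        also have "\<dots> \<le> K * norm (y - x) * norm v"
          using segment_bound1[OF z] by (intro mult_right_mono mult_left_mono K0) auto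
        finally show "norm (frechet_derivative f (at z) v - frechet_derivative f (at x) v)
            \<le> K * norm (y - x) * norm v" .
      qed
    qed auto
    moreover have "F y - F x = f y - f x - (\<Sum>i\<in>UNIV. (y - x) $ i *\<^sub>R ?D i x)"
      unfolding F_def
      unfolding frechet_derivative_eq_sum_axis[OF f, symmetric]
      by (simp add: linear_diff[OF bounded_linear.linear[OF bl]])
    ultimately show ?thesis by (simp add: power2_eq_square mult.assoc)
  qed
  then show ?thesis using K0 by blast
qed

section \<open>Families indexed by the stepsize\<close>

locale step_interval =
  fixes t0 h0 :: real
  assumes h0: "0 < h0" "h0 \<le> 1"
begin

text \<open>The bound is uniform in \<open>h\<close> but refers to the step alone, whose length
  shrinks with \<open>h\<close>.\<close>

definition bounded_family :: "(real \<Rightarrow> real \<Rightarrow> 'b::real_normed_vector) \<Rightarrow> bool" where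
  "bounded_family g \<longleftrightarrow> (\<exists>C\<ge>0. \<forall>h\<in>{0<..h0}. \<forall>t\<in>{t0..t0 + h}. norm (g h t) \<le> C)"

text \<open>Two-sided derivatives on the whole line, so that the endpoints of the step need no
  special care.\<close>

definition derivative_family ::
    "(real \<Rightarrow> real \<Rightarrow> 'b::real_normed_vector) \<Rightarrow> (real \<Rightarrow> real \<Rightarrow> 'b) \<Rightarrow> bool" where
  "derivative_family g g' \<longleftrightarrow> (\<forall>h\<in>{0<..h0}. \<forall>t. (g h has_vector_derivative g' h t) (at t))"

text \<open>The highest derivative is required to be bounded, not continuous: that is what the
  Taylor estimates consume.\<close>

primrec Ck_family :: "nat \<Rightarrow> (real \<Rightarrow> real \<Rightarrow> 'b::real_normed_vector) \<Rightarrow> bool" where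
  "Ck_family 0 g \<longleftrightarrow> bounded_family g"
| "Ck_family (Suc k) g \<longleftrightarrow> bounded_family g \<and> (\<exists>g'. derivative_family g g' \<and> Ck_family k g')"

lemma bounded_familyI:
  "(\<And>h t. h \<in> {0<..h0} \<Longrightarrow> t \<in> {t0..t0 + h} \<Longrightarrow> norm (g h t) \<le> C) \<Longrightarrow> bounded_family g"
  unfolding bounded_family_def
  by (intro exI[of _ "max C 0"]) (auto simp: le_max_iff_disj)

lemma bounded_familyE:
  assumes "bounded_family g"
  obtains C where "C \<ge> 0" "\<forall>h\<in>{0<..h0}. \<forall>t\<in>{t0..t0 + h}. norm (g h t) \<le> C"
  using assms unfolding bounded_family_def by blast

lemma derivative_familyD:
  "derivative_family g g' \<Longrightarrow> h \<in> {0<..h0} \<Longrightarrow> (g h has_vector_derivative g' h t) (at t within S)"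
  unfolding derivative_family_def using has_vector_derivative_at_within by blast

lemma derivative_family_continuous:
  "derivative_family g g' \<Longrightarrow> h \<in> {0<..h0} \<Longrightarrow> continuous_on S (g h)"
  unfolding continuous_on_eq_continuous_within
  by (auto intro!: has_vector_derivative_continuous derivative_familyD)

lemma Ck_family_bounded: "Ck_family k g \<Longrightarrow> bounded_family g"
  by (cases k) auto

lemma Ck_family_SucD: "Ck_family (Suc k) g \<Longrightarrow> Ck_family k g"
  by (induction k arbitrary: g) auto

lemma Ck_family_const:
  fixes c :: "real \<Rightarrow> 'a::real_normed_vector"
  assumes "\<And>h. h \<in> {0<..h0} \<Longrightarrow> norm (c h) \<le> C"
  shows "Ck_family k (\<lambda>h t. c h)"
  using assms
proof (induction k arbitrary: c C)
  case 0
  then show ?case unfolding Ck_family.simps by (rule bounded_familyI)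
next
  case (Suc k)
  have "Ck_family k (\<lambda>h t. 0 :: 'a)" using Suc.IH[of "\<lambda>_. 0" 0] by simp
  then show ?case using Suc.prems
    by (auto simp: derivative_family_def intro!: bounded_familyI[of _ C] exI[of _ "\<lambda>h t. 0"])
qed

lemma bounded_family_bilinear:
  assumes "bounded_bilinear B" "bounded_family f" "bounded_family g"
  shows "bounded_family (\<lambda>h t. B (f h t) (g h t))"
proof -
  obtain K where K: "K \<ge> 0" "\<And>a b. norm (B a b) \<le> norm a * norm b * K"
    using bounded_bilinear.nonneg_bounded[OF assms(1)] by blast
  obtain C1 where C1: "C1 \<ge> 0" "\<forall>h\<in>{0<..h0}. \<forall>t\<in>{t0..t0 + h}. norm (f h t) \<le> C1"
    by (rule bounded_familyE[OF assms(2)])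
  obtain C2 where C2: "C2 \<ge> 0" "\<forall>h\<in>{0<..h0}. \<forall>t\<in>{t0..t0 + h}. norm (g h t) \<le> C2"
    by (rule bounded_familyE[OF assms(3)])
  show ?thesis
  proof (rule bounded_familyI)
    fix h t assume h: "h \<in> {0<..h0}" "t \<in> {t0..t0 + h}"
    have "norm (B (f h t) (g h t)) \<le> norm (f h t) * norm (g h t) * K" by (rule K)
    also have "\<dots> \<le> C1 * C2 * K" using K C1 C2 h by (intro mult_right_mono mult_mono) auto
    finally show "norm (B (f h t) (g h t)) \<le> C1 * C2 * K" .
  qed
qed

lemma bounded_family_add:
  assumes "bounded_family f" "bounded_family g"
  shows "bounded_family (\<lambda>h t. f h t + g h t)"
proof -
  obtain C1 where C1: "C1 \<ge> 0" "\<forall>h\<in>{0<..h0}. \<forall>t\<in>{t0..t0 + h}. norm (f h t) \<le> C1"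
    by (rule bounded_familyE[OF assms(1)])
  obtain C2 where C2: "C2 \<ge> 0" "\<forall>h\<in>{0<..h0}. \<forall>t\<in>{t0..t0 + h}. norm (g h t) \<le> C2"
    by (rule bounded_familyE[OF assms(2)])
  show ?thesis by (rule bounded_familyI[of _ "C1 + C2"]) (intro norm_triangle_mono C1(2)[rule_format] C2(2)[rule_format])
qed

lemma Ck_family_add:
  "Ck_family k f \<Longrightarrow> Ck_family k g \<Longrightarrow> Ck_family k (\<lambda>h t. f h t + g h t)"
proof (induction k arbitrary: f g)
  case 0
  then show ?case by (simp add: bounded_family_add)
next
  case (Suc k)
  then obtain f' g' where "derivative_family f f'" "Ck_family k f'"
    "derivative_family g g'" "Ck_family k g'" by auto
  then show ?case using Suc
    by (auto simp: derivative_family_def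
        intro!: bounded_family_add has_vector_derivative_add exI[of _ "\<lambda>h t. f' h t + g' h t"])
qed

lemma Ck_family_sum:
  assumes "\<And>i. i \<in> I \<Longrightarrow> Ck_family k (g i)"
  shows "Ck_family k (\<lambda>h t. \<Sum>i\<in>I. g i h t)"
  using assms
  by (induction I rule: infinite_finite_induct)
    (auto intro: Ck_family_add Ck_family_const[of "\<lambda>_. 0" 0])

lemma Ck_family_bilinear:
  assumes "bounded_bilinear B"
  shows "Ck_family k f \<Longrightarrow> Ck_family k g \<Longrightarrow> Ck_family k (\<lambda>h t. B (f h t) (g h t))"
proof (induction k arbitrary: f g)
  case 0
  then show ?case by (simp add: bounded_family_bilinear[OF assms])
next
  case (Suc k)
  then obtain f' g' where f': "derivative_family f f'" "Ck_family k f'"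
    and g': "derivative_family g g'" "Ck_family k g'" by auto
  have "derivative_family (\<lambda>h t. B (f h t) (g h t)) (\<lambda>h t. B (f h t) (g' h t) + B (f' h t) (g h t))"
    unfolding derivative_family_def
    by (intro ballI allI bounded_bilinear.has_vector_derivative[OF assms]
        derivative_familyD[OF f'(1)] derivative_familyD[OF g'(1)])
  moreover have "Ck_family k (\<lambda>h t. B (f h t) (g' h t) + B (f' h t) (g h t))"
    using Suc.prems f' g' by (intro Ck_family_add Suc.IH) (auto dest: Ck_family_SucD simp del: Ck_family.simps(2))
  ultimately show ?case using Suc.prems
    by (auto intro!: bounded_family_bilinear[OF assms])
qed

lemma Ck_family_scaleR:
  "Ck_family k f \<Longrightarrow> Ck_family k g \<Longrightarrow> Ck_family k (\<lambda>h t. f h t *\<^sub>R g h t)"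
  by (rule Ck_family_bilinear[OF bounded_bilinear_scaleR])

lemma Ck_family_inner:
  "Ck_family k f \<Longrightarrow> Ck_family k g \<Longrightarrow> Ck_family k (\<lambda>h t. f h t \<bullet> g h t)"
  by (rule Ck_family_bilinear[OF bounded_bilinear_inner])

lemma Ck_family_uminus:
  assumes "Ck_family k g"
  shows "Ck_family k (\<lambda>h t. - g h t)"
  using Ck_family_scaleR[OF Ck_family_const[of "\<lambda>_. -1" 1] assms] by simp

lemma bounded_family_compose:
  fixes f :: "real ^ 'm::finite \<Rightarrow> 'b::real_normed_vector"
  assumes "smooth_on UNIV f" "bounded_family w"
  shows "bounded_family (\<lambda>h t. f (w h t))"
proof -
  obtain C where C: "C \<ge> 0" "\<forall>h\<in>{0<..h0}. \<forall>t\<in>{t0..t0 + h}. norm (w h t) \<le> C"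
    by (rule bounded_familyE[OF assms(2)])
  obtain K where K: "\<And>x. x \<in> cball 0 C \<Longrightarrow> norm (f x) \<le> K"
    using smooth_on_bounded[OF assms(1)] by blast
  have "norm (f (w h t)) \<le> K" if "h \<in> {0<..h0}" "t \<in> {t0..t0 + h}" for h t
    using C(2)[rule_format, OF that] by (intro K) simp
  then show ?thesis by (rule bounded_familyI)
qed

text \<open>The chain rule brings in compositions of \<open>w\<close> with the partial derivatives
  of \<open>f\<close>, which are smooth again; hence the induction generalises over
  \<open>f\<close>.\<close>

lemma Ck_family_compose:
  fixes f :: "real ^ 'm::finite \<Rightarrow> 'b::real_normed_vector"
  shows "smooth_on UNIV f \<Longrightarrow> Ck_family k w \<Longrightarrow> Ck_family k (\<lambda>h t. f (w h t))"
proof (induction k arbitrary: f)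
  case 0
  then show ?case by (simp add: bounded_family_compose)
next
  case (Suc k)
  let ?D = "\<lambda>i x. frechet_derivative f (at x) (axis i 1)"
  obtain w' where w': "derivative_family w w'" "Ck_family k w'" using Suc.prems by auto
  have wk: "Ck_family k w" using Suc.prems by (auto dest: Ck_family_SucD simp del: Ck_family.simps(2))
  have "derivative_family (\<lambda>h t. f (w h t)) (\<lambda>h t. \<Sum>i\<in>UNIV. w' h t $ i *\<^sub>R ?D i (w h t))"
    unfolding derivative_family_def
  proof (intro ballI allI)
    fix h t assume "h \<in> {0<..h0}"
    then have "(w h has_derivative (\<lambda>s. s *\<^sub>R w' h t)) (at t)"
      using derivative_familyD[OF w'(1)] by (simp add: has_vector_derivative_def)
    from diff_chain_at[OF this smooth_on_has_derivative[OF Suc.prems(1)]]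
    have "((\<lambda>t. f (w h t)) has_derivative (\<lambda>s. frechet_derivative f (at (w h t)) (s *\<^sub>R w' h t))) (at t)"
      by (simp add: o_def)
    moreover have "linear (frechet_derivative f (at (w h t)))"
      using smooth_on_has_derivative[OF Suc.prems(1), of _ UNIV] has_derivative_linear by auto
    ultimately show "((\<lambda>t. f (w h t)) has_vector_derivative
        (\<Sum>i\<in>UNIV. w' h t $ i *\<^sub>R ?D i (w h t))) (at t)"
      unfolding has_vector_derivative_def frechet_derivative_eq_sum_axis[OF Suc.prems(1), symmetric]
      by (simp add: linear_cmul)
  qed
  moreover have "Ck_family k (\<lambda>h t. \<Sum>i\<in>UNIV. w' h t $ i *\<^sub>R ?D i (w h t))"
  proof (intro Ck_family_sum Ck_family_scaleR)
    fix i
    have "Ck_family k (\<lambda>h t. w' h t \<bullet> axis i 1)"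
      by (intro Ck_family_inner w' Ck_family_const[of "\<lambda>_. axis i 1" 1]) simp
    then show "Ck_family k (\<lambda>h t. w' h t $ i)" by (simp add: inner_axis)
    show "Ck_family k (\<lambda>h t. ?D i (w h t))"
      by (intro Suc.IH smooth_on_frechet_derivative Suc.prems wk)
  qed
  ultimately show ?case
    using bounded_family_compose[OF Suc.prems(1) Ck_family_bounded[OF wk]] by auto
qed

text \<open>The anchor \<open>s h\<close> is left free because the numerical solution is known at
  the start of the step and the adjoint solution at its end. Steps have length at most 1, so a
  bounded derivative moves the anchored value by a bounded amount.\<close>

lemma Ck_family_antiderivative:
  assumes deriv: "derivative_family g g'" and g': "Ck_family k g'"
    and s: "\<And>h. h \<in> {0<..h0} \<Longrightarrow> s h \<in> {t0..t0 + h}"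
    and bound: "\<And>h. h \<in> {0<..h0} \<Longrightarrow> norm (g h (s h)) \<le> C"
  shows "Ck_family (Suc k) g"
proof -
  obtain C' where C': "C' \<ge> 0" "\<forall>h\<in>{0<..h0}. \<forall>t\<in>{t0..t0 + h}. norm (g' h t) \<le> C'"
    by (rule bounded_familyE[OF Ck_family_bounded[OF g']])
  have "bounded_family g"
  proof (rule bounded_familyI)
    fix h t assume ht: "h \<in> {0<..h0}" "t \<in> {t0..t0 + h}"
    have "norm (g h t - g h (s h)) \<le> C' * \<bar>t - s h\<bar>"
      by (rule vector_derivative_bound_interval[of t0 "t0 + h" "g h" "g' h"])
        (use C'(2) ht s derivative_familyD[OF deriv ht(1)] in auto)
    also have "\<dots> \<le> C' * 1"
      using C'(1) ht s[OF ht(1)] h0 by (intro mult_left_mono) auto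
    finally show "norm (g h t) \<le> C + C'"
      using bound[OF ht(1)] norm_triangle_sub[of "g h t" "g h (s h)"] by linarith
  qed
  then show ?thesis using deriv g' by auto
qed

text \<open>Unfolds the nested existentials into one sequence of derivatives, the form in which
  \<open>vanishing_jet_bound\<close> takes its input.\<close>

lemma Ck_family_sequence:
  "Ck_family k g \<Longrightarrow> \<exists>d. d 0 = g \<and> (\<forall>j<k. derivative_family (d j) (d (Suc j))) \<and>
     (\<forall>j\<le>k. bounded_family (d j))"
proof (induction k arbitrary: g)
  case 0
  then show ?case by (intro exI[of _ "\<lambda>_. g"]) auto
next
  case (Suc k)
  then obtain g' where g': "derivative_family g g'" "Ck_family k g'" "bounded_family g" by auto
  from Suc.IH[OF g'(2)] obtain d where d: "d 0 = g'"
    "\<forall>j<k. derivative_family (d j) (d (Suc j))" "\<forall>j\<le>k. bounded_family (d j)" by blast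
  show ?case
    by (rule exI[of _ "case_nat g d"]) (use d g' in \<open>auto split: nat.split\<close>)
qed

lemma Ck_family_of_sequence:
  "(\<And>j. j < k \<Longrightarrow> derivative_family (d j) (d (Suc j))) \<Longrightarrow> (\<And>j. j \<le> k \<Longrightarrow> bounded_family (d j)) \<Longrightarrow>
     Ck_family k (d 0)"
proof (induction k arbitrary: d)
  case 0
  then show ?case by simp
next
  case (Suc k)
  have "Ck_family k (d (Suc 0))" using Suc.prems by (intro Suc.IH[of "\<lambda>j. d (Suc j)"]) auto
  then show ?case using Suc.prems(1)[of 0] Suc.prems(2)[of 0] by auto
qed

end

section \<open>Convergence of the projected flow\<close>

locale jet_basis_step = jet_basis r \<psi> t0 + step_interval t0 h0
  for r :: nat and \<psi> :: "nat \<Rightarrow> nat \<Rightarrow> real \<Rightarrow> real" and t0 h0 :: real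
begin

text \<open>Taylor's theorem with the space in place of polynomials: as the jets of the basis are
  unit vectors, the derivatives of \<open>g h\<close> at \<open>t0\<close> serve as coefficients and
  the difference vanishes to order \<open>n\<close>. The jets are known below order
  \<open>r\<close>, hence \<open>n \<le> r\<close>.\<close>

lemma Ck_family_approximation:
  assumes g: "Ck_family n g" and n: "n \<le> r"
  shows "\<exists>\<gamma> C. C \<ge> 0 \<and> (\<forall>h\<in>{0<..h0}. \<forall>j<n. norm (\<gamma> h j) \<le> C) \<and>
    (\<forall>h\<in>{0<..h0}. \<forall>t\<in>{t0..t0 + h}. norm (g h t - (\<Sum>j<n. \<psi> j 0 t *\<^sub>R \<gamma> h j)) \<le> C * h ^ n)"
proof -
  obtain d where d0: "d 0 = g" and d: "\<forall>j<n. derivative_family (d j) (d (Suc j))"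
    and bd: "\<forall>j\<le>n. bounded_family (d j)"
    using Ck_family_sequence[OF g] by blast
  have "\<forall>j. \<exists>C. j \<le> n \<longrightarrow> C \<ge> 0 \<and> (\<forall>h\<in>{0<..h0}. \<forall>t\<in>{t0..t0 + h}. norm (d j h t) \<le> C)"
    using bd unfolding bounded_family_def by blast
  from choice[OF this] obtain m where m0: "\<forall>j\<le>n. m j \<ge> 0"
    and m: "\<forall>j\<le>n. \<forall>h\<in>{0<..h0}. \<forall>t\<in>{t0..t0 + h}. norm (d j h t) \<le> m j" by blast
  define M where "M = (\<Sum>j\<le>n. m j)"
  have M0: "0 \<le> M" unfolding M_def using m0 by (intro sum_nonneg) auto
  have M: "norm (d j h t) \<le> M" if "j \<le> n" "h \<in> {0<..h0}" "t \<in> {t0..t0 + h}" for j h t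
  proof -
    have "m j \<le> M" unfolding M_def using that m0 by (intro member_le_sum) auto
    then show ?thesis using m that by force
  qed
  obtain K where K: "K \<ge> 0" "\<forall>j<r. \<forall>t\<in>{t0..t0 + 1}. \<bar>\<psi> j n t\<bar> \<le> K"
    using \<psi>_bounded by blast
  \<comment> \<open>Bounds the \<open>n\<close>-th derivative of the difference; being at least
    \<open>M\<close>, it also bounds the coefficients.\<close>
  define C where "C = M + real n * (K * M)"
  have "M \<le> C" using K M0 by (simp add: C_def)
  have "norm (g h t - (\<Sum>j<n. \<psi> j 0 t *\<^sub>R d j h t0)) \<le> C * h ^ n"
    if h: "h \<in> {0<..h0}" and t: "t \<in> {t0..t0 + h}" for h t
  proof -
    define G where "G = (\<lambda>k t. d k h t - (\<Sum>j<n. \<psi> j k t *\<^sub>R d j h t0))"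
    have "norm (G 0 t) \<le> C * (t0 + h - t0) ^ n"
    proof (rule vanishing_jet_bound[of n t0 "t0 + h" G])
      fix k t assume k: "k < n" and t: "t \<in> {t0..t0 + h}"
      have "(\<psi> j k has_real_derivative \<psi> j (Suc k) t) (at t within {t0..t0 + h})" if "j < n" for j
        using \<psi>_deriv[of j k t] that n by (auto intro: has_field_derivative_at_within)
      then have "((\<lambda>t. \<Sum>j<n. \<psi> j k t *\<^sub>R d j h t0) has_vector_derivative
          (\<Sum>j<n. \<psi> j k t *\<^sub>R 0 + \<psi> j (Suc k) t *\<^sub>R d j h t0)) (at t within {t0..t0 + h})"
        by (intro has_vector_derivative_sum has_vector_derivative_scaleR has_vector_derivative_const) auto
      then show "(G k has_vector_derivative G (Suc k) t) (at t within {t0..t0 + h})"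
        unfolding G_def using d k h
        by (intro has_vector_derivative_diff derivative_familyD[of "d k"]) auto
    next
      fix k assume k: "k < n"
      have "(\<Sum>j<n. \<psi> j k t0 *\<^sub>R d j h t0) = (\<Sum>j<n. if j = k then d k h t0 else 0)"
        using k n by (intro sum.cong) (auto simp: \<psi>_jet)
      then show "G k t0 = 0" using k by (simp add: G_def)
    next
      fix t assume t: "t \<in> {t0..t0 + h}"
      have "norm (G n t) \<le> norm (d n h t) + norm (\<Sum>j<n. \<psi> j n t *\<^sub>R d j h t0)"
        unfolding G_def by (rule norm_triangle_ineq4)
      also have "norm (\<Sum>j<n. \<psi> j n t *\<^sub>R d j h t0) \<le> (\<Sum>j<n. K * M)"
        using t h h0 n by (intro sum_norm_le) (auto intro!: mult_mono M K(2)[rule_format] K(1))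
      finally show "norm (G n t) \<le> C" using M[OF _ h t, of n] by (simp add: C_def)
    qed (rule t)
    then show ?thesis by (simp add: G_def d0)
  qed
  moreover have "norm (d j h t0) \<le> C" if "h \<in> {0<..h0}" "j < n" for h j
    using M[of j h t0] that \<open>M \<le> C\<close> by auto
  moreover have "C \<ge> 0" using M0 \<open>M \<le> C\<close> by simp
  ultimately show ?thesis by (intro exI[of _ "\<lambda>h j. d j h t0"] exI[of _ C]) auto
qed

end

section \<open>Bootstrapping in unscaled time\<close>

text \<open>\<open>orth\<close> is the variational equation tested against the jet-dual basis.
  \<open>stable\<close> is the conclusion of \<open>projection_stability\<close>, taken as an
  assumption so that \<open>h0\<close> is fixed beforehand.\<close>

locale projected_flow = jet_basis_step r \<psi> t0 h0
  for r :: nat and \<psi> :: "nat \<Rightarrow> nat \<Rightarrow> real \<Rightarrow> real" and t0 h0 :: real +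
  fixes f :: "real ^ 'm::finite \<Rightarrow> real ^ 'm" and w :: "real \<Rightarrow> real \<Rightarrow> real ^ 'm"
    and a :: "real \<Rightarrow> nat \<Rightarrow> real ^ 'm" and y0 :: "real ^ 'm" and K0 :: real
  assumes f: "smooth_on UNIV f"
    and w_deriv: "derivative_family w (\<lambda>h t. \<Sum>j<r. \<psi> j 0 t *\<^sub>R a h j)"
    and w_init: "\<And>h. h \<in> {0<..h0} \<Longrightarrow> w h t0 = y0"
    and w_bounded: "bounded_family w"
    and orth: "\<And>h j. h \<in> {0<..h0} \<Longrightarrow> j < r \<Longrightarrow>
      integral {0..1} (\<lambda>x. \<psi> j 0 (t0 + x * h) *\<^sub>R
        ((\<Sum>l<r. \<psi> l 0 (t0 + x * h) *\<^sub>R a h l) - f (w h (t0 + x * h)))) = 0"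
    and K0: "K0 \<ge> 0"
    and stable: "\<And>h (b :: nat \<Rightarrow> real ^ 'm) \<eta> \<epsilon>. h \<in> {0<..h0} \<Longrightarrow> continuous_on {0..1} \<eta> \<Longrightarrow>
      (\<And>x. x \<in> {0..1} \<Longrightarrow> norm (\<eta> x) \<le> \<epsilon>) \<Longrightarrow>
      (\<And>j. j < r \<Longrightarrow> integral {0..1} (\<lambda>x. \<psi> j 0 (t0 + x * h) *\<^sub>R
        ((\<Sum>l<r. \<psi> l 0 (t0 + x * h) *\<^sub>R b l) - \<eta> x)) = 0) \<Longrightarrow>
      (\<Sum>j<r. norm (b j) * h ^ j) \<le> K0 * \<epsilon>"
begin

definition v :: "real \<Rightarrow> real \<Rightarrow> real ^ 'm" where
  "v h t = (\<Sum>j<r. \<psi> j 0 t *\<^sub>R a h j)"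

definition \<delta> :: "real \<Rightarrow> real \<Rightarrow> real ^ 'm" where
  "\<delta> h t = v h t - f (w h t)"

lemma w_has_derivative: "derivative_family w v"
proof -
  have "v = (\<lambda>h t. \<Sum>j<r. \<psi> j 0 t *\<^sub>R a h j)" by (intro ext) (simp add: v_def)
  then show ?thesis using w_deriv by simp
qed

lemma scaled_mem: "h \<in> {0<..h0} \<Longrightarrow> x \<in> {0..1} \<Longrightarrow> t0 + x * h \<in> {t0..t0 + h}"
  by (auto simp: mult_le_cancel_right1)

lemma w_continuous: "h \<in> {0<..h0} \<Longrightarrow> continuous_on S (w h)"
  by (rule derivative_family_continuous[OF w_has_derivative])

lemma w_continuous_comp:
  "h \<in> {0<..h0} \<Longrightarrow> continuous_on S g \<Longrightarrow> continuous_on S (\<lambda>x. w h (g x))"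
  by (rule continuous_on_compose2[OF w_continuous[of h UNIV]]) auto

lemma smooth_w_continuous_comp:
  assumes "smooth_on UNIV F" "h \<in> {0<..h0}" "continuous_on S g"
  shows "continuous_on S (\<lambda>x. F (w h (g x)))"
  by (rule continuous_on_compose2[OF smooth_on_continuous[OF assms(1), of UNIV]
        w_continuous_comp[OF assms(2,3)]]) auto

lemma v_continuous_comp: "continuous_on S g \<Longrightarrow> continuous_on S (\<lambda>x. v h (g x))"
  unfolding v_def by (intro continuous_intros \<psi>_continuous_comp) auto

lemma \<delta>_continuous_comp:
  "h \<in> {0<..h0} \<Longrightarrow> continuous_on S g \<Longrightarrow> continuous_on S (\<lambda>x. \<delta> h (g x))"
  unfolding \<delta>_def by (intro continuous_on_diff v_continuous_comp smooth_w_continuous_comp[OF f])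

lemma \<delta>_orthogonal:
  assumes "h \<in> {0<..h0}" "j < r"
  shows "((\<lambda>x. \<psi> j 0 (t0 + x * h) *\<^sub>R \<delta> h (t0 + x * h)) has_integral 0) {0..1}"
proof -
  have "(\<lambda>x. \<psi> j 0 (t0 + x * h) *\<^sub>R \<delta> h (t0 + x * h)) integrable_on {0..1}"
    using assms
    by (intro integrable_continuous_interval continuous_on_scaleR \<psi>_continuous_comp
        \<delta>_continuous_comp continuous_intros)
  then show ?thesis using orth[OF assms] unfolding \<delta>_def v_def
    by (simp add: has_integral_integrable_integral)
qed

text \<open>The approximant of \<open>f (w h t)\<close> lies in the space, so subtracting it from
  both \<open>v\<close> and the composition leaves the defect, and hence its orthogonality,
  unchanged. Stability then bounds the difference of coefficients by the approximation
  error.\<close>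

lemma coefficients_close:
  assumes g: "Ck_family k (\<lambda>h t. f (w h t))" and k: "k \<le> r"
  shows "\<exists>\<gamma> C. C \<ge> 0 \<and> (\<forall>h\<in>{0<..h0}. \<forall>j<k. norm (\<gamma> h j) \<le> C) \<and>
    (\<forall>h\<in>{0<..h0}. \<forall>t\<in>{t0..t0 + h}. norm (f (w h t) - (\<Sum>j<k. \<psi> j 0 t *\<^sub>R \<gamma> h j)) \<le> C * h ^ k) \<and>
    (\<forall>h\<in>{0<..h0}. (\<Sum>j<r. norm (a h j - (if j < k then \<gamma> h j else 0)) * h ^ j) \<le> C * h ^ k)"
proof -
  obtain \<gamma> C where C: "C \<ge> 0" and \<gamma>: "\<forall>h\<in>{0<..h0}. \<forall>j<k. norm (\<gamma> h j) \<le> C"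
    and approx: "\<forall>h\<in>{0<..h0}. \<forall>t\<in>{t0..t0 + h}.
      norm (f (w h t) - (\<Sum>j<k. \<psi> j 0 t *\<^sub>R \<gamma> h j)) \<le> C * h ^ k"
    using Ck_family_approximation[OF g k] by blast
  have diff: "(\<Sum>j<r. norm (a h j - (if j < k then \<gamma> h j else 0)) * h ^ j) \<le> K0 * (C * h ^ k)"
    if h: "h \<in> {0<..h0}" for h
  proof -
    define \<eta> where "\<eta> = (\<lambda>x. f (w h (t0 + x * h)) - (\<Sum>j<k. \<psi> j 0 (t0 + x * h) *\<^sub>R \<gamma> h j))"
    show ?thesis
    proof (rule stable[OF h, of \<eta>])
      show "continuous_on {0..1} \<eta>"
        unfolding \<eta>_def using k
        by (intro continuous_on_diff smooth_w_continuous_comp[OF f h] continuous_on_sum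
            continuous_on_scaleR \<psi>_continuous_comp continuous_intros) auto
      show "norm (\<eta> x) \<le> C * h ^ k" if "x \<in> {0..1}" for x
        using approx h scaled_mem[OF h that] unfolding \<eta>_def by blast
      fix j assume j: "j < r"
      have eq: "(\<Sum>l<r. \<psi> l 0 s *\<^sub>R (a h l - (if l < k then \<gamma> h l else 0)))
          = v h s - (\<Sum>l<k. \<psi> l 0 s *\<^sub>R \<gamma> h l)" for s
      proof -
        have "(\<Sum>l<r. \<psi> l 0 s *\<^sub>R (if l < k then \<gamma> h l else 0)) = (\<Sum>l<k. \<psi> l 0 s *\<^sub>R \<gamma> h l)"
          using k by (intro sum.mono_neutral_cong_right) auto
        then show ?thesis by (simp add: v_def scaleR_right_diff_distrib sum_subtractf)
      qed
      have "(\<Sum>l<r. \<psi> l 0 (t0 + x * h) *\<^sub>R (a h l - (if l < k then \<gamma> h l else 0))) - \<eta> x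
          = \<delta> h (t0 + x * h)" for x
        unfolding eq \<eta>_def \<delta>_def by simp
      then show "integral {0..1} (\<lambda>x. \<psi> j 0 (t0 + x * h) *\<^sub>R
          ((\<Sum>l<r. \<psi> l 0 (t0 + x * h) *\<^sub>R (a h l - (if l < k then \<gamma> h l else 0))) - \<eta> x)) = 0"
        using integral_unique[OF \<delta>_orthogonal[OF h j]] by simp
    qed
  qed
  define C' where "C' = max C (K0 * C)"
  have "C * h ^ k \<le> C' * h ^ k" "K0 * (C * h ^ k) \<le> C' * h ^ k" if "h \<in> {0<..h0}" for h
    using that unfolding C'_def mult.assoc[symmetric] by (intro mult_right_mono; simp)+
  moreover have "C \<le> C'" "C' \<ge> 0" using C by (auto simp: C'_def)
  ultimately show ?thesis using \<gamma> approx diff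
    by (intro exI[of _ \<gamma>] exI[of _ C'] conjI ballI allI impI)
      (blast intro: order_trans)+
qed

text \<open>Here \<open>a h j\<close> is the \<open>j\<close>-th derivative of \<open>v h\<close> at \<open>t0\<close>, and decay of order \<open>k \<ge> r\<close> says
  that all of them are bounded.\<close>

definition coefficient_decay :: "nat \<Rightarrow> bool" where
  "coefficient_decay k \<longleftrightarrow>
     (\<exists>C\<ge>0. \<forall>h\<in>{0<..h0}. \<forall>j<r. norm (a h j) * h ^ j \<le> C * h ^ min j k)"

text \<open>Below \<open>k\<close> a coefficient is the bounded \<open>\<gamma> h j\<close> plus a
  difference, from \<open>k\<close> on it is the difference alone. Weighted by \<open>h ^ j\<close>,
  the difference is of order \<open>h ^ k\<close>.\<close>

lemma coefficient_decayI:
  assumes g: "Ck_family k (\<lambda>h t. f (w h t))" and k: "k \<le> r"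
  shows "coefficient_decay k"
proof -
  obtain \<gamma> C where C: "C \<ge> 0" and \<gamma>: "\<forall>h\<in>{0<..h0}. \<forall>j<k. norm (\<gamma> h j) \<le> C"
    and diff: "\<forall>h\<in>{0<..h0}. (\<Sum>j<r. norm (a h j - (if j < k then \<gamma> h j else 0)) * h ^ j) \<le> C * h ^ k"
    using coefficients_close[OF assms] by blast
  have "norm (a h j) * h ^ j \<le> (C + C) * h ^ min j k" if h: "h \<in> {0<..h0}" and j: "j < r" for h j
  proof -
    have h': "0 < h" "h \<le> 1" using h h0 by auto
    define b where "b = (\<lambda>j. a h j - (if j < k then \<gamma> h j else 0))"
    have "norm (b j) * h ^ j \<le> (\<Sum>j<r. norm (b j) * h ^ j)"
      using j h' by (intro member_le_sum) auto
    also have "\<dots> \<le> C * h ^ k" using diff h by (simp add: b_def)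
    also have "\<dots> \<le> C * h ^ min j k" using h' C by (intro mult_left_mono power_decreasing) auto
    finally have b: "norm (b j) * h ^ j \<le> C * h ^ min j k" .
    have "norm (a h j - b j) * h ^ j \<le> C * h ^ min j k"
    proof (cases "j < k")
      case True
      then show ?thesis using \<gamma> h h' by (auto simp: b_def min_def intro!: mult_right_mono)
    next
      case False
      then show ?thesis using C h' by (simp add: b_def)
    qed
    moreover have "norm (a h j) * h ^ j \<le> (norm (b j) + norm (a h j - b j)) * h ^ j"
      using norm_triangle_sub[of "a h j" "b j"] h' by (intro mult_right_mono) auto
    ultimately show ?thesis using b by (simp add: algebra_simps)
  qed
  then show ?thesis using C unfolding coefficient_decay_def by (intro exI[of _ "C + C"]) auto
qed

text \<open>For \<open>j > k\<close> the decay still allows \<open>a h j\<close> to grow like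
  \<open>h ^ k / h ^ j\<close>, but the \<open>i\<close>-th derivative of \<open>\<psi> j 0\<close>
  shrinks like \<open>h ^ (j - i)\<close>, which compensates as long as
  \<open>i \<le> k\<close>.\<close>

lemma Ck_family_v:
  assumes "coefficient_decay k"
  shows "Ck_family k v"
proof -
  obtain C where C: "C \<ge> 0" "\<forall>h\<in>{0<..h0}. \<forall>j<r. norm (a h j) * h ^ j \<le> C * h ^ min j k"
    using assms unfolding coefficient_decay_def by blast
  define d where "d = (\<lambda>i h t. \<Sum>j<r. \<psi> j i t *\<^sub>R a h j)"
  have "Ck_family k (d 0)"
  proof (rule Ck_family_of_sequence)
    fix i
    have "((\<lambda>t. \<Sum>j<r. \<psi> j i t *\<^sub>R a h j) has_vector_derivative
        (\<Sum>j<r. \<psi> j i t *\<^sub>R 0 + \<psi> j (Suc i) t *\<^sub>R a h j)) (at t)" for h t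
      by (intro has_vector_derivative_sum has_vector_derivative_scaleR has_vector_derivative_const
          \<psi>_deriv) simp
    then show "derivative_family (d i) (d (Suc i))"
      by (simp add: derivative_family_def d_def)
  next
    fix i assume i: "i \<le> k"
    obtain K where K: "K \<ge> 0"
      "\<forall>j<r. \<forall>h\<in>{0<..1}. \<forall>t\<in>{t0..t0 + h}. \<bar>\<psi> j i t\<bar> \<le> K * h ^ (j - i)"
      using \<psi>_small by blast
    show "bounded_family (d i)"
    proof (rule bounded_familyI)
      fix h t assume h: "h \<in> {0<..h0}" and t: "t \<in> {t0..t0 + h}"
      have h': "0 < h" "h \<le> 1" using h h0 by auto
      have "norm (d i h t) \<le> (\<Sum>j<r. K * C)"
        unfolding d_def
      proof (rule sum_norm_le)
        fix j assume "j \<in> {..<r}"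
        then have j: "j < r" by simp
        \<comment> \<open>Truncated subtraction: \<open>(j - i) + min i j = j\<close> holds also
          when \<open>j < i\<close>.\<close>
        have "h ^ (j - i) * norm (a h j) * h ^ min i j = norm (a h j) * h ^ j"
          by (simp add: min_def power_add[symmetric] mult.commute mult.left_commute)
        also have "\<dots> \<le> C * h ^ min j k" using C h j by blast
        also have "\<dots> \<le> C * h ^ min i j"
          using C h' i by (intro mult_left_mono power_decreasing) auto
        finally have "h ^ (j - i) * norm (a h j) \<le> C" using h' by simp
        then have "K * (h ^ (j - i) * norm (a h j)) \<le> K * C" using K(1) by (rule mult_left_mono)
        moreover have "\<bar>\<psi> j i t\<bar> * norm (a h j) \<le> K * h ^ (j - i) * norm (a h j)"
          using K(2) j h' t by (intro mult_right_mono) auto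
        ultimately show "norm (\<psi> j i t *\<^sub>R a h j) \<le> K * C" by (simp add: mult.assoc)
      qed
      then show "norm (d i h t) \<le> real r * (K * C)" by simp
    qed
  qed
  moreover have "d 0 = v" by (intro ext) (simp add: d_def v_def)
  ultimately show ?thesis by simp
qed

lemma Ck_family_w: "Ck_family k v \<Longrightarrow> Ck_family (Suc k) w"
  by (rule Ck_family_antiderivative[OF w_has_derivative, of k "\<lambda>_. t0" "norm y0"])
    (auto simp: w_init)

text \<open>One turn of the loop: \<open>k\<close> bounded derivatives of the composition give decay
  of order \<open>k\<close>, hence \<open>k\<close> derivatives of \<open>v\<close> and, by
  integration, \<open>k + 1\<close> of \<open>w\<close>. The limit \<open>k \<le> r\<close> is that
  of approximation in the space.\<close>

lemma Ck_family_f_w: "k \<le> r \<Longrightarrow> Ck_family k (\<lambda>h t. f (w h t))"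
proof (induction k)
  case 0
  then show ?case using bounded_family_compose[OF f w_bounded] by simp
next
  case (Suc k)
  then have "coefficient_decay k" by (intro coefficient_decayI) auto
  then show ?case by (rule Ck_family_compose[OF f Ck_family_w[OF Ck_family_v]])
qed

text \<open>Decay of order \<open>r\<close> bounds every \<open>a h j\<close>, which implies decay
  of any order. Regularity beyond \<open>r\<close> then comes from the basis functions, whose
  derivatives of all orders are bounded on the step.\<close>

lemma coefficient_decay_all: "coefficient_decay k"
proof -
  obtain C where C: "C \<ge> 0" "\<forall>h\<in>{0<..h0}. \<forall>j<r. norm (a h j) * h ^ j \<le> C * h ^ min j r"
    using coefficient_decayI[OF Ck_family_f_w] unfolding coefficient_decay_def by blast
  have "norm (a h j) * h ^ j \<le> C * h ^ min j k" if "h \<in> {0<..h0}" "j < r" for h j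
  proof -
    have "norm (a h j) * h ^ j \<le> C * h ^ min j r" using C that by blast
    also have "\<dots> \<le> C * h ^ min j k"
      using C(1) that h0 by (intro mult_left_mono power_decreasing) auto
    finally show ?thesis .
  qed
  then show ?thesis using C(1) unfolding coefficient_decay_def by blast
qed

lemma Ck_family_w_all: "Ck_family k w"
  using Ck_family_w[OF Ck_family_v[OF coefficient_decay_all]] by (rule Ck_family_SucD)

text \<open>\<open>v\<close> and the composition are both within order \<open>h ^ r\<close> of the
  same element of the space: the latter by approximation, the former because its coefficient
  differences are that small after weighting by \<open>h ^ j\<close>, the size of
  \<open>\<psi> j 0\<close>.\<close>

lemma \<delta>_bound: "\<exists>C\<ge>0. \<forall>h\<in>{0<..h0}. \<forall>t\<in>{t0..t0 + h}. norm (\<delta> h t) \<le> C * h ^ r"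
proof -
  obtain \<gamma> C where C: "C \<ge> 0"
    and approx: "\<forall>h\<in>{0<..h0}. \<forall>t\<in>{t0..t0 + h}.
      norm (f (w h t) - (\<Sum>j<r. \<psi> j 0 t *\<^sub>R \<gamma> h j)) \<le> C * h ^ r"
    and diff: "\<forall>h\<in>{0<..h0}. (\<Sum>j<r. norm (a h j - (if j < r then \<gamma> h j else 0)) * h ^ j) \<le> C * h ^ r"
    using coefficients_close[OF Ck_family_f_w] by blast
  obtain K where K: "K \<ge> 0"
    "\<forall>j<r. \<forall>h\<in>{0<..1}. \<forall>t\<in>{t0..t0 + h}. \<bar>\<psi> j 0 t\<bar> \<le> K * h ^ (j - 0)"
    using \<psi>_small by blast
  have "norm (\<delta> h t) \<le> (K * C + C) * h ^ r" if h: "h \<in> {0<..h0}" and t: "t \<in> {t0..t0 + h}" for h t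
  proof -
    have "norm (\<Sum>j<r. \<psi> j 0 t *\<^sub>R (a h j - \<gamma> h j)) \<le> (\<Sum>j<r. K * (norm (a h j - \<gamma> h j) * h ^ j))"
    proof (rule sum_norm_le)
      fix j assume "j \<in> {..<r}"
      then have "\<bar>\<psi> j 0 t\<bar> \<le> K * h ^ j" using K(2) h h0 t by auto
      then have "\<bar>\<psi> j 0 t\<bar> * norm (a h j - \<gamma> h j) \<le> K * h ^ j * norm (a h j - \<gamma> h j)"
        by (rule mult_right_mono) simp
      then show "norm (\<psi> j 0 t *\<^sub>R (a h j - \<gamma> h j)) \<le> K * (norm (a h j - \<gamma> h j) * h ^ j)"
        by (simp add: mult_ac)
    qed
    also have "\<dots> \<le> K * (C * h ^ r)"
      unfolding sum_distrib_left[symmetric] using diff h K(1) by (intro mult_left_mono) auto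
    finally have 1: "norm (\<Sum>j<r. \<psi> j 0 t *\<^sub>R (a h j - \<gamma> h j)) \<le> K * C * h ^ r" by simp
    have eq: "\<delta> h t = (\<Sum>j<r. \<psi> j 0 t *\<^sub>R (a h j - \<gamma> h j)) - (f (w h t) - (\<Sum>j<r. \<psi> j 0 t *\<^sub>R \<gamma> h j))"
      by (simp add: \<delta>_def v_def scaleR_right_diff_distrib sum_subtractf)
    have "norm (f (w h t) - (\<Sum>j<r. \<psi> j 0 t *\<^sub>R \<gamma> h j)) \<le> C * h ^ r"
      using approx h t by blast
    then have "norm (\<delta> h t) \<le> K * C * h ^ r + C * h ^ r"
      unfolding eq using 1 norm_triangle_ineq4[of "\<Sum>j<r. \<psi> j 0 t *\<^sub>R (a h j - \<gamma> h j)"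
          "f (w h t) - (\<Sum>j<r. \<psi> j 0 t *\<^sub>R \<gamma> h j)"] by linarith
    then show ?thesis by (simp add: algebra_simps)
  qed
  then show ?thesis using K C by (intro exI[of _ "K * C + C"]) auto
qed

section \<open>The adjoint equation along the numerical solution\<close>

text \<open>The transposed Jacobian of \<open>f\<close> at \<open>w h t\<close> applied to
  \<open>z h t\<close>; the adjoint equation says that the derivative of \<open>z\<close> is the
  negative of this.\<close>

definition adjoint_field :: "(real \<Rightarrow> real \<Rightarrow> real ^ 'm) \<Rightarrow> real \<Rightarrow> real \<Rightarrow> real ^ 'm" where
  "adjoint_field z h t =
     (\<Sum>j\<in>UNIV. (z h t \<bullet> frechet_derivative f (at (w h t)) (axis j 1)) *\<^sub>R axis j 1)"

lemma adjoint_field_inner: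
  "adjoint_field z h t \<bullet> e =
     z h t \<bullet> (\<Sum>j\<in>UNIV. e $ j *\<^sub>R frechet_derivative f (at (w h t)) (axis j 1))"
  unfolding adjoint_field_def inner_sum_left inner_sum_right
  by (intro sum.cong) (auto simp: inner_axis' mult.commute)

lemma adjoint_field_diff:
  "adjoint_field (\<lambda>h t. z h t - z' h t) h t = adjoint_field z h t - adjoint_field z' h t"
  unfolding adjoint_field_def
  by (simp add: inner_diff_left scaleR_left_diff_distrib sum_subtractf)

lemma Ck_family_adjoint_field:
  assumes "Ck_family k z"
  shows "Ck_family k (adjoint_field z)"
proof -
  have "Ck_family k (\<lambda>h t. \<Sum>j\<in>UNIV. (z h t \<bullet> frechet_derivative f (at (w h t)) (axis j 1)) *\<^sub>R
      (axis j 1 :: real ^ 'm))"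
    by (intro Ck_family_sum Ck_family_scaleR Ck_family_inner assms Ck_family_w_all
        Ck_family_compose[OF smooth_on_frechet_derivative[OF f]]
        Ck_family_const[of "\<lambda>_. axis _ 1" 1]) simp
  moreover have "adjoint_field z = (\<lambda>h t. \<Sum>j\<in>UNIV.
      (z h t \<bullet> frechet_derivative f (at (w h t)) (axis j 1)) *\<^sub>R axis j 1)"
    by (intro ext) (simp add: adjoint_field_def)
  ultimately show ?thesis by simp
qed

lemma adjoint_field_continuous:
  assumes "h \<in> {0<..h0}" "continuous_on S (z h)"
  shows "continuous_on S (adjoint_field z h)"
proof -
  have "continuous_on S (\<lambda>t. \<Sum>j\<in>UNIV.
      (z h t \<bullet> frechet_derivative f (at (w h t)) (axis j 1)) *\<^sub>R (axis j 1 :: real ^ 'm))"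
    by (intro continuous_on_sum continuous_on_scaleR continuous_on_inner continuous_on_const assms
        smooth_w_continuous_comp[OF smooth_on_frechet_derivative[OF f]] continuous_on_id)
  moreover have "adjoint_field z h = (\<lambda>t. \<Sum>j\<in>UNIV.
      (z h t \<bullet> frechet_derivative f (at (w h t)) (axis j 1)) *\<^sub>R axis j 1)"
    by (intro ext) (simp add: adjoint_field_def)
  ultimately show ?thesis by simp
qed

lemma adjoint_field_bound:
  "\<exists>K\<ge>0. \<forall>z. \<forall>h\<in>{0<..h0}. \<forall>t\<in>{t0..t0 + h}. norm (adjoint_field z h t) \<le> K * norm (z h t)"
proof -
  have "\<forall>j. \<exists>C\<ge>0. \<forall>h\<in>{0<..h0}. \<forall>t\<in>{t0..t0 + h}.
      norm (frechet_derivative f (at (w h t)) (axis j 1)) \<le> C"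
    using bounded_family_compose[OF smooth_on_frechet_derivative[OF f] w_bounded]
    unfolding bounded_family_def by blast
  from choice[OF this] obtain C where C0: "\<forall>j. C j \<ge> 0"
    and C: "\<forall>j. \<forall>h\<in>{0<..h0}. \<forall>t\<in>{t0..t0 + h}.
      norm (frechet_derivative f (at (w h t)) (axis j 1)) \<le> C j" by blast
  have "norm (adjoint_field z h t) \<le> (\<Sum>j\<in>UNIV. C j) * norm (z h t)"
    if "h \<in> {0<..h0}" "t \<in> {t0..t0 + h}" for z h t
  proof -
    have "norm (adjoint_field z h t) \<le> (\<Sum>j\<in>UNIV. norm (z h t) * C j)"
      unfolding adjoint_field_def
    proof (rule sum_norm_le)
      fix j
      have "\<bar>z h t \<bullet> frechet_derivative f (at (w h t)) (axis j 1)\<bar> \<le> norm (z h t) * C j"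
        using C that by (intro order_trans[OF Cauchy_Schwarz_ineq2] mult_left_mono) auto
      then show "norm ((z h t \<bullet> frechet_derivative f (at (w h t)) (axis j 1)) *\<^sub>R
          (axis j 1 :: real ^ 'm)) \<le> norm (z h t) * C j" by simp
    qed
    then show ?thesis by (simp add: sum_distrib_right mult.commute)
  qed
  then show ?thesis using C0 by (intro exI[of _ "\<Sum>j\<in>UNIV. C j"]) (auto intro: sum_nonneg)
qed

text \<open>Picard iterates for the adjoint equation, solved backwards from the end of the step; each
  iteration gains one power of \<open>h\<close>, so no exact solution is needed.\<close>

lemma approximate_adjoint_solution:
  "\<exists>z z' C. (\<forall>k. Ck_family k z) \<and> derivative_family z z' \<and> (\<forall>h\<in>{0<..h0}. z h (t0 + h) = \<xi>) \<and>
     C \<ge> 0 \<and> (\<forall>h\<in>{0<..h0}. \<forall>t\<in>{t0..t0 + h}. norm (z' h t + adjoint_field z h t) \<le> C * h ^ n)"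
proof (induction n)
  case 0
  have z: "Ck_family k (\<lambda>h t. \<xi>)" for k by (rule Ck_family_const[of "\<lambda>_. \<xi>" "norm \<xi>"]) simp
  from Ck_family_adjoint_field[OF z[of 0]]
  obtain C where "C \<ge> 0" "\<forall>h\<in>{0<..h0}. \<forall>t\<in>{t0..t0 + h}. norm (adjoint_field (\<lambda>h t. \<xi>) h t) \<le> C"
    unfolding Ck_family.simps bounded_family_def by blast
  then show ?case using z
    by (intro exI[of _ "\<lambda>h t. \<xi>"] exI[of _ "\<lambda>h t. 0"] exI[of _ C]) (auto simp: derivative_family_def)
next
  case (Suc n)
  then obtain z z' C where z: "\<forall>k. Ck_family k z" and z': "derivative_family z z'"
    and end_z: "\<forall>h\<in>{0<..h0}. z h (t0 + h) = \<xi>" and C: "C \<ge> 0"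
    and res: "\<forall>h\<in>{0<..h0}. \<forall>t\<in>{t0..t0 + h}. norm (z' h t + adjoint_field z h t) \<le> C * h ^ n"
    by (elim exE conjE) (rule that; assumption)
  have "\<exists>F. \<forall>t. (F has_vector_derivative - adjoint_field z h t) (at t)" if h: "h \<in> {0<..h0}" for h
  proof -
    have "continuous_on UNIV (\<lambda>t. - adjoint_field z h t)"
      using h by (intro continuous_on_minus adjoint_field_continuous derivative_family_continuous[OF z'])
    then have "isCont (\<lambda>t. - adjoint_field z h t) t" for t
      by (simp add: continuous_on_eq_continuous_at)
    then show ?thesis
      using einterval_antiderivative[of "-\<infinity>" "\<infinity>" "\<lambda>t. - adjoint_field z h t"] by auto
  qed
  then have "\<forall>h. \<exists>F. h \<in> {0<..h0} \<longrightarrow> (\<forall>t. (F has_vector_derivative - adjoint_field z h t) (at t))"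
    by blast
  from choice[OF this] obtain F where
    F: "\<forall>h\<in>{0<..h0}. \<forall>t. (F h has_vector_derivative - adjoint_field z h t) (at t)" by blast
  \<comment> \<open>Normalised at the end of the step, where the error is to be paired with
    \<open>\<xi>\<close>.\<close>
  define Z where "Z = (\<lambda>h t. \<xi> + (F h t - F h (t0 + h)))"
  have Z': "derivative_family Z (\<lambda>h t. - adjoint_field z h t)"
    unfolding derivative_family_def Z_def
  proof (intro ballI allI)
    fix h t assume "h \<in> {0<..h0}"
    then have "((\<lambda>t. \<xi> + (F h t - F h (t0 + h))) has_vector_derivative
        0 + (- adjoint_field z h t - 0)) (at t)"
      using F by (intro has_vector_derivative_add has_vector_derivative_diff
          has_vector_derivative_const) auto
    then show "((\<lambda>t. \<xi> + (F h t - F h (t0 + h))) has_vector_derivative - adjoint_field z h t) (at t)"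
      by simp
  qed
  have end_Z: "Z h (t0 + h) = \<xi>" for h by (simp add: Z_def)
  have "Ck_family (Suc k) Z" for k
    using z h0 end_Z
    by (intro Ck_family_antiderivative[OF Z', of k "\<lambda>h. t0 + h" "norm \<xi>"] Ck_family_uminus
        Ck_family_adjoint_field) auto
  then have Z: "Ck_family k Z" for k by (rule Ck_family_SucD)
  obtain K where K: "K \<ge> 0"
    "\<forall>z. \<forall>h\<in>{0<..h0}. \<forall>t\<in>{t0..t0 + h}. norm (adjoint_field z h t) \<le> K * norm (z h t)"
    using adjoint_field_bound by blast
  have "norm (- adjoint_field z h t + adjoint_field Z h t) \<le> K * C * h ^ Suc n"
    if h: "h \<in> {0<..h0}" and t: "t \<in> {t0..t0 + h}" for h t
  proof -
    \<comment> \<open>The derivative of \<open>Z h - z h\<close> is minus the residual of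
      \<open>z\<close>, and the two agree at the end of the step, so integration gains a factor
      \<open>h\<close>. The residual of \<open>Z\<close> is the adjoint field of this
      difference.\<close>
    have "norm ((Z h t - z h t) - (Z h (t0 + h) - z h (t0 + h))) \<le> C * h ^ n * \<bar>t - (t0 + h)\<bar>"
    proof (rule vector_derivative_bound_interval[of t0 "t0 + h" "\<lambda>t. Z h t - z h t"
          "\<lambda>t. - adjoint_field z h t - z' h t"])
      fix s assume s: "s \<in> {t0..t0 + h}"
      show "((\<lambda>t. Z h t - z h t) has_vector_derivative - adjoint_field z h s - z' h s)
          (at s within {t0..t0 + h})"
        by (intro has_vector_derivative_diff derivative_familyD[OF Z' h] derivative_familyD[OF z' h])
      have "norm (- adjoint_field z h s - z' h s) = norm (z' h s + adjoint_field z h s)"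
        by (metis add.commute minus_add_distrib norm_minus_cancel diff_conv_add_uminus)
      then show "norm (- adjoint_field z h s - z' h s) \<le> C * h ^ n" using res h s by simp
    qed (use h t in auto)
    also have "\<dots> \<le> C * h ^ n * h" using h t C by (intro mult_left_mono) auto
    finally have "norm (Z h t - z h t) \<le> C * h ^ Suc n" using end_z end_Z h by (simp add: mult_ac)
    then have "K * norm (Z h t - z h t) \<le> K * (C * h ^ Suc n)" using K(1) by (rule mult_left_mono)
    moreover have "norm (adjoint_field (\<lambda>h t. Z h t - z h t) h t) \<le> K * norm (Z h t - z h t)"
      using K(2)[rule_format, OF h t] .
    ultimately show ?thesis by (simp add: adjoint_field_diff mult.assoc)
  qed
  then show ?case using Z Z' end_Z K(1) C
    by (intro exI[of _ Z] exI[of _ "\<lambda>h t. - adjoint_field z h t"] exI[of _ "K * C"]) auto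
qed

section \<open>Comparison with the exact solution\<close>

context
  fixes y :: "real \<Rightarrow> real ^ 'm"
  assumes y_init: "y t0 = y0"
    and y_deriv: "\<And>t. t \<in> {t0..t0 + h0} \<Longrightarrow>
      (y has_vector_derivative f (y t)) (at t within {t0..t0 + h0})"
begin

text \<open>Lipschitz constants and quadratic remainders of \<open>f\<close> are available on balls;
  a common ball makes them uniform over all steps.\<close>

lemma common_ball:
  "\<exists>R. \<forall>h\<in>{0<..h0}. \<forall>t\<in>{t0..t0 + h}. w h t \<in> cball 0 R \<and> y t \<in> cball 0 R"
proof -
  obtain Cw where Cw: "\<forall>h\<in>{0<..h0}. \<forall>t\<in>{t0..t0 + h}. norm (w h t) \<le> Cw"
    using w_bounded unfolding bounded_family_def by blast
  have "continuous_on {t0..t0 + h0} y"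
    unfolding continuous_on_eq_continuous_within
    by (intro ballI has_vector_derivative_continuous[OF y_deriv])
  then have "bounded (y ` {t0..t0 + h0})"
    by (intro compact_imp_bounded compact_continuous_image) auto
  then obtain Cy where Cy: "\<forall>t\<in>{t0..t0 + h0}. norm (y t) \<le> Cy"
    unfolding bounded_iff by blast
  have "w h t \<in> cball 0 (max Cw Cy) \<and> y t \<in> cball 0 (max Cw Cy)"
    if "h \<in> {0<..h0}" "t \<in> {t0..t0 + h}" for h t
    using Cw[rule_format, OF that] Cy[rule_format, of t] that by (auto simp: le_max_iff_disj)
  then show ?thesis by blast
qed

lemma error_has_derivative:
  assumes "h \<in> {0<..h0}" "t \<in> {t0..t0 + h}"
  shows "((\<lambda>t. w h t - y t) has_vector_derivative \<delta> h t + (f (w h t) - f (y t)))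
    (at t within {t0..t0 + h})"
proof -
  have "((\<lambda>t. w h t - y t) has_vector_derivative v h t - f (y t)) (at t within {t0..t0 + h})"
    using assms
    by (intro has_vector_derivative_diff derivative_familyD[OF w_has_derivative]
        has_vector_derivative_within_subset[OF y_deriv]) auto
  then show ?thesis by (simp add: \<delta>_def)
qed

text \<open>For \<open>h L \<le> 1/2\<close> the maximum of the error over the step is at most \<open>C h ^ (r + 1)\<close> plus half of
  itself; for the other \<open>h\<close>, which are bounded below, boundedness of the error suffices.\<close>

lemma error_bound:
  "\<exists>C\<ge>0. \<forall>h\<in>{0<..h0}. \<forall>t\<in>{t0..t0 + h}. norm (w h t - y t) \<le> C * h ^ (r + 1)"
proof -
  obtain R where R: "\<forall>h\<in>{0<..h0}. \<forall>t\<in>{t0..t0 + h}. w h t \<in> cball 0 R \<and> y t \<in> cball 0 R"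
    using common_ball by blast
  obtain L where L: "L \<ge> 0" "\<forall>x\<in>cball 0 R. \<forall>z\<in>cball 0 R. norm (f x - f z) \<le> L * norm (x - z)"
    using smooth_on_lipschitz[OF f, of 0 R] by blast
  obtain C where C: "C \<ge> 0" "\<forall>h\<in>{0<..h0}. \<forall>t\<in>{t0..t0 + h}. norm (\<delta> h t) \<le> C * h ^ r"
    using \<delta>_bound by blast
  define h1 where "h1 = 1 / (2 * (L + 1))"
  have h1: "h1 > 0" using L(1) by (simp add: h1_def)
  define C' where "C' = max (2 * C) (2 * \<bar>R\<bar> / h1 ^ (r + 1))"
  have C'0: "C' \<ge> 0" using C(1) by (simp add: C'_def le_max_iff_disj)
  have "norm (w h t - y t) \<le> C' * h ^ (r + 1)" if h: "h \<in> {0<..h0}" and t: "t \<in> {t0..t0 + h}" for h t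
  proof (cases "h \<le> h1")
    case True
    define e where "e = (\<lambda>t. w h t - y t)"
    have e': "(e has_vector_derivative \<delta> h s + (f (w h s) - f (y s))) (at s within {t0..t0 + h})"
      if "s \<in> {t0..t0 + h}" for s
      unfolding e_def by (rule error_has_derivative[OF h that])
    have "continuous_on {t0..t0 + h} e"
      unfolding continuous_on_eq_continuous_within
      by (intro ballI has_vector_derivative_continuous[OF e'])
    \<comment> \<open>Evaluating the integrated inequality at a maximum of the error takes the place
      of Gronwall's inequality.\<close>
    then have "\<exists>s\<in>{t0..t0 + h}. \<forall>t\<in>{t0..t0 + h}. norm (e t) \<le> norm (e s)"
      using h by (intro continuous_attains_sup continuous_on_norm) auto
    then obtain s where s: "s \<in> {t0..t0 + h}" "\<forall>t\<in>{t0..t0 + h}. norm (e t) \<le> norm (e s)"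
      by blast
    define m where "m = norm (e s)"
    have "norm (e s - e t0) \<le> (C * h ^ r + L * m) * \<bar>s - t0\<bar>"
    proof (rule vector_derivative_bound_interval[OF e'])
      fix t assume t: "t \<in> {t0..t0 + h}"
      have "norm (f (w h t) - f (y t)) \<le> L * norm (e t)"
        unfolding e_def using L(2) R h t by blast
      also have "\<dots> \<le> L * m" unfolding m_def using s(2) t L(1) by (intro mult_left_mono) auto
      finally show "norm (\<delta> h t + (f (w h t) - f (y t))) \<le> C * h ^ r + L * m"
        using C(2)[rule_format, OF h t] by (intro norm_triangle_mono)
    qed (use h s in auto)
    also have "\<dots> \<le> (C * h ^ r + L * m) * h"
      using s h C(1) L(1) by (intro mult_left_mono) (auto simp: m_def)
    finally have "m \<le> C * h ^ (r + 1) + (L * h) * m"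
      using w_init[OF h] y_init by (simp add: e_def m_def algebra_simps)
    moreover have "(L * h) * m \<le> 1 / 2 * m"
    proof (rule mult_right_mono)
      have "L * h \<le> (L + 1) * h1" using True L(1) h by (intro mult_mono) auto
      also have "\<dots> = 1 / 2" using L(1) by (simp add: h1_def)
      finally show "L * h \<le> 1 / 2" .
    qed (simp add: m_def)
    ultimately have "m \<le> 2 * C * h ^ (r + 1)" by simp
    also have "\<dots> \<le> C' * h ^ (r + 1)" using h by (intro mult_right_mono) (auto simp: C'_def)
    finally show ?thesis using s(2)[rule_format, OF t] by (simp add: e_def m_def)
  next
    case False
    have "norm (w h t) \<le> R" "norm (y t) \<le> R" using R h t by auto
    then have "norm (w h t - y t) \<le> 2 * \<bar>R\<bar>" using norm_triangle_ineq4[of "w h t" "y t"] by linarith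
    also have "\<dots> = 2 * \<bar>R\<bar> / h1 ^ (r + 1) * h1 ^ (r + 1)" using h1 by simp
    also have "\<dots> \<le> C' * h ^ (r + 1)"
      using False h1 C'0 by (intro mult_mono power_mono) (auto simp: C'_def)
    finally show ?thesis .
  qed
  then show ?thesis using C'0 by blast
qed

text \<open>With \<open>e\<close> the error, the derivative of \<open>z \<bullet> e\<close> is the
  residual of \<open>z\<close> paired with \<open>e\<close>, plus
  \<open>z \<bullet> \<delta>\<close>, minus \<open>z\<close> paired with a quadratic remainder; the
  linear parts cancel against the adjoint field. Each term is at most of order
  \<open>h ^ (2 * r)\<close>, the second after removing a part with zero integral, and the length of
  the step gives the last power.\<close>

lemma end_error_bound_inner:
  "\<exists>C\<ge>0. \<forall>h\<in>{0<..h0}. \<bar>\<xi> \<bullet> (w h (t0 + h) - y (t0 + h))\<bar> \<le> C * h ^ (2 * r + 1)"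
proof -
  obtain R where R: "\<forall>h\<in>{0<..h0}. \<forall>t\<in>{t0..t0 + h}. w h t \<in> cball 0 R \<and> y t \<in> cball 0 R"
    using common_ball by blast
  obtain Q where Q: "Q \<ge> 0" "\<forall>x\<in>cball 0 R. \<forall>z\<in>cball 0 R.
      norm (f z - f x - (\<Sum>i\<in>UNIV. (z - x) $ i *\<^sub>R frechet_derivative f (at x) (axis i 1)))
        \<le> Q * norm (z - x) ^ 2"
    using smooth_on_quadratic_remainder[OF f, of 0 R] by blast
  obtain Cd where Cd: "Cd \<ge> 0" "\<forall>h\<in>{0<..h0}. \<forall>t\<in>{t0..t0 + h}. norm (\<delta> h t) \<le> Cd * h ^ r"
    using \<delta>_bound by blast
  obtain Ce where Ce: "Ce \<ge> 0"
    "\<forall>h\<in>{0<..h0}. \<forall>t\<in>{t0..t0 + h}. norm (w h t - y t) \<le> Ce * h ^ (r + 1)"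
    using error_bound by blast
  obtain z z' Ca where z: "\<forall>k. Ck_family k z" and z': "derivative_family z z'"
    and end_z: "\<forall>h\<in>{0<..h0}. z h (t0 + h) = \<xi>" and Ca: "Ca \<ge> 0"
    and res: "\<forall>h\<in>{0<..h0}. \<forall>t\<in>{t0..t0 + h}. norm (z' h t + adjoint_field z h t) \<le> Ca * h ^ r"
    using approximate_adjoint_solution[of \<xi> r] by (elim exE conjE) (rule that; assumption)
  obtain Cz where Cz: "Cz \<ge> 0" "\<forall>h\<in>{0<..h0}. \<forall>t\<in>{t0..t0 + h}. norm (z h t) \<le> Cz"
    using Ck_family_bounded[OF z[rule_format, of 0]] unfolding bounded_family_def by blast
  obtain \<gamma> Cq where Cq: "Cq \<ge> 0" and approx: "\<forall>h\<in>{0<..h0}. \<forall>t\<in>{t0..t0 + h}.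
      norm (z h t - (\<Sum>j<r. \<psi> j 0 t *\<^sub>R \<gamma> h j)) \<le> Cq * h ^ r"
    using Ck_family_approximation[OF z[rule_format, of r]] by blast
  define C where "C = Ca * Ce + Cq * Cd + Cz * (Q * Ce\<^sup>2)"
  have C: "C \<ge> 0" using Ca Ce Cq Cd Cz Q by (simp add: C_def)
  have "\<bar>\<xi> \<bullet> (w h (t0 + h) - y (t0 + h))\<bar> \<le> C * h ^ (2 * r + 1)" if h: "h \<in> {0<..h0}" for h
  proof -
    have h': "0 < h" "h \<le> 1" using h h0 by auto
    define e where "e = (\<lambda>t. w h t - y t)"
    define q where "q = (\<lambda>t. \<Sum>j<r. \<psi> j 0 t *\<^sub>R \<gamma> h j)"
    define g where "g = (\<lambda>t. z' h t \<bullet> e t + z h t \<bullet> (\<delta> h t + (f (w h t) - f (y t))))"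
    have deriv: "((\<lambda>t. z h t \<bullet> e t) has_vector_derivative g t) (at t within {t0..t0 + h})"
      if "t \<in> {t0..t0 + h}" for t
      using bounded_bilinear.has_vector_derivative[OF bounded_bilinear_inner
          derivative_familyD[OF z' h] error_has_derivative[OF h that]]
      unfolding e_def g_def by (simp add: add.commute)
    \<comment> \<open>Orthogonality is stated on the unit interval, so the fundamental theorem is
      applied after rescaling; the factor \<open>h\<close> of the chain rule is the last power
      gained.\<close>
    have "((\<lambda>x. h * g (t0 + x * h)) has_integral
        (z h (t0 + 1 * h) \<bullet> e (t0 + 1 * h) - z h (t0 + 0 * h) \<bullet> e (t0 + 0 * h))) {0..1}"
    proof (rule fundamental_theorem_of_calculus)
      fix x :: real assume x: "x \<in> {0..1}"
      have inner: "((\<lambda>x. t0 + x * h) has_vector_derivative h) (at x within {0..1})"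
        by (auto intro!: derivative_eq_intros
            simp: has_real_derivative_iff_has_vector_derivative[symmetric])
      have "((\<lambda>t. z h t \<bullet> e t) has_vector_derivative g (t0 + x * h))
          (at (t0 + x * h) within (\<lambda>x. t0 + x * h) ` {0..1})"
        using scaled_mem[OF h]
        by (intro has_vector_derivative_within_subset[OF deriv[OF scaled_mem[OF h x]]]) blast
      from vector_diff_chain_within[OF inner this]
      show "((\<lambda>x. z h (t0 + x * h) \<bullet> e (t0 + x * h)) has_vector_derivative h * g (t0 + x * h))
          (at x within {0..1})"
        by (simp add: o_def)
    qed simp
    then have "((\<lambda>x. h * g (t0 + x * h)) has_integral (\<xi> \<bullet> e (t0 + h))) {0..1}"
      using end_z h w_init y_init by (simp add: e_def)
    from has_integral_divide[OF this, of h]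
    have int_g01: "((\<lambda>x. g (t0 + x * h)) has_integral (\<xi> \<bullet> e (t0 + h)) / h) {0..1}"
      using h' by simp
    \<comment> \<open>\<open>q\<close> takes values in the space, so its pairing with the defect can
      be subtracted from the integrand for free.\<close>
    have "((\<lambda>x. \<Sum>j<r. \<gamma> h j \<bullet> (\<psi> j 0 (t0 + x * h) *\<^sub>R \<delta> h (t0 + x * h))) has_integral
        (\<Sum>j<r. \<gamma> h j \<bullet> 0)) {0..1}"
      using has_integral_linear[OF \<delta>_orthogonal[OF h] bounded_linear_inner_right]
      by (intro has_integral_sum) (auto simp: o_def)
    then have int_q01: "((\<lambda>x. q (t0 + x * h) \<bullet> \<delta> h (t0 + x * h)) has_integral 0) {0..1}"
      by (simp add: q_def inner_sum_left mult.commute)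
    have "\<bar>g t - q t \<bullet> \<delta> h t\<bar> \<le> C * h ^ (2 * r)" if t: "t \<in> {t0..t0 + h}" for t
    proof -
      define D where "D = (\<Sum>j\<in>UNIV. e t $ j *\<^sub>R frechet_derivative f (at (w h t)) (axis j 1))"
      \<comment> \<open>\<open>f (w h t) - f (y t)\<close> equals \<open>D - \<rho>\<close>, and
        \<open>D\<close> is the part that the adjoint field cancels.\<close>
      define \<rho> where "\<rho> = f (y t) - f (w h t) + D"
      have pow: "h ^ (2 * r) = h ^ r * h ^ r" by (simp add: mult_2 power_add)
      have et: "norm (e t) \<le> Ce * h ^ (r + 1)" using Ce h t by (simp add: e_def)
      have "(\<Sum>i\<in>UNIV. (y t - w h t) $ i *\<^sub>R frechet_derivative f (at (w h t)) (axis i 1)) = - D"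
        by (simp add: D_def e_def sum_negf[symmetric] scaleR_left_diff_distrib)
      then have "norm \<rho> \<le> Q * norm (y t - w h t) ^ 2"
        using Q(2)[rule_format, of "w h t" "y t"] R h t by (simp add: \<rho>_def)
      also have "\<dots> \<le> Q * (Ce * h ^ (r + 1)) ^ 2"
        using et Q(1) by (intro mult_left_mono power_mono) (auto simp: e_def norm_minus_commute)
      also have "\<dots> = Q * Ce\<^sup>2 * (h ^ (2 * r) * h\<^sup>2)"
        unfolding pow by (simp add: power_mult_distrib power2_eq_square mult_ac)
      also have "\<dots> \<le> Q * Ce\<^sup>2 * (h ^ (2 * r) * 1)"
        using h' Q(1) by (intro mult_left_mono) (auto simp: power_le_one)
      finally have \<rho>: "norm \<rho> \<le> Q * Ce\<^sup>2 * h ^ (2 * r)" by simp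
      have "g t - q t \<bullet> \<delta> h t =
          (z' h t + adjoint_field z h t) \<bullet> e t + (z h t - q t) \<bullet> \<delta> h t - z h t \<bullet> \<rho>"
        by (simp add: g_def inner_add_left inner_diff_left inner_diff_right inner_add_right
            adjoint_field_inner D_def[symmetric] \<rho>_def)
      also have "\<bar>\<dots>\<bar> \<le> norm (z' h t + adjoint_field z h t) * norm (e t) +
          norm (z h t - q t) * norm (\<delta> h t) + norm (z h t) * norm \<rho>"
        using Cauchy_Schwarz_ineq2[of "z' h t + adjoint_field z h t" "e t"]
          Cauchy_Schwarz_ineq2[of "z h t - q t" "\<delta> h t"] Cauchy_Schwarz_ineq2[of "z h t" \<rho>]
        by linarith
      also have "\<dots> \<le> Ca * h ^ r * (Ce * h ^ r) + Cq * h ^ r * (Cd * h ^ r) +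
          Cz * (Q * Ce\<^sup>2 * h ^ (2 * r))"
      proof (intro add_mono mult_mono)
        \<comment> \<open>One power of \<open>h\<close> in the error bound is given away: order
          \<open>2 * r\<close> suffices for the integrand.\<close>
        show "norm (e t) \<le> Ce * h ^ r"
          using h' Ce(1) by (intro order_trans[OF et] mult_left_mono power_decreasing) auto
        show "norm (z' h t + adjoint_field z h t) \<le> Ca * h ^ r" using res h t by blast
        show "norm (z h t - q t) \<le> Cq * h ^ r" unfolding q_def using approx h t by blast
        show "norm (\<delta> h t) \<le> Cd * h ^ r" using Cd h t by blast
        show "norm (z h t) \<le> Cz" using Cz h t by blast
      qed (use Ca Cq Cz h' \<rho> in auto)
      also have "\<dots> = C * h ^ (2 * r)"
        unfolding pow C_def by (simp add: algebra_simps)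
      finally show ?thesis .
    qed
    then have "norm (g (t0 + x * h) - q (t0 + x * h) \<bullet> \<delta> h (t0 + x * h)) \<le> C * h ^ (2 * r)"
      if "x \<in> {0..1}" for x
      using scaled_mem[OF h that] by simp
    then have "norm ((\<xi> \<bullet> e (t0 + h)) / h - 0) \<le> C * h ^ (2 * r) * measure lborel (cbox 0 (1::real))"
      using C h' has_integral_diff[OF int_g01 int_q01]
      by (intro has_integral_bound) auto
    then show ?thesis using h' by (simp add: e_def field_simps)
  qed
  then show ?thesis using C by blast
qed

lemma end_error_bound:
  "\<exists>C. \<forall>h\<in>{0<..h0}. norm (w h (t0 + h) - y (t0 + h)) \<le> C * h ^ (2 * r + 1)"
proof -
  have "\<forall>i. \<exists>C. \<forall>h\<in>{0<..h0}. \<bar>axis i 1 \<bullet> (w h (t0 + h) - y (t0 + h))\<bar> \<le> C * h ^ (2 * r + 1)"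
    using end_error_bound_inner by blast
  from choice[OF this] obtain C where
    C: "\<forall>i. \<forall>h\<in>{0<..h0}. \<bar>axis i 1 \<bullet> (w h (t0 + h) - y (t0 + h))\<bar> \<le> C i * h ^ (2 * r + 1)" by blast
  have "norm (w h (t0 + h) - y (t0 + h)) \<le> (\<Sum>i\<in>UNIV. C i) * h ^ (2 * r + 1)" if "h \<in> {0<..h0}" for h
  proof -
    have "norm (w h (t0 + h) - y (t0 + h)) \<le> (\<Sum>i\<in>UNIV. \<bar>(w h (t0 + h) - y (t0 + h)) $ i\<bar>)"
      by (rule norm_le_l1_cart)
    also have "\<dots> \<le> (\<Sum>i\<in>UNIV. C i * h ^ (2 * r + 1))"
      using C that by (intro sum_mono) (auto simp: inner_axis')
    finally show ?thesis by (simp add: sum_distrib_right)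
  qed
  then show ?thesis by blast
qed

end

end

section \<open>The method as a projected flow\<close>

lemma has_vector_derivative_LBINT:
  fixes g :: "real \<Rightarrow> real"
  assumes "continuous_on UNIV g"
  shows "((\<lambda>t. LBINT s=ereal c..ereal t. g s) has_vector_derivative g t) (at t within S)"
proof -
  \<comment> \<open>Enlarged by 1 at both ends, so that \<open>t\<close> is interior and the
    derivative two-sided.\<close>
  let ?a = "min c t - 1" and ?b = "max c t + 1"
  have "((\<lambda>t. LBINT s=ereal c..ereal t. g s) has_vector_derivative g t) (at t within {?a..?b})"
    by (rule interval_integral_FTC2) (auto intro: continuous_on_subset[OF assms])
  moreover have "at t within {?a..?b} = at t" by (rule at_within_interior) auto
  ultimately show ?thesis using has_vector_derivative_at_within by metis
qed

lemma vec_spanI: "(\<And>t. v t = (\<Sum>i<k. \<psi> i t *\<^sub>R W i)) \<Longrightarrow> v \<in> vec_span k \<psi>"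
  unfolding vec_span_def by (rule CollectI, rule exI[of _ W]) auto

text \<open>The formula defining \<open>X_space\<close> makes sense for all \<open>t\<close> and so
  extends \<open>u\<close> to a function \<open>w\<close> on the line. In unscaled time the factor
  \<open>h\<close> of the chain rule cancels the one in the variational equation.\<close>

lemma (in jet_basis) ffcfe_solution_flow:
  fixes f :: "real ^ 'm::finite \<Rightarrow> real ^ 'm"
  assumes sol: "ffcfe_solution r \<phi> f t0 y0 h u" and h: "h > 0"
    and f: "continuous_on UNIV f"
    and \<phi>_cont: "\<And>i. i < r \<Longrightarrow> continuous_on UNIV (\<phi> i)"
    and \<psi>_span: "\<And>j. j < r \<Longrightarrow> \<exists>c. \<forall>t. \<psi> j 0 t = (\<Sum>i<r. c i * \<phi> i t)"
    and \<phi>_span: "\<And>i. i < r \<Longrightarrow> \<exists>c. \<forall>t. \<phi> i t = (\<Sum>j<r. c j * \<psi> j 0 t)"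
  shows "\<exists>w a. (\<forall>t. (w has_vector_derivative (\<Sum>j<r. \<psi> j 0 t *\<^sub>R a j)) (at t)) \<and>
    (\<forall>\<tau>\<in>{0..1}. u \<tau> = w (t0 + \<tau> * h)) \<and> w t0 = y0 \<and>
    (\<forall>j<r. integral {0..1} (\<lambda>x. \<psi> j 0 (t0 + x * h) *\<^sub>R
      ((\<Sum>l<r. \<psi> l 0 (t0 + x * h) *\<^sub>R a l) - f (w (t0 + x * h)))) = 0)"
proof -
  obtain W :: "nat \<Rightarrow> real ^ 'm" where W: "\<forall>\<tau>\<in>{0..1}. u \<tau> = (\<Sum>i<Suc r.
      (case i of 0 \<Rightarrow> 1 | Suc j \<Rightarrow> (LBINT s=ereal t0..ereal (t0 + \<tau> * h). \<phi> j s)) *\<^sub>R W i)"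
    using sol unfolding ffcfe_solution_def rescaled_def X_space_def vec_span_def by blast
  define w where "w = (\<lambda>t. W 0 + (\<Sum>i<r. (LBINT s=ereal t0..ereal t. \<phi> i s) *\<^sub>R W (Suc i)))"
  have u: "u \<tau> = w (t0 + \<tau> * h)" if "\<tau> \<in> {0..1}" for \<tau>
    using W that by (simp add: w_def sum.lessThan_Suc_shift del: sum.lessThan_Suc)
  have "\<forall>i. \<exists>c. i < r \<longrightarrow> (\<forall>t. \<phi> i t = (\<Sum>j<r. c j * \<psi> j 0 t))" using \<phi>_span by blast
  from choice[OF this] obtain c where
    c: "\<And>i t. i < r \<Longrightarrow> \<phi> i t = (\<Sum>j<r. c i j * \<psi> j 0 t)" by blast
  define a where "a = (\<lambda>j. \<Sum>i<r. c i j *\<^sub>R W (Suc i))"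
  have w': "(w has_vector_derivative (\<Sum>j<r. \<psi> j 0 t *\<^sub>R a j)) (at t)" for t
  proof -
    have "(w has_vector_derivative 0 + (\<Sum>i<r. (LBINT s=ereal t0..ereal t. \<phi> i s) *\<^sub>R 0 +
        \<phi> i t *\<^sub>R W (Suc i))) (at t)"
      unfolding w_def
      by (intro has_vector_derivative_add has_vector_derivative_sum has_vector_derivative_scaleR
          has_vector_derivative_const)
        (auto simp: has_real_derivative_iff_has_vector_derivative intro!: has_vector_derivative_LBINT \<phi>_cont)
    also have "0 + (\<Sum>i<r. (LBINT s=ereal t0..ereal t. \<phi> i s) *\<^sub>R 0 + \<phi> i t *\<^sub>R W (Suc i))
        = (\<Sum>i<r. \<Sum>j<r. (c i j * \<psi> j 0 t) *\<^sub>R W (Suc i))"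
      by (simp add: c scaleR_sum_left)
    also have "\<dots> = (\<Sum>j<r. \<psi> j 0 t *\<^sub>R a j)"
      by (subst sum.swap) (simp add: a_def scaleR_sum_right mult.commute)
    finally show ?thesis .
  qed
  have cont: "continuous_on S (\<lambda>x. w (g x))" if "continuous_on S g" for S :: "real set" and g
  proof (rule continuous_on_compose2[of UNIV w, OF _ that])
    show "continuous_on UNIV w"
      by (intro continuous_at_imp_continuous_on ballI has_vector_derivative_continuous[OF w'])
  qed auto
  have "w t0 = y0" using u[of 0] sol by (simp add: ffcfe_solution_def)
  moreover have "integral {0..1} (\<lambda>x. \<psi> j 0 (t0 + x * h) *\<^sub>R
      ((\<Sum>l<r. \<psi> l 0 (t0 + x * h) *\<^sub>R a l) - f (w (t0 + x * h)))) = 0" if j: "j < r" for j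
  proof -
    obtain b where b: "\<And>t. \<psi> j 0 t = (\<Sum>i<r. b i * \<phi> i t)" using \<psi>_span[OF j] by blast
    \<comment> \<open>The all-ones vector turns the entrywise product into multiplication by the
      scalar \<open>\<psi> j 0\<close>, so one test function serves every entry.\<close>
    define p where "p = (\<lambda>x. \<psi> j 0 (t0 + x * h) *\<^sub>R (1 :: real ^ 'm))"
    have "(\<lambda>t. \<psi> j 0 t *\<^sub>R (1 :: real ^ 'm)) \<in> Y_space r \<phi>"
      unfolding Y_space_def
      by (rule vec_spanI[where W = "\<lambda>i. b i *\<^sub>R 1"]) (simp add: b scaleR_sum_left mult.commute)
    then have "p \<in> rescaled t0 h (Y_space r \<phi>)" unfolding rescaled_def p_def by auto
    then have eq: "ip p (\<lambda>\<tau>. vector_derivative u (at \<tau> within {0..1})) = h *\<^sub>R ip p (f \<circ> u)"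
      using sol unfolding ffcfe_solution_def by blast
    have ip: "ip p g = integral {0..1} (\<lambda>x. \<psi> j 0 (t0 + x * h) *\<^sub>R g x)" for g
      unfolding ip_def p_def by (intro arg_cong[where f = "integral {0..1}"] ext) (simp add: vec_eq_iff)
    have u': "vector_derivative u (at x within {0..1}) =
        h *\<^sub>R (\<Sum>l<r. \<psi> l 0 (t0 + x * h) *\<^sub>R a l)" if x: "x \<in> {0..1}" for x
    proof -
      have "((\<lambda>x. t0 + x * h) has_vector_derivative h) (at x within {0..1})"
        by (auto intro!: derivative_eq_intros
            simp: has_real_derivative_iff_has_vector_derivative[symmetric])
      from vector_diff_chain_within[OF this has_vector_derivative_at_within[OF w']]
      have "((\<lambda>x. w (t0 + x * h)) has_vector_derivative
          h *\<^sub>R (\<Sum>l<r. \<psi> l 0 (t0 + x * h) *\<^sub>R a l)) (at x within {0..1})"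
        by (simp add: o_def)
      \<comment> \<open>\<open>u\<close> is determined on the unit interval only, and its derivative
        within that interval sees no other values.\<close>
      then have "(u has_vector_derivative
          h *\<^sub>R (\<Sum>l<r. \<psi> l 0 (t0 + x * h) *\<^sub>R a l)) (at x within {0..1})"
        by (rule has_vector_derivative_transform[rotated 2]) (use x u in auto)
      then show ?thesis
        using vector_derivative_within_cbox[of 0 1 x u] x by (simp add: cbox_interval)
    qed
    have "h *\<^sub>R integral {0..1} (\<lambda>x. \<psi> j 0 (t0 + x * h) *\<^sub>R (\<Sum>l<r. \<psi> l 0 (t0 + x * h) *\<^sub>R a l))
        = integral {0..1} (\<lambda>x. h *\<^sub>R (\<psi> j 0 (t0 + x * h) *\<^sub>R (\<Sum>l<r. \<psi> l 0 (t0 + x * h) *\<^sub>R a l)))"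
      by (rule integral_cmul[symmetric])
    also have "\<dots> = integral {0..1} (\<lambda>x. \<psi> j 0 (t0 + x * h) *\<^sub>R vector_derivative u (at x within {0..1}))"
      by (rule integral_cong) (simp add: u' mult.commute)
    also have "\<dots> = h *\<^sub>R integral {0..1} (\<lambda>x. \<psi> j 0 (t0 + x * h) *\<^sub>R f (u x))"
      using eq unfolding ip by simp
    also have "integral {0..1} (\<lambda>x. \<psi> j 0 (t0 + x * h) *\<^sub>R f (u x))
        = integral {0..1} (\<lambda>x. \<psi> j 0 (t0 + x * h) *\<^sub>R f (w (t0 + x * h)))"
      by (rule integral_cong) (simp add: u)
    finally have "integral {0..1} (\<lambda>x. \<psi> j 0 (t0 + x * h) *\<^sub>R (\<Sum>l<r. \<psi> l 0 (t0 + x * h) *\<^sub>R a l))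
        = integral {0..1} (\<lambda>x. \<psi> j 0 (t0 + x * h) *\<^sub>R f (w (t0 + x * h)))"
      using h by simp
    moreover have "(\<lambda>x. \<psi> j 0 (t0 + x * h) *\<^sub>R (\<Sum>l<r. \<psi> l 0 (t0 + x * h) *\<^sub>R a l)) integrable_on {0..1}"
      using j by (intro integrable_continuous_interval continuous_intros \<psi>_continuous_comp) auto
    moreover have "(\<lambda>x. \<psi> j 0 (t0 + x * h) *\<^sub>R f (w (t0 + x * h))) integrable_on {0..1}"
      using j by (intro integrable_continuous_interval continuous_on_scaleR \<psi>_continuous_comp
          continuous_on_compose2[OF f cont] continuous_intros) auto
    ultimately show ?thesis by (simp add: scaleR_right_diff_distrib integral_diff)
  qed
  ultimately show ?thesis using w' u by (intro exI[of _ w] exI[of _ a]) auto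
qed

section \<open>Both order estimates for the method\<close>

theorem theorem3p5:
  fixes H :: "real ^ ('n::finite + 'n) \<Rightarrow> real"
    and f :: "real ^ ('n + 'n) \<Rightarrow> real ^ ('n + 'n)"
    and \<phi> :: "nat \<Rightarrow> real \<Rightarrow> real"
    and r :: nat
    and t0 T R :: real
    and y0 :: "real ^ ('n + 'n)"
    and y :: "real \<Rightarrow> real ^ ('n + 'n)"
    and u :: "real \<Rightarrow> real \<Rightarrow> real ^ ('n + 'n)"
  assumes smooth_H: "smooth_on UNIV H"
    and smooth_f: "smooth_on UNIV f"
    and hamiltonian: "\<And>x. f x = matrix_inv J_mat *v gradient H x"
    and r_pos: "r \<ge> 1"
    and smooth_phi: "\<And>i. i < r \<Longrightarrow> smooth_on UNIV (\<phi> i)"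
    and indep_phi: "lin_indep r \<phi>"
    and invariant: "shift_reflect_invariant (Y_space r \<phi> :: (real \<Rightarrow> real ^ ('n + 'n)) set)"
    and R_pos: "R > 0"
    and u_sol: "\<forall>\<^sub>F h in at_right 0. unique_ffcfe_solution r \<phi> f t0 y0 R h (u h)"
    and u_smooth: "smooth_up_to_zero u"
    and T_pos: "T > 0"
    and y_ode: "\<And>t. t \<in> {t0..t0 + T} \<Longrightarrow>
                  (y has_vector_derivative f (y t)) (at t within {t0..t0 + T})"
    and y_init: "y t0 = y0"
  shows "(\<exists>C. \<forall>\<^sub>F h in at_right 0. \<forall>\<tau>\<in>{0<..<1}.
             norm (u h \<tau> - y (t0 + \<tau> * h)) \<le> C * h ^ (r + 1)) \<and>
         (\<lambda>h. norm (u h 1 - y (t0 + h))) \<in> O[at_right 0](\<lambda>h. h ^ (2 * r + 1))"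
proof -
  \<comment> \<open>Invariance is given for vector-valued functions; multiples of the all-ones
    vector carry it over to the scalar \<open>\<phi> i\<close>.\<close>
  have \<phi>_trans: "\<exists>W. \<forall>t. \<phi> i (t + c) = (\<Sum>j<r. W j * \<phi> j t)" if i: "i < r" for i c
  proof -
    have "(\<Sum>l<r. \<phi> l t *\<^sub>R (if l = i then 1 else 0 :: real ^ ('n + 'n))) = \<phi> i t *\<^sub>R 1" for t
    proof -
      have "(\<Sum>l<r. \<phi> l t *\<^sub>R (if l = i then 1 else 0 :: real ^ ('n + 'n)))
          = (\<Sum>l<r. if l = i then \<phi> i t *\<^sub>R 1 else 0)"
        by (intro sum.cong) auto
      then show ?thesis using i by simp
    qed
    then have "(\<lambda>t. \<phi> i t *\<^sub>R (1 :: real ^ ('n + 'n))) \<in> Y_space r \<phi>"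
      unfolding Y_space_def by (intro vec_spanI[where W = "\<lambda>l. if l = i then 1 else 0"]) simp
    from bspec[OF invariant[unfolded shift_reflect_invariant_def] this]
    have "(\<lambda>t. \<phi> i (t + c) *\<^sub>R (1 :: real ^ ('n + 'n))) \<in> Y_space r \<phi>"
      by blast
    then obtain W :: "nat \<Rightarrow> real ^ ('n + 'n)"
      where "(\<lambda>t. \<phi> i (t + c) *\<^sub>R 1) = (\<lambda>t. \<Sum>j<r. \<phi> j t *\<^sub>R W j)"
      unfolding Y_space_def vec_span_def by blast
    then have W: "\<phi> i (t + c) *\<^sub>R 1 = (\<Sum>j<r. \<phi> j t *\<^sub>R W j)" for t by (rule fun_cong)
    have "\<phi> i (t + c) = (\<Sum>j<r. W j $ k * \<phi> j t)" for t and k :: "'n + 'n"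
      using arg_cong[OF W[of t], of "\<lambda>x. x $ k"] by (simp add: mult.commute)
    \<comment> \<open>Any coordinate will do; \<open>undefined\<close> merely names one.\<close>
    then show ?thesis by (intro exI[of _ "\<lambda>j. W j $ undefined"]) blast
  qed
  have \<phi>_deriv: "(\<phi> i has_real_derivative frechet_derivative (\<phi> i) (at t) 1) (at t)"
    if "i < r" for i t
  proof -
    have d: "(\<phi> i has_derivative frechet_derivative (\<phi> i) (at t)) (at t)"
      using smooth_on_has_derivative[OF smooth_phi[OF that]] .
    have "(*) (frechet_derivative (\<phi> i) (at t) 1) = frechet_derivative (\<phi> i) (at t)"
    proof
      fix s show "frechet_derivative (\<phi> i) (at t) 1 * s = frechet_derivative (\<phi> i) (at t) s"
        using linear_cmul[OF has_derivative_linear[OF d], of s 1] by (simp add: mult.commute)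
    qed
    then show ?thesis using d by (simp only: has_field_derivative_def)
  qed
  obtain A where A: "\<forall>i<r. \<forall>t. (\<phi> i has_real_derivative (\<Sum>j<r. A i j * \<phi> j t)) (at t)"
    using translation_invariant_derivative[OF indep_phi \<phi>_deriv \<phi>_trans] by blast
  obtain \<psi> where \<psi>: "\<forall>j<r. \<forall>k t. (\<psi> j k has_real_derivative \<psi> j (Suc k) t) (at t)"
    "\<forall>j<r. \<forall>k<r. \<psi> j k t0 = (if j = k then 1 else 0)"
    and \<psi>_span: "\<forall>j<r. \<exists>c. \<forall>t. \<psi> j 0 t = (\<Sum>i<r. c i * \<phi> i t)"
    and \<phi>_span: "\<forall>i<r. \<exists>c. \<forall>t. \<phi> i t = (\<Sum>j<r. c j * \<psi> j 0 t)"
    using jet_dual_basis[OF A indep_phi, of t0] by (elim exE conjE) (rule that; assumption)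
  interpret jet_basis r \<psi> t0 by unfold_locales (use \<psi> in auto)
  obtain K0 h1 where K0: "K0 \<ge> 0" and h1: "h1 \<in> {0<..1}" and
    stable: "\<forall>h\<in>{0<..h1}. \<forall>(b :: nat \<Rightarrow> real ^ ('n + 'n)) \<eta> \<epsilon>.
     continuous_on {0..1} \<eta> \<longrightarrow> (\<forall>x\<in>{0..1}. norm (\<eta> x) \<le> \<epsilon>) \<longrightarrow>
     (\<forall>j<r. integral {0..1} (\<lambda>x. \<psi> j 0 (t0 + x * h) *\<^sub>R
        ((\<Sum>l<r. \<psi> l 0 (t0 + x * h) *\<^sub>R b l) - \<eta> x)) = 0) \<longrightarrow>
     (\<Sum>j<r. norm (b j) * h ^ j) \<le> K0 * \<epsilon>"
    using projection_stability by (elim exE conjE bexE) (rule that; assumption)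
  obtain h2 where h2: "h2 > 0"
    "\<forall>h>0. h < h2 \<longrightarrow> unique_ffcfe_solution r \<phi> f t0 y0 R h (u h)"
    using u_sol unfolding eventually_at_right_field by blast
  \<comment> \<open>\<open>h2 / 2\<close> turns \<open>h \<le> h0\<close> into the strict
    \<open>h < h2\<close>, and \<open>T\<close> keeps the step inside the interval on which
    \<open>y\<close> solves the equation.\<close>
  define h0 where "h0 = min h1 (min (h2 / 2) T)"
  have h0_le: "0 < h0" "h0 \<le> 1" "h0 \<le> h1" "h0 < h2" "h0 \<le> T"
    using h1 h2(1) T_pos by (auto simp: h0_def)
  have sol: "ffcfe_solution r \<phi> f t0 y0 h (u h)" "in_sup_ball y0 R (u h)" if "h \<in> {0<..h0}" for h
    using h2(2) that h0_le unfolding unique_ffcfe_solution_def by auto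
  have "\<forall>h. \<exists>w a. h \<in> {0<..h0} \<longrightarrow>
    (\<forall>t. (w has_vector_derivative (\<Sum>j<r. \<psi> j 0 t *\<^sub>R a j)) (at t)) \<and>
    (\<forall>\<tau>\<in>{0..1}. u h \<tau> = w (t0 + \<tau> * h)) \<and> w t0 = y0 \<and>
    (\<forall>j<r. integral {0..1} (\<lambda>x. \<psi> j 0 (t0 + x * h) *\<^sub>R
      ((\<Sum>l<r. \<psi> l 0 (t0 + x * h) *\<^sub>R a l) - f (w (t0 + x * h)))) = 0)"
    using ffcfe_solution_flow[OF sol(1) _ smooth_on_continuous[OF smooth_f]
        smooth_on_continuous[OF smooth_phi] \<psi>_span[rule_format] \<phi>_span[rule_format]]
    by (simp only: greaterThanAtMost_iff imp_conjL) blast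
  from choice[OF this] obtain w where "\<forall>h. \<exists>a. h \<in> {0<..h0} \<longrightarrow>
    (\<forall>t. (w h has_vector_derivative (\<Sum>j<r. \<psi> j 0 t *\<^sub>R a j)) (at t)) \<and>
    (\<forall>\<tau>\<in>{0..1}. u h \<tau> = w h (t0 + \<tau> * h)) \<and> w h t0 = y0 \<and>
    (\<forall>j<r. integral {0..1} (\<lambda>x. \<psi> j 0 (t0 + x * h) *\<^sub>R
      ((\<Sum>l<r. \<psi> l 0 (t0 + x * h) *\<^sub>R a l) - f (w h (t0 + x * h)))) = 0)" ..
  from choice[OF this] obtain a where wa: "\<forall>h. h \<in> {0<..h0} \<longrightarrow>
    (\<forall>t. (w h has_vector_derivative (\<Sum>j<r. \<psi> j 0 t *\<^sub>R a h j)) (at t)) \<and>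
    (\<forall>\<tau>\<in>{0..1}. u h \<tau> = w h (t0 + \<tau> * h)) \<and> w h t0 = y0 \<and>
    (\<forall>j<r. integral {0..1} (\<lambda>x. \<psi> j 0 (t0 + x * h) *\<^sub>R
      ((\<Sum>l<r. \<psi> l 0 (t0 + x * h) *\<^sub>R a h l) - f (w h (t0 + x * h)))) = 0)" ..
  have uw: "u h \<tau> = w h (t0 + \<tau> * h)" if "h \<in> {0<..h0}" "\<tau> \<in> {0..1}" for h \<tau>
    using wa that by blast
  interpret step_interval t0 h0 by unfold_locales (use h0_le in auto)
  interpret projected_flow r \<psi> t0 h0 f w a y0 K0
  proof unfold_locales
    show "smooth_on UNIV f" by (rule smooth_f)
    show "derivative_family w (\<lambda>h t. \<Sum>j<r. \<psi> j 0 t *\<^sub>R a h j)"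
      unfolding derivative_family_def using wa by blast
    show "w h t0 = y0" if "h \<in> {0<..h0}" for h using wa that by blast
    show "bounded_family w"
    proof (rule bounded_familyI)
      fix h t assume h: "h \<in> {0<..h0}" and t: "t \<in> {t0..t0 + h}"
      define \<tau> where "\<tau> = (t - t0) / h"
      have \<tau>: "\<tau> \<in> {0..1}" "t = t0 + \<tau> * h" using h t by (auto simp: \<tau>_def field_simps)
      have "infnorm (w h t - y0) \<le> R"
        using sol(2)[OF h] \<tau> uw[OF h] unfolding in_sup_ball_def by auto
      \<comment> \<open>The ball is taken in the maximum norm; passing to the Euclidean norm costs
        the square root of the dimension.\<close>
      then have "sqrt DIM(real ^ ('n + 'n)) * infnorm (w h t - y0) \<le> sqrt DIM(real ^ ('n + 'n)) * R"
        by (intro mult_left_mono) auto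
      then show "norm (w h t) \<le> sqrt DIM(real ^ ('n + 'n)) * R + norm y0"
        using norm_le_infnorm[of "w h t - y0"] norm_triangle_sub[of "w h t" y0] by linarith
    qed
    show "integral {0..1} (\<lambda>x. \<psi> j 0 (t0 + x * h) *\<^sub>R
      ((\<Sum>l<r. \<psi> l 0 (t0 + x * h) *\<^sub>R a h l) - f (w h (t0 + x * h)))) = 0"
      if "h \<in> {0<..h0}" "j < r" for h j using wa that by blast
    show "0 \<le> K0" by (rule K0)
    show "(\<Sum>j<r. norm (b j) * h ^ j) \<le> K0 * \<epsilon>"
      if "h \<in> {0<..h0}" "continuous_on {0..1} \<eta>" "\<And>x. x \<in> {0..1} \<Longrightarrow> norm (\<eta> x) \<le> \<epsilon>"
        "\<And>j. j < r \<Longrightarrow> integral {0..1} (\<lambda>x. \<psi> j 0 (t0 + x * h) *\<^sub>R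
          ((\<Sum>l<r. \<psi> l 0 (t0 + x * h) *\<^sub>R b l) - \<eta> x)) = 0"
      for h and b :: "nat \<Rightarrow> real ^ ('n + 'n)" and \<eta> \<epsilon>
    proof -
      have "h \<in> {0<..h1}" using that(1) h0_le by auto
      then show ?thesis using stable[rule_format, of h \<eta> \<epsilon> b] that by blast
    qed
  qed
  have y_deriv: "(y has_vector_derivative f (y t)) (at t within {t0..t0 + h0})"
    if "t \<in> {t0..t0 + h0}" for t
    using that h0_le by (intro has_vector_derivative_within_subset[OF y_ode]) auto
  have ev: "\<forall>\<^sub>F h in at_right 0. h \<in> {0<..h0}"
    using h0_le(1) unfolding eventually_at_right_field by (intro exI[of _ h0]) auto
  obtain C1 where C1: "\<forall>h\<in>{0<..h0}. \<forall>t\<in>{t0..t0 + h}. norm (w h t - y t) \<le> C1 * h ^ (r + 1)"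
    using error_bound[OF y_init y_deriv] by blast
  obtain C2 where C2: "\<forall>h\<in>{0<..h0}. norm (w h (t0 + h) - y (t0 + h)) \<le> C2 * h ^ (2 * r + 1)"
    using end_error_bound[OF y_init y_deriv] by blast
  have "\<forall>\<tau>\<in>{0<..<1}. norm (u h \<tau> - y (t0 + \<tau> * h)) \<le> C1 * h ^ (r + 1)" if h: "h \<in> {0<..h0}" for h
    using C1 h scaled_mem[OF h] uw[OF h] by auto
  then have "\<forall>\<^sub>F h in at_right 0. \<forall>\<tau>\<in>{0<..<1}.
      norm (u h \<tau> - y (t0 + \<tau> * h)) \<le> C1 * h ^ (r + 1)"
    by (rule eventually_mono[OF ev])
  moreover have "norm (norm (u h 1 - y (t0 + h))) \<le> C2 * norm (h ^ (2 * r + 1))"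
    if h: "h \<in> {0<..h0}" for h
    using C2 h uw[OF h, of 1] by auto
  then have "(\<lambda>h. norm (u h 1 - y (t0 + h))) \<in> O[at_right 0](\<lambda>h. h ^ (2 * r + 1))"
    by (intro bigoI[of _ C2] eventually_mono[OF ev])
  ultimately show ?thesis by blast
qed

end
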